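(* Let $K$ be a convex body in $\mathbb{R}^d$, let $I$ be a random point uniformly distributed in $K$ and let $B$ be a random point uniformly distributed on the boundary $\partial K$. Assume that at least one of the following holds: (i) $d=2$ and $\mathbb{E} I=\mathbb{E} B$; (ii) $K$ is a circumscribed polytope whose inscribed sphere has center $O$ with $O=\mathbb{E} I=\mathbb{E} B$. Let $n\ge 1$ be an integer, let $I_1,\dots,I_n$ be independent random points, each uniformly distributed in $K$, and let $B_1,\dots,B_n$ be independent random points, each uniformly distributed on $\partial K$. Then for every real $p\ge 1$, $$\mathbb{E}\bigl[\mathrm{vol}_d(\mathrm{conv}\{I_1,\dots,I_n\})^p\bigr]\le\mathbb{E}\bigl[\mathrm{vol}_d(\mathrm{conv}\{B_1,\dots,B_n\})^p\bigr].$$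
   Context: A convex body in $\mathbb{R}^d$ is a compact convex set with nonempty interior. "Uniformly distributed in $K$" means with law equal to Lebesgue measure restricted to $K$, normalized to be a probability measure. "Uniformly distributed on $\partial K$" means with law equal to the surface measure (the $(d-1)$-dimensional Hausdorff measure) restricted to $\partial K$, normalized to be a probability measure. A circumscribed polytope is a convex polytope (with nonempty interior) that has an inscribed sphere, i.e. a sphere contained in the polytope and tangent to all of its facets ($(d-1)$-dimensional faces). Here $\mathrm{conv}$ denotes the convex hull and $\mathrm{vol}_d$ denotes $d$-dimensional Lebesgue measure. *)

theory Defs
  imports "HOL-Probability.Probability"
begin

definition convex_body :: "'a::euclidean_space set \<Rightarrow> bool" where
  "convex_body K \<longleftrightarrow> compact K \<and> convex K \<and> interior K \<noteq> {}"

(* The dimension is a natural number, so that diameter U ^ 0 = 1 for a singleton U and the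
   0-dimensional measure is counting measure. The boundedness condition is needed because
   diameter is unspecified on unbounded sets. *)
definition hausdorff_premeasure :: "nat \<Rightarrow> real \<Rightarrow> 'a::metric_space set \<Rightarrow> ennreal" where
  "hausdorff_premeasure k \<delta> A =
     (INF U \<in> {U :: nat \<Rightarrow> 'a set. (\<forall>i. bounded (U i) \<and> diameter (U i) \<le> \<delta>) \<and> A \<subseteq> (\<Union>i. U i)}.
        \<Sum>i. if U i = {} then 0 else ennreal (diameter (U i) ^ k))"

definition hausdorff_outer :: "nat \<Rightarrow> 'a::metric_space set \<Rightarrow> ennreal" where
  "hausdorff_outer k A = (SUP \<delta> \<in> {0<..}. hausdorff_premeasure k \<delta> A)"

(* No normalizing constant is included; it cancels in uniform_measure. Since hausdorff_outer is
   a metric outer measure, it is countably additive on Borel sets (Caratheodory), so measure_of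
   does not degenerate to the null measure. *)
definition hausdorff_measure :: "nat \<Rightarrow> 'a::metric_space measure" where
  "hausdorff_measure k = measure_of UNIV (sets borel) (hausdorff_outer k)"

definition uniform_in :: "'w measure \<Rightarrow> ('w \<Rightarrow> 'a::euclidean_space) \<Rightarrow> 'a set \<Rightarrow> bool" where
  "uniform_in M X K \<longleftrightarrow>
     X \<in> borel_measurable M \<and> distr M borel X = uniform_measure lborel K"

definition uniform_on_boundary :: "'w measure \<Rightarrow> ('w \<Rightarrow> 'a::euclidean_space) \<Rightarrow> 'a set \<Rightarrow> bool" where
  "uniform_on_boundary M X K \<longleftrightarrow>
     X \<in> borel_measurable M \<and>
     distr M borel X = uniform_measure (hausdorff_measure (DIM('a) - 1)) (frontier K)"

(* The hyperplane spanned by F touches the sphere in exactly one point, which lies in F. *)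
definition sphere_tangent_to :: "'a::euclidean_space \<Rightarrow> real \<Rightarrow> 'a set \<Rightarrow> bool" where
  "sphere_tangent_to c r F \<longleftrightarrow> (\<exists>x\<in>F. affine hull F \<inter> sphere c r = {x})"

definition inscribed_sphere :: "'a::euclidean_space set \<Rightarrow> 'a \<Rightarrow> real \<Rightarrow> bool" where
  "inscribed_sphere K c r \<longleftrightarrow>
     r > 0 \<and> sphere c r \<subseteq> K \<and> (\<forall>F. F facet_of K \<longrightarrow> sphere_tangent_to c r F)"

definition circumscribed_polytope :: "'a::euclidean_space set \<Rightarrow> bool" where
  "circumscribed_polytope K \<longleftrightarrow>
     polytope K \<and> interior K \<noteq> {} \<and> (\<exists>c r. inscribed_sphere K c r)"

end

theory Submission
  imports Defs
begin

text \<open>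
  The functional \<open>(x\<^sub>1, \<dots>, x\<^sub>n) \<mapsto> vol (conv {x\<^sub>1, \<dots>, x\<^sub>n})\<^sup>p\<close> is convex in each point separately: as one
  point moves along a line, the length of the chord cut from the hull by any fixed
  line parallel to it is a convex function of the position. By independence the points may be replaced one at a time, so it
  suffices that the uniform law on the body is dominated by the uniform law on the boundary in the
  convex order.

  For a circumscribed polytope the cones from the centre over the facets have a common height,
  hence the radial projection from the centre maps the law in the body to the law on the boundary.
  A convex function minus its tangent at the centre increases along rays from its minimum there,
  and the affine part is settled by the equality of the means.

  In the plane, a piecewise affine convex function \<open>f\<close> agrees on the boundary with some function
  \<open>F \<ge> f\<close> that is an affine function plus a positive combination of ramps
  \<open>max 0 (u \<bullet> x - t)\<close>, so it suffices to compare ramps. If the difference of the expectations of the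
  ramps in a direction \<open>u\<close> were negative somewhere, then at its minimum \<open>s\<close> both caps cut off by
  the line \<open>u \<bullet> x = s\<close> would carry at least as large a fraction of the perimeter as of the area. On the side
  where the chords orthogonal to \<open>u\<close> decrease, the ratio of these fractions only grows towards
  the tip, which makes the difference at \<open>s\<close> nonnegative.
\<close>

section \<open>Hausdorff measure\<close>

text \<open>Of the surface measure only a few facts enter: on Borel sets it has the values of the
  outer measure, isometries preserve it, maps with Lipschitz constant 1 do not increase the outer
  measure, inscribed polygons approximate monotone arcs, and the boundary has finite positive mass.
  That it is a genuine measure follows from the mere existence of a random point with the uniform
  law on the boundary; constants of proportionality are carried along until they cancel. A convex
  function of two variables need not be a mixture of ramps, so only its boundary values are
  reproduced. The majorant interpolates them over a triangulation of an inscribed polygon whose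
  vertices include the ends of all creases, and each chord of the triangulation carries one ramp
  that vanishes on the side away from its cap. The growth of perimeter over area rests on one
  height, at which the chord has shrunk to half its length: it is low enough for the perimeter to
  pay for the prolonged chords, and high enough for the area of the cap to be at most that of a
  rectangle of this height.\<close>

lemma diameter_lipschitz_image:
  fixes T :: "'a::metric_space \<Rightarrow> 'b::metric_space"
  assumes T: "\<And>x y. dist (T x) (T y) \<le> dist x y" and "bounded S"
  shows "bounded (T ` S)" "diameter (T ` S) \<le> diameter S"
proof -
  obtain a e where "\<forall>y\<in>S. dist a y \<le> e"
    using \<open>bounded S\<close> unfolding bounded_def by blast
  then have "\<forall>y\<in>T ` S. dist (T a) y \<le> e"
    by (auto intro: order_trans[OF T])
  then show "bounded (T ` S)"
    unfolding bounded_def by blast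
  show "diameter (T ` S) \<le> diameter S"
  proof (cases "S = {}")
    case False
    have "dist x y \<le> diameter S" if "x \<in> T ` S" "y \<in> T ` S" for x y
      using that by (auto intro: order_trans[OF T] diameter_bounded_bound[OF \<open>bounded S\<close>])
    then show ?thesis
      using False diameter_def[of "T ` S"] by (auto intro!: cSUP_least)
  qed simp
qed

text \<open>The images of the sets of a cover form a cover of the image with no larger diameters. An
  image is empty only when the set is, so the convention that empty sets contribute 0 is
  respected.\<close>

lemma hausdorff_premeasure_lipschitz_image:
  fixes T :: "'a::metric_space \<Rightarrow> 'b::metric_space"
  assumes T: "\<And>x y. dist (T x) (T y) \<le> dist x y"
  shows "hausdorff_premeasure k \<delta> (T ` A) \<le> hausdorff_premeasure k \<delta> A"
  unfolding hausdorff_premeasure_def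
proof (rule INF_mono, goal_cases)
  case (1 U)
  then have U: "\<And>i. bounded (U i)" "\<And>i. diameter (U i) \<le> \<delta>" "A \<subseteq> (\<Union>i. U i)"
    by auto
  let ?V = "\<lambda>i. T ` U i"
  have V: "bounded (?V i)" "diameter (?V i) \<le> diameter (U i)" for i
    using diameter_lipschitz_image[where T = T, OF T U(1)] by auto
  show ?case
  proof (intro bexI[of _ ?V] suminf_le)
    show "(if T ` U i = {} then 0 else ennreal (diameter (T ` U i) ^ k))
        \<le> (if U i = {} then 0 else ennreal (diameter (U i) ^ k))" for i
      using V[of i] by (auto intro!: ennreal_leI power_mono diameter_ge_0)
    show "?V \<in> {U. (\<forall>i. bounded (U i) \<and> diameter (U i) \<le> \<delta>) \<and> T ` A \<subseteq> \<Union> (range U)}"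
      using U V by (auto intro: order_trans[OF V(2)] simp flip: image_UN)
  qed auto
qed

lemma hausdorff_outer_lipschitz_image:
  fixes T :: "'a::metric_space \<Rightarrow> 'b::metric_space"
  assumes T: "\<And>x y. dist (T x) (T y) \<le> dist x y"
  shows "hausdorff_outer k (T ` A) \<le> hausdorff_outer k A"
  unfolding hausdorff_outer_def
  using hausdorff_premeasure_lipschitz_image[where T = T, OF T] by (intro SUP_mono) blast

lemma hausdorff_outer_isometry_image:
  fixes T :: "'a::metric_space \<Rightarrow> 'b::metric_space"
  assumes T: "\<And>x y. dist (T x) (T y) = dist x y" and "bij T"
  shows "hausdorff_outer k (T ` A) = hausdorff_outer k A"
proof (rule antisym)
  have "dist (inv T x) (inv T y) = dist x y" for x y
    by (metis T \<open>bij T\<close> bij_inv_eq_iff)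
  then have "hausdorff_outer k (inv T ` (T ` A)) \<le> hausdorff_outer k (T ` A)"
    by (intro hausdorff_outer_lipschitz_image) simp
  moreover have "inv T ` (T ` A) = A"
    by (simp add: \<open>bij T\<close> bij_is_inj image_inv_f_f)
  ultimately show "hausdorff_outer k A \<le> hausdorff_outer k (T ` A)"
    by simp
qed (simp add: T hausdorff_outer_lipschitz_image)

text \<open>Each set of a cover lies between its infimum and its supremum, which are at most a
  diameter apart, and Lebesgue measure is countably subadditive. The scale 1 in the proof is
  arbitrary, because the outer measure is a supremum over all scales. Together with projections this
  yields the lower bounds for the perimeter.\<close>

lemma emeasure_interval_le_hausdorff_outer:
  fixes A :: "real set"
  assumes "{\<alpha><..<\<beta>} \<subseteq> A"
  shows "ennreal (\<beta> - \<alpha>) \<le> hausdorff_outer 1 A"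
proof -
  have "ennreal (\<beta> - \<alpha>) \<le> hausdorff_premeasure 1 1 A"
    unfolding hausdorff_premeasure_def
  proof (rule INF_greatest, goal_cases)
    case (1 U)
    then have U: "\<And>i. bounded (U i)" "A \<subseteq> (\<Union>i. U i)"
      by auto
    define V where "V i = (if U i = {} then {} else {Inf (U i)..Sup (U i)})" for i
    have bdd: "bdd_above (U i)" "bdd_below (U i)" for i
      using U(1) bounded_imp_bdd_above bounded_imp_bdd_below by auto
    have UV: "U i \<subseteq> V i" for i
      using bdd[of i] by (auto simp: V_def intro: cInf_lower cSup_upper)
    have *: "emeasure lborel (V i) \<le> (if U i = {} then 0 else ennreal (diameter (U i) ^ 1))" for i
    proof (cases "U i = {}")
      case False
      have "x - y \<le> diameter (U i)" if "x \<in> U i" "y \<in> U i" for x y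
        using diameter_bounded_bound[OF U(1) that] by (simp add: dist_real_def)
      then have "Sup (U i) \<le> diameter (U i) + y" if "y \<in> U i" for y
        using that False by (intro cSup_least) (auto simp: algebra_simps)
      then have "Sup (U i) - diameter (U i) \<le> Inf (U i)"
        using False by (intro cInf_greatest) (auto simp: algebra_simps)
      moreover have "Inf (U i) \<le> Sup (U i)"
        using False bdd cInf_le_cSup by blast
      ultimately show ?thesis
        using False by (auto simp: V_def intro!: ennreal_leI)
    qed (simp add: V_def)
    have "ennreal (\<beta> - \<alpha>) \<le> emeasure lborel {\<alpha><..<\<beta>}"
      by (cases "\<alpha> \<le> \<beta>") (auto simp: ennreal_neg)
    also have "\<dots> \<le> emeasure lborel (\<Union>i. V i)"
    proof (rule emeasure_mono)
      show "{\<alpha><..<\<beta>} \<subseteq> (\<Union>i. V i)"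
        using assms U(2) UV by blast
    qed (auto simp: V_def)
    also have "\<dots> \<le> (\<Sum>i. emeasure lborel (V i))"
      by (intro emeasure_subadditive_countably) (auto simp: V_def)
    also have "\<dots> \<le> (\<Sum>i. if U i = {} then 0 else ennreal (diameter (U i) ^ 1))"
      by (intro suminf_le *) auto
    finally show ?case .
  qed
  also have "\<dots> \<le> hausdorff_outer 1 A"
    unfolding hausdorff_outer_def by (rule SUP_upper) simp
  finally show ?thesis .
qed

text \<open>A degenerate \<open>measure_of\<close> would be null, and a null measure cannot be normalized.\<close>
lemma hausdorff_measure_normalizable:
  fixes S A :: "'a::metric_space set"
  assumes P: "prob_space (uniform_measure (hausdorff_measure k) S)" and S: "S \<in> sets borel"
  shows "A \<in> sets borel \<Longrightarrow> emeasure (hausdorff_measure k) A = hausdorff_outer k A"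
    and "emeasure (hausdorff_measure k) S \<noteq> 0" "emeasure (hausdorff_measure k) S \<noteq> \<infinity>"
proof -
  let ?H = "hausdorff_measure k :: 'a measure"
  have sb: "sigma_sets UNIV (sets borel) = sets (borel :: 'a measure)"
    by (metis sets.sigma_sets_eq space_borel)
  have sets: "sets ?H = sets borel"
    unfolding hausdorff_measure_def by (simp add: sb sets_measure_of_conv)
  then have space: "space ?H = UNIV"
    using sets_eq_imp_space_eq[OF sets] by simp
  have "emeasure (uniform_measure ?H S) UNIV = 1"
    using prob_space.emeasure_space_1[OF P] space by (simp add: space_uniform_measure)
  moreover have "emeasure (uniform_measure ?H S) UNIV = emeasure ?H S / emeasure ?H S"
    using S sets by (subst emeasure_uniform_measure) (auto simp: Int_UNIV_right)
  ultimately have *: "emeasure ?H S / emeasure ?H S = 1"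
    by simp
  show "emeasure ?H S \<noteq> 0"
    using * by auto
  show "emeasure ?H S \<noteq> \<infinity>"
    using * by (auto simp: divide_ennreal_def)
  show "emeasure ?H A = hausdorff_outer k A" if "A \<in> sets borel"
    using \<open>emeasure ?H S \<noteq> 0\<close> that unfolding hausdorff_measure_def
    by (auto simp: emeasure_measure_of_conv sb split: if_splits)
qed

lemma sets_hausdorff_measure [measurable_cong, simp]:
  "sets (hausdorff_measure k :: 'a::metric_space measure) = sets borel"
  unfolding hausdorff_measure_def
  by (metis UNIV_I sets.sigma_sets_eq sets_measure_of_conv space_borel subset_UNIV Pow_UNIV)

lemma space_hausdorff_measure [simp]:
  "space (hausdorff_measure k :: 'a::metric_space measure) = UNIV"
  using sets_eq_imp_space_eq[OF sets_hausdorff_measure] by simp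

text \<open>The assumption concerns the source only. On Borel sets the outer measure of the target
  coincides with the pushforward, which is a measure, so \<open>measure_of\<close> does not
  degenerate in the target either.\<close>

lemma hausdorff_measure_isometry:
  fixes T :: "'a::metric_space \<Rightarrow> 'b::metric_space"
  assumes T: "\<And>x y. dist (T x) (T y) = dist x y" and "bij T"
    and H: "\<And>A. A \<in> sets borel \<Longrightarrow> emeasure (hausdorff_measure k :: 'a measure) A = hausdorff_outer k A"
  shows "distr (hausdorff_measure k) borel T = (hausdorff_measure k :: 'b measure)"
proof -
  have "continuous_on UNIV T"
    unfolding continuous_on_iff by (auto simp: T)
  then have [measurable]: "T \<in> borel_measurable borel"
    by (rule borel_measurable_continuous_onI)
  let ?D = "distr (hausdorff_measure k) borel T"
  have "hausdorff_outer k A = emeasure ?D A" if "A \<in> sets borel" for A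
  proof -
    have "T ` (T -` A) = A"
      using \<open>bij T\<close> by (simp add: bij_is_surj)
    then show ?thesis
      using H[of "T -` A"] that hausdorff_outer_isometry_image[OF T \<open>bij T\<close>, of k "T -` A"]
        measurable_sets[of T borel borel A]
      by (auto simp: emeasure_distr)
  qed
  then have "measure_of UNIV (sets borel) (hausdorff_outer k) = measure_of UNIV (sets borel) (emeasure ?D)"
    by (intro measure_of_eq) (auto, metis sets.sigma_sets_eq space_borel)
  also have "\<dots> = ?D"
    using measure_of_of_measure[of ?D] by simp
  finally show ?thesis
    unfolding hausdorff_measure_def by simp
qed

section \<open>Invariance of Lebesgue measure\<close>

text \<open>The uniqueness argument for Haar measure: the double integral of
  \<open>indicator A x * indicator B (x + y)\<close> is evaluated in both orders, with the
  substitution of \<open>x - y\<close> for \<open>x\<close> in between. The subspace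
  \<open>V\<close> lets the result apply to measures concentrated on a hyperplane, for which
  invariance holds along the hyperplane.\<close>

lemma translation_invariant_swap:
  fixes \<mu> \<nu> :: "'a::euclidean_space measure"
  assumes sets [measurable_cong]: "sets \<mu> = sets borel" "sets \<nu> = sets borel"
    and "sigma_finite_measure \<mu>" "sigma_finite_measure \<nu>"
    and V: "subspace V" "AE x in \<mu>. x \<in> V" "AE x in \<nu>. x \<in> V"
    and inv\<mu>: "\<And>v A. v \<in> V \<Longrightarrow> A \<in> sets borel \<Longrightarrow> emeasure \<mu> {x. x + v \<in> A} = emeasure \<mu> A"
    and inv\<nu>: "\<And>v A. v \<in> V \<Longrightarrow> A \<in> sets borel \<Longrightarrow> emeasure \<nu> {x. x + v \<in> A} = emeasure \<nu> A"
    and [measurable]: "A \<in> sets borel" "B \<in> sets borel"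
  shows "emeasure \<nu> A * emeasure \<mu> B = emeasure \<nu> B * emeasure \<mu> {x. - x \<in> A}"
proof -
  interpret \<mu>: sigma_finite_measure \<mu> by fact
  interpret \<nu>: sigma_finite_measure \<nu> by fact
  interpret pair_sigma_finite \<nu> \<mu> ..
  have sp [simp]: "space \<mu> = UNIV" "space \<nu> = UNIV"
    using sets sets_eq_imp_space_eq[of _ borel] by auto
  let ?I = "\<lambda>x y. indicator A x * indicator B (x + y) :: ennreal"
  let ?J = "\<lambda>x y. indicator A (x - y) * indicator B x :: ennreal"
  have "emeasure \<nu> A * emeasure \<mu> B = (\<integral>\<^sup>+x. indicator A x * emeasure \<mu> B \<partial>\<nu>)"
    by (simp add: nn_integral_multc sets)
  also have "\<dots> = (\<integral>\<^sup>+x. \<integral>\<^sup>+y. ?I x y \<partial>\<mu> \<partial>\<nu>)"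
  proof (rule nn_integral_cong_AE)
    show "AE x in \<nu>. indicator A x * emeasure \<mu> B = (\<integral>\<^sup>+y. ?I x y \<partial>\<mu>)"
      using V(3)
    proof eventually_elim
      case (elim x)
      have "(\<integral>\<^sup>+y. ?I x y \<partial>\<mu>) = (\<integral>\<^sup>+y. indicator A x * indicator {y. y + x \<in> B} y \<partial>\<mu>)"
        by (intro nn_integral_cong) (auto simp: indicator_def add.commute)
      also have "\<dots> = indicator A x * emeasure \<mu> {y. y + x \<in> B}"
        by (intro nn_integral_cmult_indicator) (simp add: sets)
      finally show ?case
        using inv\<mu>[OF elim] by simp
    qed
  qed
  also have "\<dots> = (\<integral>\<^sup>+y. \<integral>\<^sup>+x. ?I x y \<partial>\<nu> \<partial>\<mu>)"
    by (rule Fubini'[symmetric]) measurable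
  also have "\<dots> = (\<integral>\<^sup>+y. \<integral>\<^sup>+x. ?J x y \<partial>\<nu> \<partial>\<mu>)"
  proof (rule nn_integral_cong_AE)
    show "AE y in \<mu>. (\<integral>\<^sup>+x. ?I x y \<partial>\<nu>) = (\<integral>\<^sup>+x. ?J x y \<partial>\<nu>)"
      using V(2)
    proof eventually_elim
      case (elim y)
      let ?C = "{x. x - y \<in> A \<and> x \<in> B}"
      have C: "?C \<in> sets borel"
        by measurable
      have "(\<integral>\<^sup>+x. ?I x y \<partial>\<nu>) = (\<integral>\<^sup>+x. indicator {x. x + y \<in> ?C} x \<partial>\<nu>)"
        by (intro nn_integral_cong) (auto simp: indicator_def)
      also have "\<dots> = emeasure \<nu> {x. x + y \<in> ?C}"
        by (intro nn_integral_indicator) (simp add: sets)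
      also have "\<dots> = emeasure \<nu> ?C"
        by (rule inv\<nu>[OF elim C])
      also have "\<dots> = (\<integral>\<^sup>+x. indicator ?C x \<partial>\<nu>)"
        using C by (intro nn_integral_indicator[symmetric]) (simp add: sets)
      also have "\<dots> = (\<integral>\<^sup>+x. ?J x y \<partial>\<nu>)"
        by (intro nn_integral_cong) (auto simp: indicator_def)
      finally show ?case .
    qed
  qed
  also have "\<dots> = (\<integral>\<^sup>+x. \<integral>\<^sup>+y. ?J x y \<partial>\<mu> \<partial>\<nu>)"
    by (rule Fubini') measurable
  also have "\<dots> = (\<integral>\<^sup>+x. indicator B x * emeasure \<mu> {x. - x \<in> A} \<partial>\<nu>)"
  proof (rule nn_integral_cong_AE)
    show "AE x in \<nu>. (\<integral>\<^sup>+y. ?J x y \<partial>\<mu>) = indicator B x * emeasure \<mu> {x. - x \<in> A}"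
      using V(3)
    proof eventually_elim
      case (elim x)
      let ?C = "{y. - y \<in> A}"
      have C: "?C \<in> sets borel"
        by measurable
      have "(\<integral>\<^sup>+y. ?J x y \<partial>\<mu>) = (\<integral>\<^sup>+y. indicator B x * indicator {y. y + - x \<in> ?C} y \<partial>\<mu>)"
        by (intro nn_integral_cong) (auto simp: indicator_def)
      also have "\<dots> = indicator B x * emeasure \<mu> {y. y + - x \<in> ?C}"
        by (intro nn_integral_cmult_indicator) (simp add: sets)
      also have "emeasure \<mu> {y. y + - x \<in> ?C} = emeasure \<mu> ?C"
        using V(1) elim by (intro inv\<mu> C subspace_neg)
      finally show ?case .
    qed
  qed
  also have "\<dots> = emeasure \<nu> B * emeasure \<mu> {x. - x \<in> A}"
    by (simp add: nn_integral_multc sets)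
  finally show ?thesis .
qed

text \<open>Comparing \<open>\<mu>\<close> with itself on \<open>A\<close> and \<open>C\<close>
  shows that \<open>\<mu>\<close> is symmetric under negation, since the mass of \<open>C\<close>
  can be cancelled. This removes the reflection from the swapped identity.\<close>

lemma translation_invariant_unique:
  fixes \<mu> \<nu> :: "'a::euclidean_space measure"
  assumes sets: "sets \<mu> = sets borel" "sets \<nu> = sets borel"
    and sf: "sigma_finite_measure \<mu>" "sigma_finite_measure \<nu>"
    and V: "subspace V" "AE x in \<mu>. x \<in> V" "AE x in \<nu>. x \<in> V"
    and inv\<mu>: "\<And>v A. v \<in> V \<Longrightarrow> A \<in> sets borel \<Longrightarrow> emeasure \<mu> {x. x + v \<in> A} = emeasure \<mu> A"
    and inv\<nu>: "\<And>v A. v \<in> V \<Longrightarrow> A \<in> sets borel \<Longrightarrow> emeasure \<nu> {x. x + v \<in> A} = emeasure \<nu> A"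
    and C: "C \<in> sets borel" "emeasure \<mu> C \<noteq> 0" "emeasure \<mu> C \<noteq> \<infinity>"
    and AB: "A \<in> sets borel" "B \<in> sets borel"
  shows "emeasure \<nu> A * emeasure \<mu> B = emeasure \<nu> B * emeasure \<mu> A"
proof -
  have "emeasure \<mu> A * emeasure \<mu> C = emeasure \<mu> C * emeasure \<mu> {x. - x \<in> A}"
    by (rule translation_invariant_swap[OF sets(1,1) sf(1,1) V(1,2,2) inv\<mu> inv\<mu> AB(1) C(1)])
  then have "emeasure \<mu> {x. - x \<in> A} = emeasure \<mu> A"
    using C by (auto simp only: mult.commute[of "emeasure \<mu> A"] ennreal_mult_cancel_left infinity_ennreal_def)
  moreover have "emeasure \<nu> A * emeasure \<mu> B = emeasure \<nu> B * emeasure \<mu> {x. - x \<in> A}"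
    by (rule translation_invariant_swap[OF sets sf V inv\<mu> inv\<nu> AB])
  ultimately show ?thesis
    by (simp only:)
qed

lemma lborel_translate:
  assumes "A \<in> sets borel"
  shows "emeasure lborel {x. x + v \<in> A} = emeasure lborel (A :: 'a::euclidean_space set)"
proof -
  have "emeasure lborel A = emeasure (distr lborel borel ((+) v)) A"
    by (simp add: lborel_distr_plus)
  also have "\<dots> = emeasure lborel ((+) v -` A)"
    using assms by (subst emeasure_distr) auto
  also have "(+) v -` A = {x. x + v \<in> A}"
    by (auto simp: add.commute)
  finally show ?thesis by simp
qed

section \<open>Linear isometries and uniform laws\<close>

text \<open>Source and target may be different types, so the notion covers coordinate maps onto
  \<open>real \<times> real\<close> as well as reflections and rotations. The right inverse
  \<open>S\<close> encodes surjectivity and turns images under \<open>T\<close> into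
  preimages.\<close>

locale linear_isometry =
  fixes T :: "'a::euclidean_space \<Rightarrow> 'b::euclidean_space" and S :: "'b \<Rightarrow> 'a"
  assumes linear_T: "linear T" and norm_T: "norm (T x) = norm x" and TS: "T (S y) = y"
begin

lemma dist_T: "dist (T x) (T y) = dist x y"
  using norm_T[of "x - y"] linear_diff[OF linear_T] by (simp add: dist_norm)

lemma ST: "S (T x) = x"
proof -
  have "dist (S (T x)) x = dist (T (S (T x))) (T x)"
    by (rule dist_T[symmetric])
  then show ?thesis
    by (simp add: TS)
qed

lemma bij_T: "bij T"
  using ST TS by (intro o_bij[of S]) auto

lemma linear_S: "linear S"
proof (rule linearI)
  show "S (x + y) = S x + S y" for x y
  proof -
    have "T (S x + S y) = x + y"
      by (simp add: linear_add[OF linear_T] TS)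
    then show ?thesis
      using ST[of "S x + S y"] by simp
  qed
  show "S (c *\<^sub>R x) = c *\<^sub>R S x" for c x
  proof -
    have "T (c *\<^sub>R S x) = c *\<^sub>R x"
      by (simp add: linear_scale[OF linear_T] TS)
    then show ?thesis
      using ST[of "c *\<^sub>R S x"] by simp
  qed
qed

lemma image_T: "T ` X = S -` X"
  using ST TS by (auto simp: image_iff) metis

lemma vimage_image_T: "T -` T ` X = X"
  using bij_T by (simp add: inj_vimage_image_eq bij_is_inj)

lemma continuous_T: "continuous_on A T" and continuous_S: "continuous_on B S"
  using linear_T linear_S by (auto simp: linear_continuous_on linear_conv_bounded_linear)

lemma measurable_T [measurable]: "T \<in> borel_measurable borel"
  and measurable_S [measurable]: "S \<in> borel_measurable borel"
  using continuous_T continuous_S by (auto intro: borel_measurable_continuous_onI)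

lemma image_T_borel: "X \<in> sets borel \<Longrightarrow> T ` X \<in> sets borel"
  using measurable_sets[OF measurable_S, of X] by (simp add: image_T)

lemma inner_T: "T x \<bullet> y = x \<bullet> S y"
proof -
  have "T x \<bullet> T z = x \<bullet> z" for z
    unfolding dot_norm using norm_T by (simp add: linear_add[OF linear_T, symmetric])
  from this[of "S y"] show ?thesis
    by (simp add: TS)
qed

lemma interior_T: "interior (T ` X) = T ` interior X"
proof
  have "open (T ` interior X)"
    unfolding image_T by (intro open_vimage continuous_S) auto
  then show "T ` interior X \<subseteq> interior (T ` X)"
    by (intro interior_maximal image_mono interior_subset)
  have "open (T -` interior (T ` X))"
    by (intro open_vimage continuous_T) auto
  moreover have "T -` interior (T ` X) \<subseteq> X"
    using vimage_mono[OF interior_subset[of "T ` X"], of T] by (simp only: vimage_image_T)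
  ultimately have "T -` interior (T ` X) \<subseteq> interior X"
    by (rule interior_maximal[rotated])
  then have "T ` (T -` interior (T ` X)) \<subseteq> T ` interior X"
    by (rule image_mono)
  then show "interior (T ` X) \<subseteq> T ` interior X"
    by (simp only: surj_image_vimage_eq[OF bij_is_surj[OF bij_T]])
qed

lemma frontier_T: "frontier (T ` X) = T ` frontier X"
  unfolding frontier_def interior_T
  using closure_injective_linear_image[OF linear_T bij_is_inj[OF bij_T], of X]
  by (simp add: image_set_diff bij_is_inj[OF bij_T])

lemma convex_body_T: "convex_body X \<Longrightarrow> convex_body (T ` X)"
  unfolding convex_body_def interior_T
  by (auto intro: compact_continuous_image continuous_T convex_linear_image linear_T)

text \<open>The pushforward of Lebesgue measure is again translation invariant, hence proportional
  to Lebesgue measure of the target. The factor is left implicit in the product form; it cancels in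
  uniform laws.\<close>

lemma lborel_T:
  assumes AB: "A \<in> sets borel" "B \<in> sets borel"
  shows "emeasure lborel (T -` A) * emeasure lborel B = emeasure lborel (T -` B) * emeasure lborel A"
proof -
  let ?\<nu> = "distr lborel borel T"
  have e: "emeasure ?\<nu> X = emeasure lborel (T -` X)" if "X \<in> sets borel" for X
    using that by (subst emeasure_distr) auto
  have inv: "emeasure ?\<nu> {x. x + v \<in> X} = emeasure ?\<nu> X" if X: "X \<in> sets borel" for v X
  proof -
    have [measurable]: "X \<in> sets borel" by fact
    have "T -` {x. x + v \<in> X} = {z. z + S v \<in> T -` X}"
      by (auto simp: linear_add[OF linear_T] TS)
    moreover have "T -` X \<in> sets borel"
      using measurable_sets[OF measurable_T X] by simp
    ultimately show ?thesis
      using e[OF X] e[of "{x. x + v \<in> X}"] lborel_translate[of "T -` X" "S v"] by simp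
  qed
  have "sigma_finite_measure ?\<nu>"
  proof
    obtain Q where Q: "countable Q" "Q \<subseteq> sets (lborel :: 'a measure)" "\<Union>Q = UNIV" "\<forall>a\<in>Q. emeasure lborel a \<noteq> \<infinity>"
      using lborel.sigma_finite_countable by auto
    have "emeasure ?\<nu> (T ` a) = emeasure lborel a" if "a \<in> Q" for a
      using e[of "T ` a"] that Q(2) image_T_borel[of a] by (auto simp: vimage_image_T)
    moreover have "T ` a \<in> sets borel" if "a \<in> Q" for a
      using that Q(2) image_T_borel by auto
    moreover have "(\<Union>a\<in>Q. T ` a) = UNIV"
      using Q(3) bij_T by (metis bij_is_surj image_Union)
    ultimately show "\<exists>A. countable A \<and> A \<subseteq> sets ?\<nu> \<and> \<Union> A = space ?\<nu> \<and> (\<forall>a\<in>A. emeasure ?\<nu> a \<noteq> \<infinity>)"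
      using Q(1,4) by (intro exI[of _ "(`) T ` Q"]) auto
  qed
  moreover have "emeasure lborel (cbox 0 (One :: 'b)) \<noteq> 0" "emeasure lborel (cbox 0 (One :: 'b)) \<noteq> \<infinity>"
    by (auto simp: emeasure_lborel_cbox_eq)
  ultimately have "emeasure ?\<nu> A * emeasure lborel B = emeasure ?\<nu> B * emeasure lborel A"
    using inv lborel_translate lborel.sigma_finite_measure_axioms AB
    by (intro translation_invariant_unique[where V = UNIV and C = "cbox 0 One"]) auto
  then show ?thesis
    using e AB by simp
qed

end

lemma ennreal_cross_divide:
  fixes a b k m :: ennreal
  assumes "a * m = k * b" "k \<noteq> 0" "k \<noteq> \<infinity>" "m \<noteq> 0" "m \<noteq> \<infinity>"
  shows "a / k = b / m"
  by (metis assms divide_mult_eq mult.commute)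

lemma convex_body_emeasure:
  assumes "convex_body K"
  shows "K \<in> sets borel" "emeasure lborel K \<noteq> 0" "emeasure lborel K \<noteq> \<infinity>"
proof -
  show K: "K \<in> sets borel"
    using assms by (auto simp: convex_body_def compact_imp_closed)
  show "emeasure lborel K \<noteq> \<infinity>"
    using assms emeasure_bounded_finite[OF compact_imp_bounded, of K] by (auto simp: convex_body_def)
  obtain x e where xe: "e > 0" "ball x e \<subseteq> K"
    using assms by (auto simp: convex_body_def mem_interior)
  have "0 < emeasure lborel (ball x e)"
    using content_ball_pos[OF xe(1), of x] by (auto simp: measure_def zero_less_iff_neq_zero)
  also have "\<dots> \<le> emeasure lborel K"
    using xe K by (intro emeasure_mono) auto
  finally show "emeasure lborel K \<noteq> 0"
    by simp
qed

context linear_isometry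
begin

lemma uniform_lborel_T:
  assumes K: "convex_body K"
  shows "distr (uniform_measure lborel K) borel T = uniform_measure lborel (T ` K)"
proof (rule measure_eqI)
  fix X assume "X \<in> sets (distr (uniform_measure lborel K) borel T)"
  then have X: "X \<in> sets borel" by simp
  note TK = convex_body_emeasure[OF convex_body_T[OF K]] and K' = convex_body_emeasure[OF K]
  have TX: "T -` X \<in> sets borel"
    using measurable_sets[OF measurable_T X] by simp
  have "emeasure lborel (K \<inter> T -` X) * emeasure lborel (T ` K) = emeasure lborel K * emeasure lborel (T ` K \<inter> X)"
    using lborel_T[of "T ` K \<inter> X" "T ` K"] X TK by (simp add: vimage_image_T)
  then have "emeasure lborel (K \<inter> T -` X) / emeasure lborel K = emeasure lborel (T ` K \<inter> X) / emeasure lborel (T ` K)"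
    by (rule ennreal_cross_divide) (use TK K' in auto)
  then show "emeasure (distr (uniform_measure lborel K) borel T) X = emeasure (uniform_measure lborel (T ` K)) X"
    using X TX K' TK by (simp add: emeasure_distr emeasure_uniform_measure)
qed simp

end

text \<open>The unit ball is its own preimage, so the factor of proportionality is 1.\<close>

lemma lborel_isometry:
  fixes T :: "'a::euclidean_space \<Rightarrow> 'a"
  assumes "linear_isometry T S" and A: "A \<in> sets borel"
  shows "emeasure lborel (T -` A) = emeasure lborel A"
proof -
  interpret linear_isometry T S by fact
  let ?B = "ball 0 1 :: 'a set"
  have "T -` ?B = ?B"
    using norm_T by auto
  then have "emeasure lborel (T -` A) * emeasure lborel ?B = emeasure lborel A * emeasure lborel ?B"
    using lborel_T[OF A, of ?B] by (simp add: mult.commute)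
  moreover have "emeasure lborel ?B \<noteq> 0"
    using content_ball_pos[of 1 "0 :: 'a"] by (auto simp: measure_def)
  moreover have "emeasure lborel ?B \<noteq> \<infinity>"
    using emeasure_bounded_finite[of ?B] by auto
  ultimately show ?thesis
    by (auto simp only: mult.commute[of _ "emeasure lborel ?B"] ennreal_mult_cancel_left infinity_ennreal_def)
qed

section \<open>Fubini along a direction, and shears\<close>

text \<open>Fubini along \<open>w\<close> without coordinates adapted to it. The outer integral runs
  over a full-dimensional slab orthogonal to \<open>w\<close> of thickness \<open>norm w\<close>, so
  that every point is brought into the slab by shifts along \<open>w\<close> with parameters of
  total length 1.\<close>

lemma emeasure_lborel_lines:
  fixes w :: "'a::euclidean_space"
  assumes w: "w \<noteq> 0" and [measurable]: "A \<in> sets borel"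
  shows "emeasure lborel A = (\<integral>\<^sup>+y. indicator {y. 0 \<le> y \<bullet> w \<and> y \<bullet> w < w \<bullet> w} y
     * emeasure lborel {\<tau>. y + \<tau> *\<^sub>R w \<in> A} \<partial>lborel)"
proof -
  let ?E = "{y. 0 \<le> y \<bullet> w \<and> y \<bullet> w < w \<bullet> w}"
  have [measurable]: "?E \<in> sets borel"
    by measurable
  let ?I = "\<lambda>y \<tau>. indicator ?E y * indicator A (y + \<tau> *\<^sub>R w) :: ennreal"
  let ?J = "\<lambda>y \<tau>. indicator ?E (y - \<tau> *\<^sub>R w) * indicator A y :: ennreal"
  have ww: "w \<bullet> w > 0"
    using w by simp
  have "(\<integral>\<^sup>+y. indicator ?E y * emeasure lborel {\<tau>. y + \<tau> *\<^sub>R w \<in> A} \<partial>lborel)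
      = (\<integral>\<^sup>+y. \<integral>\<^sup>+\<tau>. ?I y \<tau> \<partial>lborel \<partial>lborel)"
  proof (rule nn_integral_cong)
    fix y
    have "(\<integral>\<^sup>+\<tau>. ?I y \<tau> \<partial>lborel) = (\<integral>\<^sup>+\<tau>. indicator ?E y * indicator {\<tau>. y + \<tau> *\<^sub>R w \<in> A} \<tau> \<partial>lborel)"
      by (intro nn_integral_cong) (auto simp: indicator_def)
    also have "\<dots> = indicator ?E y * emeasure lborel {\<tau>. y + \<tau> *\<^sub>R w \<in> A}"
      by (intro nn_integral_cmult_indicator) simp
    finally show "indicator ?E y * emeasure lborel {\<tau>. y + \<tau> *\<^sub>R w \<in> A} = (\<integral>\<^sup>+\<tau>. ?I y \<tau> \<partial>lborel)" ..
  qed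
  also have "\<dots> = (\<integral>\<^sup>+\<tau>. \<integral>\<^sup>+y. ?I y \<tau> \<partial>lborel \<partial>lborel)"
    by (rule lborel_pair.Fubini'[symmetric]) measurable
  also have "\<dots> = (\<integral>\<^sup>+\<tau>. \<integral>\<^sup>+y. ?J y \<tau> \<partial>lborel \<partial>lborel)"
  proof (rule nn_integral_cong)
    fix \<tau> :: real
    let ?C = "{y. y - \<tau> *\<^sub>R w \<in> ?E \<and> y \<in> A}"
    have C: "?C \<in> sets borel"
      by measurable
    have "(\<integral>\<^sup>+y. ?I y \<tau> \<partial>lborel) = (\<integral>\<^sup>+y. indicator {y. y + \<tau> *\<^sub>R w \<in> ?C} y \<partial>lborel)"
      by (intro nn_integral_cong) (auto simp: indicator_def)
    also have "\<dots> = emeasure lborel {y. y + \<tau> *\<^sub>R w \<in> ?C}"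
      by (intro nn_integral_indicator) simp
    also have "\<dots> = emeasure lborel ?C"
      by (rule lborel_translate[OF C])
    also have "\<dots> = (\<integral>\<^sup>+y. indicator ?C y \<partial>lborel)"
      using C by (intro nn_integral_indicator[symmetric]) simp
    also have "\<dots> = (\<integral>\<^sup>+y. ?J y \<tau> \<partial>lborel)"
      by (intro nn_integral_cong) (auto simp: indicator_def)
    finally show "(\<integral>\<^sup>+y. ?I y \<tau> \<partial>lborel) = (\<integral>\<^sup>+y. ?J y \<tau> \<partial>lborel)" .
  qed
  also have "\<dots> = (\<integral>\<^sup>+y. \<integral>\<^sup>+\<tau>. ?J y \<tau> \<partial>lborel \<partial>lborel)"
    by (rule lborel_pair.Fubini') measurable
  also have "\<dots> = (\<integral>\<^sup>+y. indicator A y \<partial>lborel)"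
  proof (rule nn_integral_cong)
    fix y
    \<comment> \<open>The parameters \<open>\<tau>\<close> that bring \<open>y\<close> into the slab
      form a half-open interval of length 1.\<close>
    let ?S = "{y \<bullet> w / (w \<bullet> w) - 1 <.. y \<bullet> w / (w \<bullet> w)}"
    have "(\<integral>\<^sup>+\<tau>. ?J y \<tau> \<partial>lborel) = (\<integral>\<^sup>+\<tau>. indicator A y * indicator ?S \<tau> \<partial>lborel)"
      using ww by (intro nn_integral_cong) (auto simp: indicator_def inner_diff_left field_simps)
    also have "\<dots> = indicator A y * emeasure lborel ?S"
      by (intro nn_integral_cmult_indicator) simp
    finally show "(\<integral>\<^sup>+\<tau>. ?J y \<tau> \<partial>lborel) = indicator A y"
      by simp
  qed
  finally show ?thesis
    by simp
qed

text \<open>On each line parallel to \<open>w\<close> the map is a translation, because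
  \<open>\<phi>\<close> is constant there, so the lengths of all sections are unchanged.\<close>

lemma lborel_shear:
  fixes w :: "'a::euclidean_space"
  assumes \<phi>: "\<And>x \<tau>. \<phi> (x + \<tau> *\<^sub>R w) = \<phi> x" "\<phi> \<in> borel_measurable borel" and A: "A \<in> sets borel"
  shows "emeasure lborel {x. x + \<phi> x *\<^sub>R w \<in> A} = emeasure lborel A"
proof (cases "w = 0")
  case False
  note [measurable] = \<phi>(2) A
  have "emeasure lborel {\<tau>. y + \<tau> *\<^sub>R w \<in> {x. x + \<phi> x *\<^sub>R w \<in> A}} = emeasure lborel {\<tau>. y + \<tau> *\<^sub>R w \<in> A}" for y
  proof -
    have "{\<tau>. y + \<tau> *\<^sub>R w \<in> {x. x + \<phi> x *\<^sub>R w \<in> A}} = {\<tau>. \<tau> + \<phi> y \<in> {\<tau>. y + \<tau> *\<^sub>R w \<in> A}}"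
      by (auto simp: \<phi>(1) algebra_simps)
    also have "emeasure lborel \<dots> = emeasure lborel {\<tau>. y + \<tau> *\<^sub>R w \<in> A}"
      by (intro lborel_translate) measurable
    finally show ?thesis .
  qed
  then show ?thesis
    using emeasure_lborel_lines[OF False A] emeasure_lborel_lines[OF False, of "{x. x + \<phi> x *\<^sub>R w \<in> A}"]
    by simp
qed simp

section \<open>Ramps and convex functions in the plane\<close>

text \<open>Twice the signed area of the triangle \<open>p q x\<close>: positive exactly when
  \<open>x\<close> lies strictly to the left of the line directed from \<open>p\<close> to
  \<open>q\<close>.\<close>

definition cross :: "real \<times> real \<Rightarrow> real \<times> real \<Rightarrow> real \<times> real \<Rightarrow> real" where
  "cross p q x = (fst q - fst p) * (snd x - snd p) - (snd q - snd p) * (fst x - fst p)"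

text \<open>Affine functions are stored as pairs of gradient and constant term, so that a piecewise
  affine function is given by a finite set of pairs.\<close>

definition aff :: "'a::real_inner \<times> real \<Rightarrow> 'a \<Rightarrow> real" where
  "aff a x = fst a \<bullet> x + snd a"

lemma cross_zero: "cross p q p = 0" "cross p q q = 0" "cross p p x = 0"
  by (simp_all add: cross_def algebra_simps)

lemma cross_swap:
  "cross q p x = - cross p q x" "cross p r q = - cross p q r" "cross r q p = - cross p q r"
  by (simp_all add: cross_def algebra_simps)

text \<open>Barycentric interpolation from the vertices \<open>p\<close>, \<open>q\<close>,
  \<open>r\<close>, multiplied by the area so that it also holds for degenerate triangles. For a
  positively oriented triangle the outer sides of the edges \<open>p r\<close> and
  \<open>r q\<close> are those where \<open>cross p r\<close> and \<open>cross r q\<close> are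
  positive; this is the orientation used for caps.\<close>

lemma aff_barycentric:
  "aff a x * cross p q r = cross p q x * aff a r - cross p r x * aff a q - cross r q x * aff a p"
  by (cases p, cases q, cases r, cases x, cases a)
     (simp add: cross_def aff_def inner_prod_def algebra_simps)

lemma vec_barycentric:
  assumes "cross p q r \<noteq> 0"
  shows "x = (cross p q x / cross p q r) *\<^sub>R r + (- cross p r x / cross p q r) *\<^sub>R q
           + (- cross r q x / cross p q r) *\<^sub>R p"
    and "cross p q x / cross p q r + (- cross p r x / cross p q r) + (- cross r q x / cross p q r) = 1"
proof -
  have s: "cross p q x + (- cross p r x) + (- cross r q x) = cross p q r"
    by (simp add: cross_def algebra_simps)
  show "cross p q x / cross p q r + (- cross p r x / cross p q r) + (- cross r q x / cross p q r) = 1"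
    using assms s by (simp add: field_simps)
  have "cross p q r *\<^sub>R x = cross p q x *\<^sub>R r + (- cross p r x) *\<^sub>R q + (- cross r q x) *\<^sub>R p"
    by (cases p, cases q, cases r, cases x) (simp add: cross_def algebra_simps)
  then have "(1 / cross p q r) *\<^sub>R (cross p q r *\<^sub>R x)
      = (1 / cross p q r) *\<^sub>R (cross p q x *\<^sub>R r + (- cross p r x) *\<^sub>R q + (- cross r q x) *\<^sub>R p)"
    by simp
  then show "x = (cross p q x / cross p q r) *\<^sub>R r + (- cross p r x / cross p q r) *\<^sub>R q
           + (- cross r q x / cross p q r) *\<^sub>R p"
    using assms by (simp add: scaleR_add_right scaleR_diff_right)
qed

lemma cross_aff: "\<exists>a. \<forall>x. cross p q x = aff a x"
  by (rule exI[of _ "((-(snd q - snd p), fst q - fst p), - (fst q - fst p) * snd p + (snd q - snd p) * fst p)"])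
     (auto simp: cross_def aff_def inner_prod_def algebra_simps)

lemma aff_convex: "aff a ((1 - s) *\<^sub>R x + s *\<^sub>R y) = (1 - s) * aff a x + s * aff a y"
  by (simp add: aff_def algebra_simps)

lemma cross_convex: "cross p q ((1 - s) *\<^sub>R x + s *\<^sub>R y) = (1 - s) * cross p q x + s * cross p q y"
  by (metis cross_aff aff_convex)

lemma aff_comb: "\<exists>c. \<forall>x. aff c x = s * aff a x + t * aff b x"
  by (rule exI[of _ "(s *\<^sub>R fst a + t *\<^sub>R fst b, s * snd a + t * snd b)"])
     (auto simp: aff_def algebra_simps)

lemma continuous_aff: "continuous_on S (aff a)"
  unfolding aff_def by (intro continuous_intros)

lemma frontier_support:
  fixes K :: "'a::euclidean_space set"
  assumes "convex K" "closed K" "z \<in> frontier K"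
  obtains n where "fst n \<noteq> 0" "aff n z = 0" "\<And>y. y \<in> K \<Longrightarrow> aff n y \<le> 0"
proof -
  have z: "z \<in> K" "z \<notin> interior K"
    using assms frontier_subset_closed by (auto simp: frontier_def)
  obtain a where a: "a \<noteq> 0" "\<And>y. y \<in> K \<Longrightarrow> a \<bullet> z \<le> a \<bullet> y"
  proof (cases "interior K = {}")
    \<comment> \<open>With empty interior the set lies in a hyperplane, which supports it at each of
      its points.\<close>
    case True
    then obtain a b where "a \<noteq> 0" "K \<subseteq> {x. a \<bullet> x = b}"
      using empty_interior_subset_hyperplane[OF \<open>convex K\<close>] by metis
    then have "a \<bullet> z \<le> a \<bullet> y" if "y \<in> K" for y
      using subsetD[OF \<open>K \<subseteq> _\<close> z(1)] subsetD[OF \<open>K \<subseteq> _\<close> that] by simp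
    with \<open>a \<noteq> 0\<close> show ?thesis
      by (rule that)
  next
    case False
    then have "z \<notin> rel_interior K"
      using z by (simp add: rel_interior_nonempty_interior)
    then show ?thesis
      using supporting_hyperplane_rel_boundary[OF \<open>convex K\<close> z(1)] that by metis
  qed
  show ?thesis
    using a by (intro that[of "(- a, a \<bullet> z)"]) (auto simp: aff_def)
qed

lemma aff_eq_zero:
  assumes "aff n p = 0" "aff n q = 0" "aff n r = 0" "cross p q r \<noteq> 0"
  shows "fst n = 0"
proof -
  have z: "aff n x = 0" for x
    using aff_barycentric[of n x p q r] assms by simp
  have "fst n \<bullet> fst n = 0"
    using z[of "fst n"] z[of 0] by (simp add: aff_def)
  then show ?thesis by simp
qed

section \<open>Caps of a planar convex set\<close>

context
  fixes K :: "(real \<times> real) set"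
  assumes K: "convex K" "closed K"
begin

text \<open>A point beyond both edges at \<open>r\<close> lies in the cone with apex
  \<open>r\<close> opposite to the triangle. There a supporting functional at \<open>r\<close>,
  being nonpositive at \<open>p\<close> and \<open>q\<close>, would be nonnegative; so it would
  vanish at all three vertices, which are not collinear.\<close>

lemma caps_disjoint:
  assumes "p \<in> K" "q \<in> K" "r \<in> frontier K" "x \<in> K" "cross p q r > 0" "cross p r x > 0"
  shows "cross r q x \<le> 0"
proof (rule ccontr)
  assume c: "\<not> cross r q x \<le> 0"
  obtain n where n: "fst n \<noteq> 0" "aff n r = 0" "\<And>y. y \<in> K \<Longrightarrow> aff n y \<le> 0"
    using frontier_support[OF K \<open>r \<in> frontier K\<close>] by blast
  have e: "aff n x * cross p q r = - cross p r x * aff n q - cross r q x * aff n p"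
    using aff_barycentric[of n x p q r] n by simp
  have m: "aff n x * cross p q r \<le> 0" "cross p r x * aff n q \<le> 0" "cross r q x * aff n p \<le> 0"
    using n(3) assms c by (auto simp: mult_le_0_iff)
  then have "cross p r x * aff n q = 0" "cross r q x * aff n p = 0"
    using e m by linarith+
  then have "aff n q = 0" "aff n p = 0"
    using assms c by auto
  with n aff_eq_zero assms show False
    by (metis less_irrefl)
qed

text \<open>By a supporting functional at \<open>p\<close>, a point beyond \<open>p r\<close> but
  not beyond \<open>p q\<close> forces the support line to be the line \<open>p q\<close>. The point
  \<open>c\<close> strictly on the other side of that line rules this out: the chord does not lie
  along an edge of the body that continues past \<open>p\<close>.\<close>

lemma cap_subset_left:
  assumes "p \<in> frontier K" "q \<in> K" "r \<in> K" "x \<in> K" "cross p q r > 0" "cross p q x \<le> 0"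
    and c: "c \<in> K" "cross p q c < 0"
  shows "cross p r x \<le> 0"
proof (rule ccontr)
  assume "\<not> cross p r x \<le> 0"
  then have pos: "cross p r x > 0" by simp
  obtain n where n: "fst n \<noteq> 0" "aff n p = 0" "\<And>y. y \<in> K \<Longrightarrow> aff n y \<le> 0"
    using frontier_support[OF K \<open>p \<in> frontier K\<close>] by blast
  have e: "aff n x * cross p q r = cross p q x * aff n r - cross p r x * aff n q"
    using aff_barycentric[of n x p q r] n by simp
  have e': "aff n c * cross p q r = cross p q c * aff n r - cross p r c * aff n q"
    using aff_barycentric[of n c p q r] n by simp
  have m: "aff n x * cross p q r \<le> 0" "cross p r x * aff n q \<le> 0" "cross p q x * aff n r \<ge> 0"
    using n(3) assms pos by (auto simp: mult_le_0_iff zero_le_mult_iff)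
  then have "cross p r x * aff n q = 0"
    using e m by linarith+
  then have q: "aff n q = 0"
    using pos by auto
  then have "aff n r \<noteq> 0"
    using n aff_eq_zero assms by (metis less_irrefl)
  then have "cross p q c * aff n r > 0"
    using c n(3)[OF \<open>r \<in> K\<close>] by (simp add: mult_neg_neg)
  moreover have "aff n c * cross p q r \<le> 0"
    using n(3)[OF c(1)] assms by (simp add: mult_le_0_iff)
  ultimately show False
    using e' q by simp
qed

text \<open>Mirror image of \<open>cap_subset_left\<close>, with the support line taken at
  \<open>q\<close>.\<close>

lemma cap_subset_right:
  assumes "q \<in> frontier K" "p \<in> K" "r \<in> K" "x \<in> K" "cross p q r > 0" "cross p q x \<le> 0"
    and c: "c \<in> K" "cross p q c < 0"
  shows "cross r q x \<le> 0"
proof (rule ccontr)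
  assume "\<not> cross r q x \<le> 0"
  then have pos: "cross r q x > 0" by simp
  obtain n where n: "fst n \<noteq> 0" "aff n q = 0" "\<And>y. y \<in> K \<Longrightarrow> aff n y \<le> 0"
    using frontier_support[OF K \<open>q \<in> frontier K\<close>] by blast
  have e: "aff n x * cross p q r = cross p q x * aff n r - cross r q x * aff n p"
    using aff_barycentric[of n x p q r] n by simp
  have e': "aff n c * cross p q r = cross p q c * aff n r - cross r q c * aff n p"
    using aff_barycentric[of n c p q r] n by simp
  have m: "aff n x * cross p q r \<le> 0" "cross r q x * aff n p \<le> 0" "cross p q x * aff n r \<ge> 0"
    using n(3) assms pos by (auto simp: mult_le_0_iff zero_le_mult_iff)
  then have "cross r q x * aff n p = 0"
    using e m by linarith+
  then have q: "aff n p = 0"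
    using pos by auto
  then have "aff n r \<noteq> 0"
    using n aff_eq_zero assms by (metis less_irrefl)
  then have "cross p q c * aff n r > 0"
    using c n(3)[OF \<open>r \<in> K\<close>] by (simp add: mult_neg_neg)
  moreover have "aff n c * cross p q r \<le> 0"
    using n(3)[OF c(1)] assms by (simp add: mult_le_0_iff)
  ultimately show False
    using e' q by simp
qed

text \<open>Inside the triangle all barycentric coordinates are positive, so a supporting functional
  that vanishes there vanishes at all vertices.\<close>

lemma triangle_frontier:
  assumes "p \<in> K" "q \<in> K" "r \<in> K" "x \<in> frontier K" "cross p q r > 0"
    and "cross p q x \<ge> 0" "cross p r x \<le> 0" "cross r q x \<le> 0"
  shows "cross p q x = 0 \<or> cross p r x = 0 \<or> cross r q x = 0"
proof (rule ccontr)
  assume "\<not> ?thesis"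
  with assms have pos: "cross p q x > 0" "cross p r x < 0" "cross r q x < 0"
    by auto
  obtain n where n: "fst n \<noteq> 0" "aff n x = 0" "\<And>y. y \<in> K \<Longrightarrow> aff n y \<le> 0"
    using frontier_support[OF K \<open>x \<in> frontier K\<close>] by blast
  have e: "0 = cross p q x * aff n r - cross p r x * aff n q - cross r q x * aff n p"
    using aff_barycentric[of n x p q r] n by simp
  have m: "cross p q x * aff n r \<le> 0" "cross p r x * aff n q \<ge> 0" "cross r q x * aff n p \<ge> 0"
    using n(3) assms pos by (auto simp: mult_le_0_iff zero_le_mult_iff)
  then have "cross p q x * aff n r = 0" "cross p r x * aff n q = 0" "cross r q x * aff n p = 0"
    using e m by linarith+
  then have "aff n r = 0" "aff n q = 0" "aff n p = 0"
    using pos by auto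
  with n aff_eq_zero assms show False
    by (metis less_irrefl)
qed

end

section \<open>Sums of ramps and finite families of affine functions\<close>

text \<open>Positive coefficients are absorbed into the affine functions, since
  \<open>c * max 0 a\<close> equals \<open>max 0 (c * a)\<close> for
  \<open>c \<ge> 0\<close>.\<close>

inductive ridge_sum :: "('a::real_inner \<Rightarrow> real) \<Rightarrow> bool" where
  zero: "ridge_sum (\<lambda>x. 0)"
| ridge: "ridge_sum F \<Longrightarrow> ridge_sum (\<lambda>x. F x + max 0 (aff a x))"

lemma ridge_sum_add: "ridge_sum F \<Longrightarrow> ridge_sum G \<Longrightarrow> ridge_sum (\<lambda>x. F x + G x)"
proof (induction F rule: ridge_sum.induct)
  case (ridge F a)
  then have "ridge_sum (\<lambda>x. (F x + G x) + max 0 (aff a x))"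
    by (intro ridge_sum.ridge)
  then show ?case
    by (simp add: add_ac)
qed simp

lemma ridge_sum_cross: "c \<ge> 0 \<Longrightarrow> ridge_sum (\<lambda>x. c * max 0 (cross p q x))"
proof -
  assume "c \<ge> 0"
  obtain a where "\<And>x. cross p q x = aff a x"
    using cross_aff by blast
  moreover obtain b where b: "\<And>x. aff b x = c * aff a x + 0 * aff a x"
    using aff_comb by blast
  ultimately have "c * max 0 (cross p q x) = 0 + max 0 (aff b x)" for x
    using \<open>c \<ge> 0\<close> by (simp add: max_mult_distrib_left)
  then show ?thesis
    using ridge_sum.ridge[OF ridge_sum.zero, of b] by simp
qed

text \<open>Functions that never exchange their order on \<open>W\<close> are totally preordered by
  comparison on \<open>W\<close>, and a finite nonempty family has a greatest member.\<close>

lemma one_piece: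
  assumes "finite A" "A \<noteq> {}"
    and "\<And>a a'. a \<in> A \<Longrightarrow> a' \<in> A \<Longrightarrow> \<not> (\<exists>x\<in>W. \<exists>y\<in>W. aff a x > aff a' x \<and> aff a y < aff a' y)"
  shows "\<exists>a\<in>A. \<forall>x\<in>W. \<forall>a'\<in>A. aff a' x \<le> aff a x"
  using assms
proof (induction A rule: finite_ne_induct)
  case (insert b A)
  then obtain a where a: "a \<in> A" "\<forall>x\<in>W. \<forall>a'\<in>A. aff a' x \<le> aff a x"
    by (metis insertCI)
  show ?case
  proof (cases "\<forall>x\<in>W. aff b x \<le> aff a x")
    case True
    with a show ?thesis by auto
  next
    case False
    then obtain x where "x \<in> W" "aff b x > aff a x"
      by force
    with insert.prems[of b a] a(1) have "\<forall>y\<in>W. aff a y \<le> aff b y"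
      by force
    with a have "\<forall>y\<in>W. \<forall>a'\<in>insert b A. aff a' y \<le> aff b y"
      by force
    then show ?thesis by blast
  qed
qed auto

lemma zero_at_ends:
  assumes "aff n p \<le> 0" "aff n r \<le> 0" "aff n y = 0" "y \<in> open_segment p r"
  shows "aff n p = 0" "aff n r = 0"
proof -
  obtain s where s: "0 < s" "s < 1" "y = (1 - s) *\<^sub>R p + s *\<^sub>R r"
    using assms(4) by (auto simp: in_segment)
  then have e: "0 = (1 - s) * aff n p + s * aff n r"
    using aff_convex[of n s p r] assms(3) by simp
  have "(1 - s) * aff n p \<le> 0" "s * aff n r \<le> 0"
    using s assms by (auto simp: mult_le_0_iff)
  with e have "(1 - s) * aff n p = 0" "s * aff n r = 0"
    by linarith+
  then show "aff n p = 0" "aff n r = 0"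
    using s by auto
qed

lemma zero_on_segment:
  assumes "aff n p = 0" "aff n r = 0" "y \<in> closed_segment p r"
  shows "aff n y = 0"
  using assms aff_convex[of n _ p r] by (auto simp: in_segment)

lemma cross_zero_collinear:
  assumes "cross p q x = 0" "p \<noteq> q"
  obtains s where "x = (1 - s) *\<^sub>R p + s *\<^sub>R q"
proof -
  obtain p1 p2 q1 q2 x1 x2 where [simp]: "p = (p1, p2)" "q = (q1, q2)" "x = (x1, x2)"
    by (metis surj_pair)
  have c: "(q1 - p1) * (x2 - p2) = (q2 - p2) * (x1 - p1)"
    using assms by (simp add: cross_def)
  show ?thesis
  proof (cases "q1 = p1")
    case False
    have "x = (1 - (x1 - p1) / (q1 - p1)) *\<^sub>R p + ((x1 - p1) / (q1 - p1)) *\<^sub>R q"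
      using False c by (simp add: divide_simps) (simp add: algebra_simps)
    then show ?thesis by (rule that)
  next
    case True
    then have "q2 \<noteq> p2" "x1 = p1"
      using assms c by auto
    then have "x = (1 - (x2 - p2) / (q2 - p2)) *\<^sub>R p + ((x2 - p2) / (q2 - p2)) *\<^sub>R q"
      using True by (simp add: divide_simps) (simp add: algebra_simps)
    then show ?thesis by (rule that)
  qed
qed

lemma aff_opposite_signs:
  assumes "aff a x > aff a' x" "aff a y < aff a' y"
  obtains z where "z \<in> open_segment x y" "aff a z = aff a' z"
proof -
  let ?u = "aff a x - aff a' x" and ?v = "aff a' y - aff a y"
  define s where "s = ?u / (?u + ?v)"
  have s: "0 < s" "s < 1" "s * (?u + ?v) = ?u"
    using assms by (auto simp: s_def)
  have "x \<noteq> y"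
    using assms by auto
  then have "(1 - s) *\<^sub>R x + s *\<^sub>R y \<in> open_segment x y"
    using s by (auto simp: in_segment)
  moreover have "aff a ((1 - s) *\<^sub>R x + s *\<^sub>R y) = aff a' ((1 - s) *\<^sub>R x + s *\<^sub>R y)"
    using s(3) unfolding aff_convex by (simp add: algebra_simps)
  ultimately show ?thesis by (rule that)
qed

section \<open>Ramps majorizing a piecewise affine function\<close>

text \<open>The finite set \<open>C\<close> of boundary points contains the ends of all chords of
  \<open>K\<close> on which two pieces agree. Hence inside \<open>K\<close> the function
  \<open>f\<close> can change its piece only along segments joining points of
  \<open>C\<close>.\<close>

context
  fixes K C :: "(real \<times> real) set" and A :: "((real \<times> real) \<times> real) set"
    and f :: "real \<times> real \<Rightarrow> real"
  assumes K: "convex K" "closed K" and A: "finite A" "A \<noteq> {}"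
    and f_def: "\<And>x. f x = Max ((\<lambda>a. aff a x) ` A)"
    and C: "finite C" "C \<subseteq> frontier K"
    and creases: "\<And>a a' z. a \<in> A \<Longrightarrow> a' \<in> A \<Longrightarrow> a \<noteq> a' \<Longrightarrow> z \<in> K \<Longrightarrow> aff a z = aff a' z \<Longrightarrow>
       \<exists>z1\<in>C. \<exists>z2\<in>C. z \<in> closed_segment z1 z2 \<and> aff a z1 = aff a' z1 \<and> aff a z2 = aff a' z2"
begin

lemma C_K: "C \<subseteq> K"
  using C K frontier_subset_closed by blast

lemma piece_le: "a \<in> A \<Longrightarrow> aff a x \<le> f x"
  using A by (simp add: f_def)

lemma piece_eq: "a \<in> A \<Longrightarrow> (\<And>a'. a' \<in> A \<Longrightarrow> aff a' x \<le> aff a x) \<Longrightarrow> f x = aff a x"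
  using A by (auto simp: f_def intro!: Max_eqI)

lemma f_segment:
  assumes "0 \<le> s" "s \<le> 1"
  shows "f ((1 - s) *\<^sub>R x + s *\<^sub>R y) \<le> (1 - s) * f x + s * f y"
proof -
  have "aff a ((1 - s) *\<^sub>R x + s *\<^sub>R y) \<le> (1 - s) * f x + s * f y" if "a \<in> A" for a
    unfolding aff_convex using assms piece_le[OF that] by (intro add_mono mult_left_mono) auto
  then show ?thesis
    unfolding f_def[of "(1 - s) *\<^sub>R x + s *\<^sub>R y"] using A by auto
qed

lemma continuous_f: "continuous_on UNIV f"
proof -
  have "continuous_on UNIV (\<lambda>x. Max ((\<lambda>a. aff a x) ` A))"
    using A
  proof (induction A rule: finite_ne_induct)
    case (singleton a)
    have "(\<lambda>x. Max ((\<lambda>a. aff a x) ` {a})) = aff a"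
      by (rule ext) simp
    then show ?case
      by (simp add: continuous_aff)
  next
    case (insert a A)
    then have eq: "(\<lambda>x. Max ((\<lambda>a. aff a x) ` insert a A)) = (\<lambda>x. max (aff a x) (Max ((\<lambda>a. aff a x) ` A)))"
      by (intro ext) simp
    show ?case
      unfolding eq by (intro continuous_on_max continuous_aff insert.IH)
  qed
  moreover have "f = (\<lambda>x. Max ((\<lambda>a. aff a x) ` A))"
    by (rule ext) (rule f_def)
  ultimately show ?thesis by simp
qed

lemma piece_closure:
  assumes "\<And>x. x \<in> W \<Longrightarrow> f x = aff a x" "x \<in> closure W"
  shows "f x = aff a x"
proof -
  have "closed {x. f x = aff a x}"
    by (intro closed_Collect_eq continuous_f continuous_aff)
  then have "closure W \<subseteq> {x. f x = aff a x}"
    using assms by (intro closure_minimal) auto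
  then show ?thesis
    using assms by auto
qed

text \<open>A change of piece inside the open cap would happen on a segment with ends in
  \<open>C\<close>. These ends lie in the opposite closed half-plane, and so does the
  segment.\<close>

lemma one_piece_cap:
  assumes "C \<inter> {x. cross p q x > 0} = {}"
  shows "\<exists>a\<in>A. \<forall>x \<in> K \<inter> {x. cross p q x > 0}. f x = aff a x"
proof -
  let ?W = "K \<inter> {x. cross p q x > 0}"
  have "\<exists>a\<in>A. \<forall>x\<in>?W. \<forall>a'\<in>A. aff a' x \<le> aff a x"
  proof (rule one_piece[OF A], rule notI, clarify)
    fix a a' x y
    assume a: "a \<in> A" "a' \<in> A" and x: "x \<in> K" "0 < cross p q x" and y: "y \<in> K" "0 < cross p q y"
      and xy: "aff a' x < aff a x" "aff a y < aff a' y"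
    obtain z where z: "z \<in> open_segment x y" "aff a z = aff a' z"
      using aff_opposite_signs[OF xy] by blast
    then obtain s where s: "0 < s" "s < 1" "z = (1 - s) *\<^sub>R x + s *\<^sub>R y"
      by (auto simp: in_segment)
    then have "z \<in> K" "0 < cross p q z"
      using x y K convexD_alt[of K x y s] by (auto simp: cross_convex intro!: add_pos_pos)
    moreover from creases[OF a _ \<open>z \<in> K\<close> z(2)] xy obtain z1 z2
      where z12: "z1 \<in> C" "z2 \<in> C" "z \<in> closed_segment z1 z2"
      by blast
    moreover have "cross p q z1 \<le> 0" "cross p q z2 \<le> 0"
      using z12 assms by force+
    moreover obtain t where "0 \<le> t" "t \<le> 1" "z = (1 - t) *\<^sub>R z1 + t *\<^sub>R z2"
      using z12 by (auto simp: in_segment)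
    ultimately show False
      using add_mono[OF mult_nonneg_nonpos[of "1 - t" "cross p q z1"] mult_nonneg_nonpos[of t "cross p q z2"]]
      by (simp add: cross_convex)
  qed
  then show ?thesis
    using piece_eq by blast
qed

text \<open>The support line at \<open>x\<close> contains \<open>p\<close> and \<open>r\<close>, so
  the segment runs along the boundary. If a point of \<open>C\<close> lies inside it, convexity with
  \<open>f\<close> above \<open>\<beta>\<close> there and equal to \<open>\<beta>\<close> at the
  ends forces equality throughout. Otherwise no crease crosses the segment and \<open>f\<close> is a
  single piece on it.\<close>

lemma edge_affine:
  assumes pr: "p \<in> K" "r \<in> K" "p \<noteq> r" and x: "x \<in> frontier K" "x \<in> open_segment p r"
    and \<beta>: "f p = aff \<beta> p" "f r = aff \<beta> r"
    and ge: "\<And>z. z \<in> C \<Longrightarrow> z \<in> open_segment p r \<Longrightarrow> f z \<ge> aff \<beta> z"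
  shows "f x = aff \<beta> x"
proof -
  obtain n where n: "fst n \<noteq> 0" "aff n x = 0" "\<And>y. y \<in> K \<Longrightarrow> aff n y \<le> 0"
    using frontier_support[OF K x(1)] by blast
  have npr: "aff n p = 0" "aff n r = 0"
    using zero_at_ends[OF _ _ n(2) x(2)] n(3) pr by auto
  obtain s where s: "0 < s" "s < 1" "x = (1 - s) *\<^sub>R p + s *\<^sub>R r"
    using x(2) by (auto simp: in_segment)
  show ?thesis
  proof (cases "C \<inter> open_segment p r = {}")
    case False
    then obtain c where c: "c \<in> C" "c \<in> open_segment p r"
      by blast
    then obtain t where t: "0 < t" "t < 1" "c = (1 - t) *\<^sub>R p + t *\<^sub>R r"
      unfolding in_segment by blast
    have fc: "f c \<ge> aff \<beta> c"
      using ge c by blast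
    have "f x \<le> aff \<beta> x"
      using f_segment[of s p r] s \<beta> by (simp add: aff_convex)
    moreover have "aff \<beta> x \<le> f x"
    proof (cases "s \<le> t")
      case True
      \<comment> \<open>\<open>u\<close> places \<open>c\<close> between \<open>x\<close> and
        \<open>r\<close>. If \<open>f x\<close> were below \<open>\<beta>\<close>, convexity would
        push \<open>f c\<close> below \<open>\<beta>\<close> as well.\<close>
      define u where "u = (t - s) / (1 - s)"
      have u: "0 \<le> u" "u < 1" "(1 - u) * (1 - s) = 1 - t" 
        using s t True by (auto simp: u_def field_simps)
      have "(1 - u) *\<^sub>R x + u *\<^sub>R r = ((1 - u) * (1 - s)) *\<^sub>R p + ((1 - u) * s + u) *\<^sub>R r"
        unfolding s(3) by (simp add: algebra_simps)
      also have "(1 - u) * s + u = t"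
        using u(3) by (simp add: algebra_simps)
      finally have ce: "(1 - u) *\<^sub>R x + u *\<^sub>R r = c"
        using t u by simp
      have "f c \<le> (1 - u) * f x + u * f r"
        using f_segment[of u x r] u by (simp add: ce)
      moreover have "aff \<beta> c = (1 - u) * aff \<beta> x + u * aff \<beta> r"
        using aff_convex[of \<beta> u x r] by (simp add: ce)
      ultimately have "(1 - u) * aff \<beta> x \<le> (1 - u) * f x"
        using fc \<beta> by simp
      then show ?thesis
        using u by simp
    next
      case False
      define u where "u = t / s"
      have u: "0 < u" "u \<le> 1" "u * s = t"
        using s t False by (auto simp: u_def field_simps)
      have "(1 - u) *\<^sub>R p + u *\<^sub>R x = (1 - u * s) *\<^sub>R p + (u * s) *\<^sub>R r"
        unfolding s(3) by (simp add: algebra_simps)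
      then have ce: "(1 - u) *\<^sub>R p + u *\<^sub>R x = c"
        using t u by simp
      have "f c \<le> (1 - u) * f p + u * f x"
        using f_segment[of u p x] u by (simp add: ce)
      moreover have "aff \<beta> c = (1 - u) * aff \<beta> p + u * aff \<beta> x"
        using aff_convex[of \<beta> u p x] by (simp add: ce)
      ultimately have "u * aff \<beta> x \<le> u * f x"
        using fc \<beta> by simp
      then show ?thesis
        using u by simp
    qed
    ultimately show ?thesis by simp
  next
    case True
    let ?W = "open_segment p r"
    have "\<exists>a\<in>A. \<forall>x\<in>?W. \<forall>a'\<in>A. aff a' x \<le> aff a x"
    proof (rule one_piece[OF A], rule notI, clarify)
      fix a a' y y'
      assume a: "a \<in> A" "a' \<in> A" and y: "y \<in> ?W" "y' \<in> ?W"
        and xy: "aff a' y < aff a y" "aff a y' < aff a' y'"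
      obtain z where z: "z \<in> open_segment y y'" "aff a z = aff a' z"
        using aff_opposite_signs[OF xy] by blast
      have zW: "z \<in> ?W"
        using y z(1) convex_open_segment[of p r] convex_contains_open_segment by blast
      then have "z \<in> K"
        using pr K convex_contains_open_segment by blast
      \<comment> \<open>The ends of the crease through \<open>z\<close> lie on the support line. So
        the two pieces agree at two different points of the line through \<open>p\<close> and
        \<open>r\<close>, namely \<open>z\<close> and \<open>z1\<close>, and hence all along
        it.\<close>
      obtain z1 z2 where z12: "z1 \<in> C" "z2 \<in> C" "z \<in> closed_segment z1 z2"
        and eq: "aff a z1 = aff a' z1"
        using creases[OF a _ \<open>z \<in> K\<close> z(2)] xy by blast
      have "z \<in> open_segment z1 z2"
        using z12 zW True by (auto simp: open_segment_def)
      moreover have nz: "aff n z = 0"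
        using zero_on_segment[OF npr] zW by (simp add: open_segment_def)
      ultimately have n1: "aff n z1 = 0"
        using zero_at_ends[of n z1 z2 z] n(3) z12 C_K by blast
      have "cross p r z1 = 0"
        using aff_eq_zero[OF npr n1] n(1) by blast
      then obtain t where t: "z1 = (1 - t) *\<^sub>R p + t *\<^sub>R r"
        using cross_zero_collinear pr(3) by blast
      obtain t' where t': "z = (1 - t') *\<^sub>R p + t' *\<^sub>R r"
        using zW by (auto simp: in_segment)
      obtain b where b: "\<And>x. aff b x = 1 * aff a x + (-1) * aff a' x"
        using aff_comb[of 1 a "-1" a'] by blast
      have "(1 - t) * aff b p + t * aff b r = 0"
        using eq b[of z1] unfolding t aff_convex[symmetric] by simp
      moreover have "(1 - t') * aff b p + t' * aff b r = 0"
        using z(2) b[of z] unfolding t' aff_convex[symmetric] by simp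
      ultimately have "(t - t') * (aff b r - aff b p) = 0"
        by (simp add: algebra_simps)
      moreover have "t \<noteq> t'"
        using t t' z12(1) zW True by auto
      ultimately have br: "aff b r = aff b p"
        by simp
      have "aff b v = aff b p" if v: "v \<in> ?W" for v
      proof -
        obtain s where "v = (1 - s) *\<^sub>R p + s *\<^sub>R r"
          using v unfolding in_segment by blast
        then show ?thesis
          using br by (simp only: aff_convex) (simp add: algebra_simps)
      qed
      then have "aff b y = aff b p" "aff b y' = aff b p"
        using y by auto
      then show False
        using xy b[of y] b[of y'] by simp
    qed
    then obtain a where a: "a \<in> A" "\<And>x. x \<in> ?W \<Longrightarrow> f x = aff a x"
      using piece_eq by blast
    have "f p = aff a p" "f r = aff a r"
      using piece_closure[OF a(2)] pr(3) by (auto simp: closure_open_segment)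
    then show ?thesis
      using a(2)[OF x(2)] \<beta> s(3) by (simp add: aff_convex)
  qed
qed

lemma triangle_le:
  assumes "cross p q r > 0" "cross p q x \<ge> 0" "cross p r x \<le> 0" "cross r q x \<le> 0"
    and "f p = aff \<beta> p" "f q = aff \<beta> q" "f r = aff \<beta> r"
  shows "f x \<le> aff \<beta> x"
proof -
  have "aff a x \<le> aff \<beta> x" if "a \<in> A" for a
  proof -
    have "cross p q x * aff a r \<le> cross p q x * aff \<beta> r"
      using assms piece_le[OF that, of r] by (intro mult_left_mono) auto
    moreover have "- cross p r x * aff a q \<le> - cross p r x * aff \<beta> q"
      using assms piece_le[OF that, of q] by (intro mult_left_mono) auto
    moreover have "- cross r q x * aff a p \<le> - cross r q x * aff \<beta> p"
      using assms piece_le[OF that, of p] by (intro mult_left_mono) auto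
    ultimately have "aff a x * cross p q r \<le> aff \<beta> x * cross p q r"
      unfolding aff_barycentric[of _ x p q r] by linarith
    then show ?thesis
      using assms(1) by simp
  qed
  then show ?thesis
    unfolding f_def[of x] using A by auto
qed

lemma triangle_edge:
  assumes pr: "p \<in> K" "r \<in> K" and x: "x \<in> frontier K" "x \<in> closed_segment p r"
    and \<beta>: "f p = aff \<beta> p" "f r = aff \<beta> r"
    and ge: "\<And>z. z \<in> C \<Longrightarrow> z \<in> open_segment p r \<Longrightarrow> f z \<ge> aff \<beta> z"
  shows "f x = aff \<beta> x"
proof (cases "x = p \<or> x = r")
  case False
  then have "x \<in> open_segment p r" "p \<noteq> r"
    using x by (auto simp: open_segment_def)
  then show ?thesis
    using edge_affine[OF pr _ x(1) _ \<beta> ge] by blast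
qed (use \<beta> in auto)

text \<open>A boundary point of \<open>K\<close> in the triangle lies on an edge, where
  \<open>edge_affine\<close> applies. Points of \<open>C\<close> on the edge \<open>p q\<close>
  itself are not covered by \<open>ge\<close>; the last assumption either keeps \<open>x\<close> off
  this edge or supplies the inequality for them.\<close>

lemma triangle_eq:
  assumes pqr: "p \<in> C" "q \<in> C" "r \<in> C" "cross p q r > 0"
    and x: "x \<in> frontier K" "cross p q x \<ge> 0" "cross p r x \<le> 0" "cross r q x \<le> 0"
    and \<beta>: "f p = aff \<beta> p" "f q = aff \<beta> q" "f r = aff \<beta> r"
    and ge: "\<And>z. z \<in> C \<Longrightarrow> cross p q z > 0 \<Longrightarrow> f z \<ge> aff \<beta> z"
    and pq: "cross p q x > 0 \<or> (\<forall>z\<in>C. f z \<ge> aff \<beta> z)"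
  shows "f x = aff \<beta> x"
proof -
  have inK: "p \<in> K" "q \<in> K" "r \<in> K"
    using pqr C_K by auto
  define a b c where abc: "a = cross p q x / cross p q r" "b = - cross p r x / cross p q r"
    "c = - cross r q x / cross p q r"
  have xe: "x = a *\<^sub>R r + b *\<^sub>R q + c *\<^sub>R p" and sum: "a + b + c = 1"
    using vec_barycentric[of p q r x] pqr(4) unfolding abc by auto
  have nn: "0 \<le> a" "0 \<le> b" "0 \<le> c"
    using x pqr(4) by (auto simp: abc zero_le_divide_iff divide_le_0_iff)
  have z: "a = 0 \<or> b = 0 \<or> c = 0"
    using triangle_frontier[OF K inK x(1) pqr(4) x(2-4)] by (auto simp: abc)
  have opos: "0 < cross p q z" if z': "z \<in> open_segment p r \<or> z \<in> open_segment r q" for z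
  proof -
    obtain s v where "0 < s" "s < 1" "z = (1 - s) *\<^sub>R v + s *\<^sub>R r" "v = p \<or> v = q"
      using z' unfolding open_segment_commute[of r q] in_segment by blast
    moreover have "cross p q v = 0"
      using calculation cross_zero by metis
    ultimately show ?thesis
      using pqr(4) by (simp add: cross_convex)
  qed
  consider "b = 0" | "c = 0" | "a = 0" "b \<noteq> 0" "c \<noteq> 0"
    using z by blast
  then show ?thesis
  proof cases
    case 1
    then have "c = 1 - a"
      using sum by simp
    with xe 1 have "x = (1 - a) *\<^sub>R p + a *\<^sub>R r"
      by simp
    with nn sum have "x \<in> closed_segment p r"
      unfolding in_segment by (intro exI[of _ a]) simp
    then show ?thesis
      using triangle_edge[OF inK(1,3) x(1) _ \<beta>(1,3)] ge opos by blast
  next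
    case 2
    then have "b = 1 - a"
      using sum by simp
    with xe 2 have "x = (1 - b) *\<^sub>R r + b *\<^sub>R q"
      by simp
    with nn sum have "x \<in> closed_segment r q"
      unfolding in_segment by (intro exI[of _ b]) simp
    then show ?thesis
      using triangle_edge[OF inK(3,2) x(1) _ \<beta>(3,2)] ge opos by blast
  next
    case 3
    then have "c = 1 - b"
      using sum by simp
    with xe 3 have "x = (1 - b) *\<^sub>R p + b *\<^sub>R q"
      by simp
    with nn sum have "x \<in> closed_segment p q"
      unfolding in_segment by (intro exI[of _ b]) simp
    moreover have "cross p q x = 0"
      using 3 pqr(4) by (simp add: abc)
    ultimately show ?thesis
      using triangle_edge[OF inK(1,2) x(1) _ \<beta>(1,2)] pq by auto
  qed
qed

lemma finite_argmin:
  fixes h :: "'b \<Rightarrow> real"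
  assumes "finite S" "S \<noteq> {}"
  obtains r where "r \<in> S" "\<And>z. z \<in> S \<Longrightarrow> h r \<le> h z"
  using arg_min_if_finite[OF assms, of h] by (metis not_le)

lemma open_segment_cap:
  assumes "p \<in> K" "w \<in> K" "cross a b p \<ge> 0" "cross a b w > 0"
  shows "open_segment p w \<subseteq> K \<inter> {x. cross a b x > 0}"
proof
  fix x assume x: "x \<in> open_segment p w"
  then obtain s where s: "0 < s" "s < 1" "x = (1 - s) *\<^sub>R p + s *\<^sub>R w"
    unfolding in_segment by blast
  moreover have "x \<in> K"
    using s assms K convexD_alt[of K p w s] by auto
  ultimately show "x \<in> K \<inter> {x. cross a b x > 0}"
    using assms by (auto simp: cross_convex intro!: add_nonneg_pos)
qed

text \<open>The affine function \<open>\<beta>\<close> is tilted about the line \<open>p q\<close>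
  until it first meets the graph of \<open>f\<close> over a point \<open>r\<close> of
  \<open>C\<close> in the cap. Over the triangle \<open>p q r\<close> the tilted function dominates
  \<open>f\<close> by convexity. At the points of \<open>C\<close> in the cap it stays below
  \<open>f\<close>, which is what the recursion into the caps beyond \<open>p r\<close> and
  \<open>r q\<close> requires; both contain fewer points of \<open>C\<close>. The ramps of a cap
  vanish on the rest of \<open>K\<close>, so the contributions do not interfere.\<close>

lemma cap_majorant:
  assumes "p \<in> C" "q \<in> C" "f p = aff \<beta> p" "f q = aff \<beta> q"
    and "\<And>z. z \<in> C \<Longrightarrow> cross p q z > 0 \<Longrightarrow> f z \<ge> aff \<beta> z"
    and "c \<in> C" "cross p q c < 0" "f c = aff \<beta> c"
  shows "\<exists>F. ridge_sum F \<and> (\<forall>x\<in>K. cross p q x \<le> 0 \<longrightarrow> F x = 0)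
     \<and> (\<forall>x\<in>K. cross p q x > 0 \<longrightarrow> f x \<le> aff \<beta> x + F x)
     \<and> (\<forall>x\<in>frontier K. cross p q x > 0 \<longrightarrow> f x = aff \<beta> x + F x)"
  using assms
proof (induction "card (C \<inter> {z. cross p q z > 0})" arbitrary: p q \<beta> c rule: less_induct)
  case less
  note pq = less.prems(1,2) and \<beta> = less.prems(3,4) and ge = less.prems(5) and c = less.prems(6-8)
  have inK: "p \<in> K" "q \<in> K" "c \<in> K" and fr: "p \<in> frontier K" "q \<in> frontier K"
    using pq c C_K C by auto
  have frK: "frontier K \<subseteq> K"
    using K by (simp add: frontier_subset_closed)
  show ?case
  proof (cases "C \<inter> {z. cross p q z > 0} = {}")
    case True
    let ?W = "K \<inter> {x. cross p q x > 0}"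
    show ?thesis
    proof (cases "?W = {}")
      case True
      then show ?thesis
        using frK by (intro exI[of _ "\<lambda>x. 0"]) (auto intro: ridge_sum.zero)
    next
      case False
      then obtain w where w: "w \<in> K" "cross p q w > 0" by blast
      obtain a where a: "a \<in> A" "\<And>x. x \<in> ?W \<Longrightarrow> f x = aff a x"
        using one_piece_cap[OF True] by blast
      have "v \<in> closure ?W" if "v \<in> K" "cross p q v = 0" for v
      proof -
        have "v \<noteq> w"
          using that w by auto
        then have "v \<in> closure (open_segment v w)"
          by (simp add: closure_open_segment)
        also have "\<dots> \<subseteq> closure ?W"
          using open_segment_cap[of v w p q] that w by (intro closure_mono) auto
        finally show ?thesis .
      qed
      then have fa: "f p = aff a p" "f q = aff a q"
        using inK piece_closure[OF a(2)] cross_zero by metis+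
      obtain b where b: "\<And>x. aff b x = 1 * aff a x + (-1) * aff \<beta> x"
        using aff_comb[of 1 a "-1" \<beta>] by blast
      have b0: "aff b p = 0" "aff b q = 0" "aff b c \<le> 0"
        using fa \<beta> c piece_le[OF a(1), of c] by (auto simp: b)
      \<comment> \<open>The single piece of \<open>f\<close> over the cap differs from
        \<open>\<beta>\<close> by a multiple of \<open>cross p q\<close>. At \<open>c\<close>, on
        the other side, \<open>f\<close> equals \<open>\<beta>\<close> and the piece lies below
        \<open>f\<close>; so the multiple is nonnegative and gives a ramp.\<close>
      define k where "k = aff b c / cross p q c"
      have k: "k \<ge> 0"
        using b0 c by (simp add: k_def zero_le_divide_iff)
      have "aff b x * cross p q c = cross p q x * aff b c" for x
        using aff_barycentric[of b x p q c] b0 by simp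
      then have bk: "aff b x = k * cross p q x" for x
        using c(2) by (simp add: k_def field_simps)
      have "f x = aff \<beta> x + k * max 0 (cross p q x)" if "x \<in> K" "cross p q x > 0" for x
        using a(2)[of x] that bk[of x] b[of x] by simp
      then show ?thesis
        using ridge_sum_cross[OF k] frK by (intro exI[of _ "\<lambda>x. k * max 0 (cross p q x)"]) auto
    qed
  next
    case False
    let ?h = "\<lambda>z. (f z - aff \<beta> z) / cross p q z"
    obtain r where r: "r \<in> C \<inter> {z. cross p q z > 0}"
      and rmin: "\<And>z. z \<in> C \<inter> {z. cross p q z > 0} \<Longrightarrow> ?h r \<le> ?h z"
      using finite_argmin[of "C \<inter> {z. cross p q z > 0}" ?h] False C(1) by blast
    then have rC: "r \<in> C" "cross p q r > 0" by auto
    then have rK: "r \<in> K" "r \<in> frontier K"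
      using C C_K by auto
    \<comment> \<open>The slope at which the tilted function first touches the graph over the points
      of \<open>C\<close> in the cap; it is nonnegative because \<open>\<beta>\<close> lies below
      \<open>f\<close> there.\<close>
    define t where "t = ?h r"
    have t: "t \<ge> 0"
      using ge[OF rC] rC by (simp add: t_def)
    obtain e where e: "\<And>x. cross p q x = aff e x"
      using cross_aff by blast
    obtain \<gamma> where "\<And>x. aff \<gamma> x = 1 * aff \<beta> x + t * aff e x"
      using aff_comb[of 1 \<beta> t e] by blast
    then have \<gamma>: "aff \<gamma> x = aff \<beta> x + t * cross p q x" for x
      by (simp add: e)
    have f\<gamma>: "f p = aff \<gamma> p" "f q = aff \<gamma> q" "f r = aff \<gamma> r"
      using \<beta> rC by (auto simp: \<gamma> cross_zero t_def)
    have ge\<gamma>: "f z \<ge> aff \<gamma> z" if "z \<in> C" "cross p q z > 0" for z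
      using rmin[of z] that unfolding t_def[symmetric] by (simp add: \<gamma> field_simps)
    have left: "cross p q z > 0" if "z \<in> K" "cross p r z > 0" for z
      using cap_subset_left[OF K fr(1) inK(2) rK(1) that(1) rC(2) _ inK(3) c(2)] that by force
    have right: "cross p q z > 0" if "z \<in> K" "cross r q z > 0" for z
      using cap_subset_right[OF K fr(2) inK(1) rK(1) that(1) rC(2) _ inK(3) c(2)] that by force
    have "C \<inter> {z. cross p r z > 0} \<subseteq> C \<inter> {z. cross p q z > 0}"
      using C_K left by blast
    moreover have "r \<notin> C \<inter> {z. cross p r z > 0}"
      by (simp add: cross_zero)
    ultimately have "card (C \<inter> {z. cross p r z > 0}) < card (C \<inter> {z. cross p q z > 0})"
      using C(1) r by (intro psubset_card_mono) blast+
    \<comment> \<open>The vertex \<open>q\<close> serves as the point strictly on the other side of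
      \<open>p r\<close> at which the new affine function equals \<open>f\<close>; for the cap
      beyond \<open>r q\<close> this will be \<open>p\<close>.\<close>
    then have "\<exists>F. ridge_sum F \<and> (\<forall>x\<in>K. cross p r x \<le> 0 \<longrightarrow> F x = 0)
       \<and> (\<forall>x\<in>K. cross p r x > 0 \<longrightarrow> f x \<le> aff \<gamma> x + F x)
       \<and> (\<forall>x\<in>frontier K. cross p r x > 0 \<longrightarrow> f x = aff \<gamma> x + F x)"
      using pq rC f\<gamma> ge\<gamma> left C_K
      by (intro less.hyps[where c = q]) (auto simp: cross_swap(2)[of p r q])
    then obtain F where F: "ridge_sum F" "\<And>x. x \<in> K \<Longrightarrow> cross p r x \<le> 0 \<Longrightarrow> F x = 0"
      "\<And>x. x \<in> K \<Longrightarrow> cross p r x > 0 \<Longrightarrow> f x \<le> aff \<gamma> x + F x"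
      "\<And>x. x \<in> frontier K \<Longrightarrow> cross p r x > 0 \<Longrightarrow> f x = aff \<gamma> x + F x"
      by blast
    have "C \<inter> {z. cross r q z > 0} \<subseteq> C \<inter> {z. cross p q z > 0}"
      using C_K right by blast
    moreover have "r \<notin> C \<inter> {z. cross r q z > 0}"
      by (simp add: cross_zero)
    ultimately have "card (C \<inter> {z. cross r q z > 0}) < card (C \<inter> {z. cross p q z > 0})"
      using C(1) r by (intro psubset_card_mono) blast+
    then have "\<exists>F. ridge_sum F \<and> (\<forall>x\<in>K. cross r q x \<le> 0 \<longrightarrow> F x = 0)
       \<and> (\<forall>x\<in>K. cross r q x > 0 \<longrightarrow> f x \<le> aff \<gamma> x + F x)
       \<and> (\<forall>x\<in>frontier K. cross r q x > 0 \<longrightarrow> f x = aff \<gamma> x + F x)"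
      using pq rC f\<gamma> ge\<gamma> right C_K
      by (intro less.hyps[where c = p]) (auto simp: cross_swap(3)[of r q p])
    then obtain G where G: "ridge_sum G" "\<And>x. x \<in> K \<Longrightarrow> cross r q x \<le> 0 \<Longrightarrow> G x = 0"
      "\<And>x. x \<in> K \<Longrightarrow> cross r q x > 0 \<Longrightarrow> f x \<le> aff \<gamma> x + G x"
      "\<And>x. x \<in> frontier K \<Longrightarrow> cross r q x > 0 \<Longrightarrow> f x = aff \<gamma> x + G x"
      by blast
    \<comment> \<open>The first ramp accounts for the tilt from \<open>\<beta>\<close> to
      \<open>\<gamma>\<close>, the other two terms for the caps beyond the new edges.\<close>
    let ?F = "\<lambda>x. t * max 0 (cross p q x) + (F x + G x)"
    have "ridge_sum ?F"
      by (intro ridge_sum_add ridge_sum_cross t F G)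
    moreover have "?F x = 0" if "x \<in> K" "cross p q x \<le> 0" for x
      using F(2)[OF that(1)] G(2)[OF that(1)] left[OF that(1)] right[OF that(1)] that(2) by force
    moreover have "f x \<le> aff \<beta> x + ?F x \<and> (x \<in> frontier K \<longrightarrow> f x = aff \<beta> x + ?F x)"
      if x: "x \<in> K" "cross p q x > 0" for x
    proof -
      have "f x \<le> aff \<gamma> x + (F x + G x) \<and> (x \<in> frontier K \<longrightarrow> f x = aff \<gamma> x + (F x + G x))"
      proof (cases "cross p r x > 0")
        case True
        then have "G x = 0"
          using caps_disjoint[OF K inK(1,2) rK(2) x(1) rC(2)] G(2) x by blast
        with F(3,4)[of x] True x show ?thesis by simp
      next
        case r1: False
        then have F0: "F x = 0"
          using F(2) x by simp
        show ?thesis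
        proof (cases "cross r q x > 0")
          case True
          with G(3,4)[of x] F0 x show ?thesis by simp
        next
          case False
          then have "G x = 0"
            using G(2) x by simp
          moreover have "f x \<le> aff \<gamma> x"
            using triangle_le[OF rC(2), of x] x r1 False f\<gamma> by simp
          moreover have "f x = aff \<gamma> x" if "x \<in> frontier K"
            using triangle_eq[OF pq rC that _ _ _ f\<gamma> ge\<gamma>] x r1 False by simp
          ultimately show ?thesis
            using F0 by simp
        qed
      qed
      then show ?thesis
        using x by (simp add: \<gamma> algebra_simps)
    qed
    ultimately show ?thesis
      using frK by (intro exI[of _ ?F]) blast
  qed
qed

text \<open>A lower face of the convex hull of the graph points over \<open>C\<close>, found by
  tilting: an affine function below the graph is turned about a point and then about a line, each
  time until it touches again.\<close>

lemma hull_triangle: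
  assumes "\<exists>x\<in>C. \<exists>y\<in>C. \<exists>z\<in>C. cross x y z \<noteq> 0"
  obtains p q r \<beta> where "p \<in> C" "q \<in> C" "r \<in> C" "cross p q r > 0"
    "f p = aff \<beta> p" "f q = aff \<beta> q" "f r = aff \<beta> r" "\<And>z. z \<in> C \<Longrightarrow> f z \<ge> aff \<beta> z"
proof -
  \<comment> \<open>Through a point of largest norm, the line orthogonal to its position vector
    leaves all other points of \<open>C\<close> strictly on one side; \<open>l\<close> below
    measures the distance from this line up to a factor.\<close>
  obtain p where p: "p \<in> C" "\<And>z. z \<in> C \<Longrightarrow> - norm p \<le> - norm z"
    using finite_argmin[of C "\<lambda>z. - norm z"] C assms by blast
  have "p \<bullet> (p - z) > 0" if "z \<in> C" "z \<noteq> p" for z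
  proof -
    have "p \<bullet> p + z \<bullet> z - 2 * (p \<bullet> z) = (p - z) \<bullet> (p - z)"
      by (simp add: algebra_simps inner_commute)
    also have "\<dots> > 0"
      using that by simp
    finally have "2 * (p \<bullet> z) < p \<bullet> p + z \<bullet> z" by simp
    moreover have "z \<bullet> z \<le> p \<bullet> p"
      using p(2)[OF that(1)] by (simp add: norm_le)
    ultimately show ?thesis
      by (simp add: inner_diff_right)
  qed
  moreover define l where "l = (- p, p \<bullet> p)"
  ultimately have l: "aff l p = 0" "\<And>z. z \<in> C \<Longrightarrow> z \<noteq> p \<Longrightarrow> aff l z > 0"
    by (auto simp: aff_def inner_diff_right inner_commute simp del: split_paired_All)
  have "C - {p} \<noteq> {}"
    using assms by (metis Diff_eq_empty_iff cross_zero(3) singletonD subsetD)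
  then obtain q where q: "q \<in> C" "q \<noteq> p"
    "\<And>z. z \<in> C - {p} \<Longrightarrow> (f q - f p) / aff l q \<le> (f z - f p) / aff l z"
    using finite_argmin[of "C - {p}" "\<lambda>z. (f z - f p) / aff l z"] C by blast
  define t where "t = (f q - f p) / aff l q"
  define \<alpha> where "\<alpha> = (t *\<^sub>R fst l, f p + t * snd l)"
  have \<alpha>: "aff \<alpha> x = f p + t * aff l x" for x
    by (simp add: \<alpha>_def aff_def algebra_simps)
  have \<alpha>_eq: "f p = aff \<alpha> p" "f q = aff \<alpha> q"
    using l q by (auto simp: \<alpha> t_def order_less_imp_not_eq2)
  have \<alpha>_le: "aff \<alpha> z \<le> f z" if "z \<in> C" for z
  proof (cases "z = p")
    case False
    then have "t \<le> (f z - f p) / aff l z"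
      using q(3) that by (simp add: t_def)
    then show ?thesis
      using l(2)[OF that False] by (simp add: \<alpha> field_simps)
  qed (simp add: \<alpha>_eq)
  \<comment> \<open>Since \<open>C\<close> is not collinear, one of the two orientations of the line
    through \<open>p\<close> and \<open>q\<close> has points of \<open>C\<close> on its
    left.\<close>
  have "\<exists>p' q'. p' \<in> C \<and> q' \<in> C \<and> f p' = aff \<alpha> p' \<and> f q' = aff \<alpha> q' \<and> (\<exists>z\<in>C. cross p' q' z > 0)"
  proof (rule ccontr)
    assume "\<not> ?thesis"
    then have nopos: "\<not> cross p q z > 0" "\<not> cross q p z > 0" if "z \<in> C" for z
      using p(1) q(1) \<alpha>_eq that by blast+
    then have z0: "cross p q z = 0" if "z \<in> C" for z
      using nopos[OF that] cross_swap(1)[of q p z] by linarith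
    have on_line: "\<exists>s. z = (1 - s) *\<^sub>R p + s *\<^sub>R q" if "z \<in> C" for z
      using cross_zero_collinear[OF z0[OF that]] q(2) by metis
    obtain x y z where xyz: "x \<in> C" "y \<in> C" "z \<in> C" "cross x y z \<noteq> 0"
      using assms by blast
    obtain s1 s2 s3 where "x = (1 - s1) *\<^sub>R p + s1 *\<^sub>R q" "y = (1 - s2) *\<^sub>R p + s2 *\<^sub>R q"
      "z = (1 - s3) *\<^sub>R p + s3 *\<^sub>R q"
      using on_line xyz(1-3) by metis
    then have "cross x y z = 0"
      by (simp only: cross_def) (simp add: algebra_simps)
    with xyz(4) show False by simp
  qed
  then obtain p' q' where p'q': "p' \<in> C" "q' \<in> C" "f p' = aff \<alpha> p'" "f q' = aff \<alpha> q'"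
    and ne: "C \<inter> {z. cross p' q' z > 0} \<noteq> {}"
    by blast
  let ?h = "\<lambda>z. (f z - aff \<alpha> z) / cross p' q' z"
  have "finite (C \<inter> {z. cross p' q' z > 0})"
    using C(1) by blast
  then obtain r where r': "r \<in> C \<inter> {z. cross p' q' z > 0}"
    and rmin': "\<And>z. z \<in> C \<inter> {z. cross p' q' z > 0} \<Longrightarrow> ?h r \<le> ?h z"
    using ne by (rule finite_argmin[where h = ?h]) (rule that)
  have r: "r \<in> C" "cross p' q' r > 0"
    using r' by auto
  have rmin: "?h r \<le> ?h z" if "z \<in> C" "cross p' q' z > 0" for z
    using rmin' that by blast
  \<comment> \<open>The smallest slope at which the function tilted about the line touches the graph
    over the left side. On the right side the tilt only lowers it, because
    \<open>u \<ge> 0\<close>.\<close>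
  define u where "u = ?h r"
  have u: "u \<ge> 0"
    using \<alpha>_le[OF r(1)] r(2) by (simp add: u_def)
  obtain e where e: "\<And>x. cross p' q' x = aff e x"
    using cross_aff by blast
  obtain \<gamma> where "\<And>x. aff \<gamma> x = 1 * aff \<alpha> x + u * aff e x"
    using aff_comb[of 1 \<alpha> u e] by blast
  then have \<gamma>: "aff \<gamma> x = aff \<alpha> x + u * cross p' q' x" for x
    by (simp add: e)
  show ?thesis
  proof (rule that[OF p'q'(1,2) r])
    show "f p' = aff \<gamma> p'" "f q' = aff \<gamma> q'" "f r = aff \<gamma> r"
      using p'q' r by (auto simp: \<gamma> cross_zero u_def)
    fix z assume z: "z \<in> C"
    show "aff \<gamma> z \<le> f z"
    proof (cases "cross p' q' z > 0")
      case True
      then have "u \<le> ?h z"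
        using rmin[OF z] by (simp add: u_def)
      with True show ?thesis
        by (simp add: \<gamma> field_simps)
    next
      case False
      then have "u * cross p' q' z \<le> 0"
        using u by (simp add: mult_nonneg_nonpos)
      with \<alpha>_le[OF z] show ?thesis
        by (simp add: \<gamma>)
    qed
  qed
qed

text \<open>The initial triangle and the three caps beyond its edges exhaust the body.
  \<open>cap_majorant\<close> treats each cap, with the opposite vertex on the other side, and its
  ramps vanish on the remaining parts.\<close>

lemma ridge_majorant:
  assumes "\<exists>x\<in>C. \<exists>y\<in>C. \<exists>z\<in>C. cross x y z \<noteq> 0"
  obtains F \<beta> where "ridge_sum F" "\<And>x. x \<in> K \<Longrightarrow> f x \<le> aff \<beta> x + F x"
    "\<And>x. x \<in> frontier K \<Longrightarrow> f x = aff \<beta> x + F x"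
proof -
  obtain p q r \<beta> where pqr: "p \<in> C" "q \<in> C" "r \<in> C" "cross p q r > 0"
    and \<beta>: "f p = aff \<beta> p" "f q = aff \<beta> q" "f r = aff \<beta> r" and ge: "\<And>z. z \<in> C \<Longrightarrow> f z \<ge> aff \<beta> z"
    using hull_triangle[OF assms] by metis
  have inK: "p \<in> K" "q \<in> K" "r \<in> K" and fr: "p \<in> frontier K" "q \<in> frontier K" "r \<in> frontier K"
    using pqr C_K C by auto
  have frK: "frontier K \<subseteq> K"
    using K by (simp add: frontier_subset_closed)
  obtain F where F: "ridge_sum F" "\<And>x. x \<in> K \<Longrightarrow> cross p r x \<le> 0 \<Longrightarrow> F x = 0"
      "\<And>x. x \<in> K \<Longrightarrow> cross p r x > 0 \<Longrightarrow> f x \<le> aff \<beta> x + F x"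
      "\<And>x. x \<in> frontier K \<Longrightarrow> cross p r x > 0 \<Longrightarrow> f x = aff \<beta> x + F x"
    using cap_majorant[of p r \<beta> q] pqr \<beta> ge cross_swap(2)[of p r q] by auto
  obtain G where G: "ridge_sum G" "\<And>x. x \<in> K \<Longrightarrow> cross r q x \<le> 0 \<Longrightarrow> G x = 0"
      "\<And>x. x \<in> K \<Longrightarrow> cross r q x > 0 \<Longrightarrow> f x \<le> aff \<beta> x + G x"
      "\<And>x. x \<in> frontier K \<Longrightarrow> cross r q x > 0 \<Longrightarrow> f x = aff \<beta> x + G x"
    using cap_majorant[of r q \<beta> p] pqr \<beta> ge cross_swap(3)[of r q p] by auto
  obtain E where E: "ridge_sum E" "\<And>x. x \<in> K \<Longrightarrow> cross q p x \<le> 0 \<Longrightarrow> E x = 0"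
      "\<And>x. x \<in> K \<Longrightarrow> cross q p x > 0 \<Longrightarrow> f x \<le> aff \<beta> x + E x"
      "\<And>x. x \<in> frontier K \<Longrightarrow> cross q p x > 0 \<Longrightarrow> f x = aff \<beta> x + E x"
    using cap_majorant[of q p \<beta> r] pqr \<beta> ge cross_swap(1)[of q p r] by auto
  have main: "f x \<le> aff \<beta> x + (E x + (F x + G x)) \<and> (x \<in> frontier K \<longrightarrow> f x = aff \<beta> x + (E x + (F x + G x)))"
    if x: "x \<in> K" for x
  proof (cases "cross p q x < 0")
    case True
    then have "F x = 0" "G x = 0"
      using cap_subset_left[OF K fr(1) inK(2,3) x pqr(4) _ x True] F(2)[OF x]
        cap_subset_right[OF K fr(2) inK(1,3) x pqr(4) _ x True] G(2)[OF x] by auto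
    then show ?thesis
      using E(3,4)[of x] True x cross_swap(1)[of q p x] by simp
  next
    case False
    then have E0: "E x = 0"
      using E(2)[OF x] cross_swap(1)[of q p x] by simp
    show ?thesis
    proof (cases "cross p r x > 0")
      case True
      then have "G x = 0"
        using caps_disjoint[OF K inK(1,2) fr(3) x pqr(4)] G(2) x by blast
      with F(3,4)[of x] True x E0 show ?thesis by simp
    next
      case r1: False
      then have F0: "F x = 0"
        using F(2) x by simp
      show ?thesis
      proof (cases "cross r q x > 0")
        case True
        with G(3,4)[of x] F0 E0 x show ?thesis by simp
      next
        case r2: False
        then have "G x = 0"
          using G(2) x by simp
        moreover have "f x \<le> aff \<beta> x"
          using triangle_le[OF pqr(4), of x] False r1 r2 \<beta> by simp
        moreover have "f x = aff \<beta> x" if "x \<in> frontier K"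
          using triangle_eq[OF pqr that _ _ _ \<beta> ge] False r1 r2 ge by simp
        ultimately show ?thesis
          using F0 E0 by simp
      qed
    qed
  qed
  show ?thesis
    by (rule that[of "\<lambda>x. E x + (F x + G x)" \<beta>]) (use main frK E F G in \<open>auto intro: ridge_sum_add\<close>)
qed

end

section \<open>Creases in a convex body\<close>

text \<open>On the compact set where the two functions agree, the extreme points in the direction of
  the line serve as ends. They are boundary points of \<open>K\<close>, since from an interior point
  one could move further along the line inside \<open>K\<close>.\<close>

lemma chord_endpoints:
  fixes K :: "(real \<times> real) set"
  assumes K: "compact K" and aa': "a \<noteq> a'"
  shows "\<exists>E. finite E \<and> E \<subseteq> frontier K \<and> (\<forall>z\<in>K. aff a z = aff a' z \<longrightarrow>
     (\<exists>z1\<in>E. \<exists>z2\<in>E. z \<in> closed_segment z1 z2 \<and> aff a z1 = aff a' z1 \<and> aff a z2 = aff a' z2))"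
proof -
  define S where "S = K \<inter> {z. aff a z = aff a' z}"
  show ?thesis
  proof (cases "S = {}")
    case True
    then show ?thesis
      by (intro exI[of _ "{}"]) (auto simp: S_def)
  next
    case False
    have "compact S"
      unfolding S_def by (intro compact_Int_closed K closed_Collect_eq continuous_aff)
    define w where "w = fst a - fst a'"
    have "w \<noteq> 0"
    proof
      assume "w = 0"
      then have "fst a = fst a'" "snd a \<noteq> snd a'"
        using aa' by (auto simp: w_def prod_eq_iff)
      then show False
        using False by (auto simp: S_def aff_def)
    qed
    \<comment> \<open>\<open>w\<close> rotated by a right angle: the direction of the line on which
      the two functions agree.\<close>
    define v where "v = (- snd w, fst w)"
    have v0: "v \<noteq> 0" and wv: "w \<bullet> v = 0"
      using \<open>w \<noteq> 0\<close> by (auto simp: v_def inner_prod_def prod_eq_iff)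
    have uniq: "x = y" if "w \<bullet> x = w \<bullet> y" "v \<bullet> x = v \<bullet> y" for x y :: "real \<times> real"
    proof -
      define d where "d = x - y"
      have d: "fst w * fst d + snd w * snd d = 0" "- snd w * fst d + fst w * snd d = 0"
        using that by (auto simp: d_def v_def inner_prod_def algebra_simps)
      have "(fst w * fst w + snd w * snd w) * fst d
          = fst w * (fst w * fst d + snd w * snd d) - snd w * (- snd w * fst d + fst w * snd d)"
        "(fst w * fst w + snd w * snd w) * snd d
          = snd w * (fst w * fst d + snd w * snd d) + fst w * (- snd w * fst d + fst w * snd d)"
        by (simp_all add: algebra_simps)
      then have "(fst w * fst w + snd w * snd w) * fst d = 0" "(fst w * fst w + snd w * snd w) * snd d = 0"
        using d by simp_all
      moreover have "fst w * fst w + snd w * snd w \<noteq> 0"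
        using \<open>w \<noteq> 0\<close> by (simp add: prod_eq_iff sum_squares_eq_zero_iff)
      ultimately have "fst d = 0" "snd d = 0"
        using mult_eq_0_iff by blast+
      then have "d = 0"
        by (simp add: prod_eq_iff)
      then show ?thesis
        by (simp add: d_def)
    qed
    have Sw: "aff a z = aff a' z \<longleftrightarrow> w \<bullet> z = snd a' - snd a" for z
      by (auto simp: w_def aff_def algebra_simps)
    have "continuous_on S (\<lambda>z. v \<bullet> z)"
      by (intro continuous_intros)
    then obtain z1 z2 where z1: "z1 \<in> S" "\<And>z. z \<in> S \<Longrightarrow> v \<bullet> z \<le> v \<bullet> z1"
      and z2: "z2 \<in> S" "\<And>z. z \<in> S \<Longrightarrow> v \<bullet> z2 \<le> v \<bullet> z"
      using continuous_attains_sup[OF \<open>compact S\<close> False] continuous_attains_inf[OF \<open>compact S\<close> False]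
      by metis
    \<comment> \<open>Both ends at once: \<open>c\<close> is 1 for the upper end and -1 for the
      lower one.\<close>
    have fr: "z \<in> frontier K" if "z \<in> S" and ext: "\<And>y. y \<in> S \<Longrightarrow> c * (v \<bullet> y) \<le> c * (v \<bullet> z)" and "c \<noteq> 0" for z c
    proof -
      have "z \<notin> interior K"
      proof
        assume "z \<in> interior K"
        then obtain e where e: "e > 0" "cball z e \<subseteq> K"
          using mem_interior_cball by blast
        let ?y = "z + (sgn c * e / norm v) *\<^sub>R v"
        have "dist z ?y = e"
          using v0 e \<open>c \<noteq> 0\<close> by (simp add: dist_norm abs_mult abs_sgn_eq)
        moreover have "w \<bullet> ?y = w \<bullet> z"
          by (simp add: inner_add_right wv)
        moreover have "w \<bullet> z = snd a' - snd a"
          using \<open>z \<in> S\<close> Sw by (simp add: S_def)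
        ultimately have "?y \<in> cball z e" "aff a ?y = aff a' ?y"
          using Sw by simp_all
        then have "?y \<in> S"
          using e(2) unfolding S_def by blast
        then have "c * (v \<bullet> ?y) \<le> c * (v \<bullet> z)"
          by (rule ext)
        moreover have "c * (v \<bullet> ?y) = c * (v \<bullet> z) + \<bar>c\<bar> * e / norm v * (v \<bullet> v)"
          by (simp add: inner_add_right abs_sgn algebra_simps)
        moreover have "\<bar>c\<bar> * e / norm v * (v \<bullet> v) > 0"
          using v0 e \<open>c \<noteq> 0\<close> by simp
        ultimately show False by linarith
      qed
      then show ?thesis
        using that closure_subset by (auto simp: frontier_def S_def)
    qed
    have "z1 \<in> frontier K" "z2 \<in> frontier K"
      using fr[OF z1(1), of 1] fr[OF z2(1), of "-1"] z1(2) z2(2) by auto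
    moreover have "z \<in> closed_segment z2 z1" if "z \<in> S" for z
    proof (cases "v \<bullet> z1 = v \<bullet> z2")
      case True
      then have "v \<bullet> z = v \<bullet> z1"
        using z1(2)[OF that] z2(2)[OF that] by simp
      moreover have "w \<bullet> z = w \<bullet> z1"
        using that z1(1) by (simp add: S_def Sw)
      ultimately have "z = z1"
        using uniq by blast
      then show ?thesis by simp
    next
      case False
      then have lt: "v \<bullet> z2 < v \<bullet> z1"
        using z1(2)[OF z2(1)] by simp
      define s where "s = (v \<bullet> z - v \<bullet> z2) / (v \<bullet> z1 - v \<bullet> z2)"
      have s: "0 \<le> s" "s \<le> 1" "s * (v \<bullet> z1 - v \<bullet> z2) = v \<bullet> z - v \<bullet> z2"
        using lt z1(2)[OF that] z2(2)[OF that] by (auto simp: s_def)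
      have "v \<bullet> z = v \<bullet> ((1 - s) *\<^sub>R z2 + s *\<^sub>R z1)"
        using s(3) by (simp add: inner_add_right inner_diff_right algebra_simps)
      moreover have "w \<bullet> z = w \<bullet> ((1 - s) *\<^sub>R z2 + s *\<^sub>R z1)"
      proof -
        have "w \<bullet> z = snd a' - snd a" "w \<bullet> z1 = snd a' - snd a" "w \<bullet> z2 = snd a' - snd a"
          using that z1(1) z2(1) by (auto simp: S_def Sw)
        then show ?thesis
          by (simp only: inner_add_right inner_scaleR_right) (simp add: algebra_simps)
      qed
      ultimately have "z = (1 - s) *\<^sub>R z2 + s *\<^sub>R z1"
        using uniq by blast
      with s show ?thesis
        unfolding in_segment by blast
    qed
    moreover have "aff a z1 = aff a' z1" "aff a z2 = aff a' z2"
      using z1(1) z2(1) by (auto simp: S_def)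
    ultimately have "finite {z1, z2} \<and> {z1, z2} \<subseteq> frontier K \<and> (\<forall>z\<in>K. aff a z = aff a' z \<longrightarrow>
        z \<in> closed_segment z2 z1 \<and> aff a z1 = aff a' z1 \<and> aff a z2 = aff a' z2)"
      by (simp add: S_def)
    then show ?thesis
      by (intro exI[of _ "{z1, z2}"]) blast
  qed
qed

text \<open>A convex body is the convex hull of its boundary, so a collinear boundary would confine
  it to a line, which has no interior.\<close>

lemma frontier_not_collinear:
  fixes K :: "(real \<times> real) set"
  assumes K: "compact K" "convex K" "interior K \<noteq> {}"
  shows "\<exists>x\<in>frontier K. \<exists>y\<in>frontier K. \<exists>z\<in>frontier K. cross x y z \<noteq> 0"
proof (rule ccontr)
  assume "\<not> ?thesis"
  then have c0: "\<And>x y z. x \<in> frontier K \<Longrightarrow> y \<in> frontier K \<Longrightarrow> z \<in> frontier K \<Longrightarrow> cross x y z = 0"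
    by blast
  have hull: "K = convex hull (frontier K)"
    using Krein_Milman_frontier[OF K(2,1)] by simp
  have "\<exists>x\<in>frontier K. \<exists>y\<in>frontier K. x \<noteq> y"
  proof (rule ccontr)
    assume "\<not> ?thesis"
    then obtain x where "frontier K \<subseteq> {x}"
      by (metis equals0I singletonI subsetI)
    then have "K \<subseteq> {x}"
      using hull by (metis convex_hull_empty convex_hull_singleton subset_singletonD order_refl)
    then show False
      using K(3) by (metis all_not_in_conv interior_singleton interior_mono subset_empty)
  qed
  then obtain x y where xy: "x \<in> frontier K" "y \<in> frontier K" "x \<noteq> y" by blast
  obtain a where a: "\<And>z. cross x y z = aff a z"
    using cross_aff by blast
  have cv: "convex {z. cross x y z = 0}"
    unfolding convex_alt by (auto simp: cross_convex simp del: split_paired_All)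
  have "K \<subseteq> {z. cross x y z = 0}"
  proof (subst hull, rule hull_minimal)
    show "frontier K \<subseteq> {z. cross x y z = 0}"
      using c0[OF xy(1,2)] by blast
  qed (rule cv)
  moreover have "interior {z. cross x y z = 0} = {}"
  proof -
    have "fst a \<noteq> 0"
    proof
      assume "fst a = 0"
      then have "aff a (x + (- (snd y - snd x), fst y - fst x)) = aff a x"
        by (simp add: aff_def)
      then have "(fst y - fst x) * (fst y - fst x) + (snd y - snd x) * (snd y - snd x) = 0"
        unfolding a[symmetric] by (simp add: cross_def algebra_simps)
      then show False
        using xy(3) by (simp add: sum_squares_eq_zero_iff prod_eq_iff)
    qed
    moreover have "{z. cross x y z = 0} = {z. fst a \<bullet> z = - snd a}"
      unfolding a aff_def by (auto simp: add_eq_0_iff2)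
    ultimately show ?thesis
      using interior_hyperplane by metis
  qed
  ultimately show False
    using K(3) interior_mono by blast
qed

lemma polyhedral_majorant:
  fixes K :: "(real \<times> real) set"
  assumes K: "compact K" "convex K" "interior K \<noteq> {}" and A: "finite A" "A \<noteq> {}"
    and f: "\<And>x. f x = Max ((\<lambda>a. aff a x) ` A)"
  obtains F \<beta> where "ridge_sum F" "\<And>x. x \<in> K \<Longrightarrow> f x \<le> aff \<beta> x + F x"
    "\<And>x. x \<in> frontier K \<Longrightarrow> f x = aff \<beta> x + F x"
proof -
  obtain E where E: "\<And>a a'. a \<noteq> a' \<Longrightarrow> finite (E a a') \<and> E a a' \<subseteq> frontier K \<and>
    (\<forall>z\<in>K. aff a z = aff a' z \<longrightarrow>
     (\<exists>z1\<in>E a a'. \<exists>z2\<in>E a a'. z \<in> closed_segment z1 z2 \<and> aff a z1 = aff a' z1 \<and> aff a z2 = aff a' z2))"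
    using chord_endpoints[OF K(1)] by metis
  obtain x y z where xyz: "x \<in> frontier K" "y \<in> frontier K" "z \<in> frontier K" "cross x y z \<noteq> 0"
    using frontier_not_collinear[OF K] by blast
  \<comment> \<open>The three extra points guarantee a nondegenerate initial triangle even when
    there are no creases.\<close>
  define C where "C = {x, y, z} \<union> (\<Union>a\<in>A. \<Union>a'\<in>A - {a}. E a a')"
  have "finite (E a a')" if "a' \<in> A - {a}" for a a'
    using E[of a a'] that by blast
  then have finC: "finite C"
    using A(1) unfolding C_def by (intro finite_UnI finite_UN_I finite_Diff) auto
  have "E a a' \<subseteq> frontier K" if "a' \<in> A - {a}" for a a'
    using E[of a a'] that by blast
  then have subC: "C \<subseteq> frontier K"
    using xyz unfolding C_def by (intro Un_least UN_least) auto
  have "\<exists>z1\<in>C. \<exists>z2\<in>C. v \<in> closed_segment z1 z2 \<and> aff a z1 = aff a' z1 \<and> aff a z2 = aff a' z2"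
    if "a \<in> A" "a' \<in> A" "a \<noteq> a'" "v \<in> K" "aff a v = aff a' v" for a a' v
  proof -
    have "E a a' \<subseteq> C"
      using that(1-3) unfolding C_def by blast
    moreover have "\<exists>z1\<in>E a a'. \<exists>z2\<in>E a a'. v \<in> closed_segment z1 z2 \<and> aff a z1 = aff a' z1 \<and> aff a z2 = aff a' z2"
      using E[OF that(3)] that(4,5) by blast
    ultimately show ?thesis
      by (meson subsetD)
  qed
  moreover have "\<exists>x\<in>C. \<exists>y\<in>C. \<exists>z\<in>C. cross x y z \<noteq> 0"
    using xyz by (auto simp: C_def)
  ultimately show ?thesis
    using ridge_majorant[OF K(2) compact_imp_closed[OF K(1)] A f finC subC] that by blast
qed

section \<open>Tangents and polyhedral approximation\<close>

text \<open>Support the epigraph at the point above \<open>x\<close>. The hyperplane is not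
  vertical, because the epigraph extends over the whole space, and the last coefficient of its
  normal is negative, because the epigraph is unbounded upwards.\<close>

lemma convex_subgradient:
  fixes f :: "'a::euclidean_space \<Rightarrow> real"
  assumes "convex_on UNIV f"
  obtains g where "\<And>y. f x + g \<bullet> (y - x) \<le> f y"
proof -
  let ?E = "{z. f (fst z) \<le> snd z}"
  have cont: "continuous_on UNIV f"
    using convex_on_continuous[OF open_UNIV assms] .
  have "?E = epigraph UNIV f"
    by (auto simp: epigraph_def)
  then have "convex ?E"
    using assms by (simp add: convex_epigraph)
  moreover have "closed ?E"
    by (intro closed_Collect_le continuous_intros continuous_on_compose2[OF cont]) auto
  moreover have "(x, f x) \<in> frontier ?E"
  proof -
    have "(x, f x) \<notin> interior ?E"
    proof
      assume "(x, f x) \<in> interior ?E"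
      then obtain e where e: "e > 0" "cball (x, f x) e \<subseteq> ?E"
        using mem_interior_cball by blast
      have "(x, f x - e) \<in> cball (x, f x) e"
        using e by (simp add: dist_Pair_Pair dist_real_def)
      then have "(x, f x - e) \<in> ?E"
        using e by blast
      then show False
        using e by simp
    qed
    then show ?thesis
      using closure_subset[of ?E] by (auto simp: frontier_def)
  qed
  ultimately obtain n where n: "fst n \<noteq> 0" "aff n (x, f x) = 0" "\<And>z. z \<in> ?E \<Longrightarrow> aff n z \<le> 0"
    using frontier_support by blast
  obtain n1 n2 n3 where n_eq: "n = ((n1, n2), n3)"
    by (metis surj_pair)
  have le: "n1 \<bullet> (y - x) + n2 * (t - f x) \<le> 0" if "f y \<le> t" for y t
    using n(3)[of "(y, t)"] n(2) that by (simp add: n_eq aff_def inner_prod_def algebra_simps)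
  have "n2 \<le> 0"
    using le[of x "f x + 1"] by simp
  moreover have "n2 \<noteq> 0"
  proof
    assume "n2 = 0"
    then have "n1 \<bullet> n1 \<le> 0"
      using le[of "x + n1" "f (x + n1)"] by simp
    then have "n1 \<bullet> n1 = 0"
      using inner_ge_zero[of n1] by linarith
    then show False
      using n(1) \<open>n2 = 0\<close> by (simp add: n_eq zero_prod_def)
  qed
  ultimately have n2: "n2 < 0" by simp
  have "f x + ((1 / - n2) *\<^sub>R n1) \<bullet> (y - x) \<le> f y" for y
    using le[of y "f y"] n2 by (simp add: field_simps)
  then show ?thesis by (rule that)
qed

text \<open>Tangent functions lie below \<open>f\<close>, and each is within \<open>e\<close> of
  \<open>f\<close> on a neighbourhood of its point of contact; compactness leaves finitely
  many.\<close>

lemma polyhedral_approximation: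
  fixes f :: "'a::euclidean_space \<Rightarrow> real"
  assumes f: "convex_on UNIV f" and K: "compact K" and e: "e > 0"
  obtains A where "finite A" "A \<noteq> {}" "\<And>a x. a \<in> A \<Longrightarrow> aff a x \<le> f x"
    "\<And>x. x \<in> K \<Longrightarrow> \<exists>a\<in>A. f x - e \<le> aff a x"
proof -
  obtain g where g: "\<And>x y. f x + g x \<bullet> (y - x) \<le> f y"
  proof -
    have "\<exists>g. \<forall>y. f x + g \<bullet> (y - x) \<le> f y" for x
      using convex_subgradient[OF f, of x] by blast
    then have "\<exists>g. \<forall>x y. f x + g x \<bullet> (y - x) \<le> f y"
      by metis
    with that show ?thesis by blast
  qed
  define T where "T z = (g z, f z - g z \<bullet> z)" for z
  have T: "aff (T z) x = f z + g z \<bullet> (x - z)" for z x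
    by (simp add: T_def aff_def inner_diff_right)
  have cont: "continuous_on UNIV f"
    using convex_on_continuous[OF open_UNIV f] .
  define U where "U z = {x. f x - aff (T z) x < e}" for z
  have op: "open (U z)" if "z \<in> K" for z
    unfolding U_def by (intro open_Collect_less continuous_intros cont continuous_aff)
  have cov: "K \<subseteq> (\<Union>z\<in>K. U z)"
    using e by (auto simp: T U_def)
  obtain D where D: "D \<subseteq> K" "finite D" "K \<subseteq> (\<Union>z\<in>D. U z)"
    by (rule compactE_image[OF K op cov])
  \<comment> \<open>The tangent at \<open>undefined\<close> keeps the family nonempty when
    \<open>D\<close> is empty.\<close>
  show ?thesis
  proof (rule that[of "T ` insert undefined D"])
    show "\<exists>a\<in>T ` insert undefined D. f x - e \<le> aff a x" if "x \<in> K" for x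
    proof -
      obtain z where z: "z \<in> D" "x \<in> U z"
        using D(3) \<open>x \<in> K\<close> by blast
      then show ?thesis
        by (intro bexI[of _ "T z"]) (auto simp: U_def)
    qed
  qed (use D g T in auto)
qed

lemma integrable_continuous_compact:
  fixes f :: "'a::euclidean_space \<Rightarrow> real"
  assumes "finite_measure \<mu>" "sets \<mu> = sets borel" "compact K" "AE x in \<mu>. x \<in> K" "continuous_on UNIV f"
  shows "integrable \<mu> f"
proof -
  have "bounded (f ` K)"
    using compact_continuous_image[OF continuous_on_subset[OF assms(5) subset_UNIV] assms(3)]
    by (rule compact_imp_bounded)
  then obtain b where "\<forall>x\<in>K. norm (f x) \<le> b"
    unfolding bounded_iff by blast
  then have "AE x in \<mu>. norm (f x) \<le> b"
    using assms(4) by auto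
  moreover have "f \<in> borel_measurable \<mu>"
    using borel_measurable_continuous_onI[OF assms(5)] measurable_cong_sets[OF assms(2) refl] by blast
  ultimately show ?thesis
    using finite_measure.integrable_const_bound[OF assms(1)] by blast
qed

lemma continuous_ridge_sum: "ridge_sum F \<Longrightarrow> continuous_on UNIV F"
  by (induction rule: ridge_sum.induct) (auto intro!: continuous_intros continuous_aff)

text \<open>The law \<open>\<mu>\<close> lives on the body, where the majorant lies above the
  polyhedral approximation, and \<open>\<nu>\<close> lives on the boundary, where the two coincide.
  So the comparison of ramps and affine functions passes from the majorant to \<open>f\<close>, up
  to the error of the approximation.\<close>

lemma ridge_order_imp_convex_order:
  fixes K :: "(real \<times> real) set"
  assumes K: "compact K" "convex K" "interior K \<noteq> {}"
    and \<mu>: "prob_space \<mu>" "sets \<mu> = sets borel" "AE x in \<mu>. x \<in> K"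
    and \<nu>: "prob_space \<nu>" "sets \<nu> = sets borel" "AE x in \<nu>. x \<in> frontier K"
    and mean: "\<And>u. (\<integral>x. u \<bullet> x \<partial>\<mu>) = (\<integral>x. u \<bullet> x \<partial>\<nu>)"
    and ridge': "\<And>a. (\<integral>x. max 0 (aff a x) \<partial>\<mu>) \<le> (\<integral>x. max 0 (aff a x) \<partial>\<nu>)"
    and f: "convex_on UNIV f"
  shows "(\<integral>x. f x \<partial>\<mu>) \<le> (\<integral>x. f x \<partial>\<nu>)"
proof -
  interpret \<mu>: prob_space \<mu> by fact
  interpret \<nu>: prob_space \<nu> by fact
  have compF: "compact (frontier K)"
    using K(1) by (simp add: compact_frontier)
  have int\<mu>: "integrable \<mu> g" if "continuous_on UNIV g" for g :: "real \<times> real \<Rightarrow> real"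
    using integrable_continuous_compact[OF \<mu>.finite_measure_axioms \<mu>(2) K(1) \<mu>(3) that] .
  have int\<nu>: "integrable \<nu> g" if "continuous_on UNIV g" for g :: "real \<times> real \<Rightarrow> real"
    using integrable_continuous_compact[OF \<nu>.finite_measure_axioms \<nu>(2) compF \<nu>(3) that] .
  have contf: "continuous_on UNIV f"
    using convex_on_continuous[OF open_UNIV f] .
  have ridges: "(\<integral>x. F x \<partial>\<mu>) \<le> (\<integral>x. F x \<partial>\<nu>)" if "ridge_sum F" for F
    using that
  proof (induction rule: ridge_sum.induct)
    case (ridge F a)
    have c: "continuous_on UNIV F" "continuous_on UNIV (\<lambda>x. max 0 (aff a x))"
      using continuous_ridge_sum[OF ridge.hyps] by (auto intro!: continuous_intros continuous_aff)
    show ?case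
      using ridge.IH ridge'[of a] int\<mu>[OF c(1)] int\<mu>[OF c(2)] int\<nu>[OF c(1)] int\<nu>[OF c(2)]
      by (simp add: Bochner_Integration.integral_add)
  qed simp
  have affs: "(\<integral>x. aff b x \<partial>\<mu>) = (\<integral>x. aff b x \<partial>\<nu>)" for b
  proof -
    have c: "continuous_on UNIV (\<lambda>x. fst b \<bullet> x)"
      by (intro continuous_intros)
    show ?thesis
      using mean[of "fst b"] int\<mu>[OF c] int\<nu>[OF c]
      by (simp add: aff_def Bochner_Integration.integral_add \<mu>.prob_space \<nu>.prob_space)
  qed
  show ?thesis
  proof (rule field_le_epsilon)
    fix e :: real assume e: "e > 0"
    obtain A where A: "finite A" "A \<noteq> {}" and le: "\<And>a x. a \<in> A \<Longrightarrow> aff a x \<le> f x"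
      and ge: "\<And>x. x \<in> K \<Longrightarrow> \<exists>a\<in>A. f x - e \<le> aff a x"
      using polyhedral_approximation[OF f K(1) e] by metis
    define h where "h x = Max ((\<lambda>a. aff a x) ` A)" for x
    have hf: "h x \<le> f x" for x
      using A le by (simp add: h_def)
    have fh: "f x - e \<le> h x" if "x \<in> K" for x
    proof -
      obtain a where "a \<in> A" "f x - e \<le> aff a x"
        using ge[OF \<open>x \<in> K\<close>] by blast
      moreover from this have "aff a x \<le> h x"
        using A(1) unfolding h_def by (intro Max_ge) auto
      ultimately show ?thesis by linarith
    qed
    obtain F b where F: "ridge_sum F" and hF: "\<And>x. x \<in> K \<Longrightarrow> h x \<le> aff b x + F x"
      and hF_eq: "\<And>x. x \<in> frontier K \<Longrightarrow> h x = aff b x + F x"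
      using polyhedral_majorant[OF K A, of h] h_def by metis
    have cF: "continuous_on UNIV F" "continuous_on UNIV (aff b)"
      using continuous_ridge_sum[OF F] continuous_aff by blast+
    note ints = int\<mu>[OF contf] int\<nu>[OF contf] int\<mu>[OF cF(1)] int\<nu>[OF cF(1)] int\<mu>[OF cF(2)] int\<nu>[OF cF(2)]
    have "(\<integral>x. f x \<partial>\<mu>) \<le> (\<integral>x. aff b x + F x + e \<partial>\<mu>)"
    proof (rule integral_mono_AE)
      show "AE x in \<mu>. f x \<le> aff b x + F x + e"
        using \<mu>(3) by eventually_elim (use fh hF in force)
    qed (use ints in auto)
    also have "\<dots> = (\<integral>x. aff b x \<partial>\<mu>) + (\<integral>x. F x \<partial>\<mu>) + e"
      using ints by (simp add: Bochner_Integration.integral_add \<mu>.prob_space)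
    also have "\<dots> \<le> (\<integral>x. aff b x \<partial>\<nu>) + (\<integral>x. F x \<partial>\<nu>) + e"
      using affs ridges[OF F] by simp
    also have "(\<integral>x. aff b x \<partial>\<nu>) + (\<integral>x. F x \<partial>\<nu>) = (\<integral>x. aff b x + F x \<partial>\<nu>)"
      using ints by (simp add: Bochner_Integration.integral_add)
    also have "\<dots> \<le> (\<integral>x. f x \<partial>\<nu>)"
    proof (rule integral_mono_AE)
      show "AE x in \<nu>. aff b x + F x \<le> f x"
        using \<nu>(3) by eventually_elim (metis hf hF_eq)
    qed (use ints in auto)
    finally show "(\<integral>x. f x \<partial>\<mu>) \<le> (\<integral>x. f x \<partial>\<nu>) + e"
      by simp
  qed
qed

section \<open>Circumscribed polytopes\<close>

text \<open>The reflection in the hyperplane orthogonal to \<open>a - a'\<close>, which is its own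
  inverse.\<close>

lemma linear_isometry_reflection:
  fixes a a' :: "'a::euclidean_space"
  assumes "norm a = norm a'"
  obtains R where "linear_isometry R R" "R a = a'"
proof (cases "a = a'")
  case True
  have "linear_isometry (\<lambda>x :: 'a. x) (\<lambda>x. x)"
    by (rule linear_isometry.intro) (auto simp: linear_id[unfolded id_def])
  with True that show ?thesis by blast
next
  case False
  define v where "v = a - a'"
  define R where "R x = x - (2 * (x \<bullet> v) / (v \<bullet> v)) *\<^sub>R v" for x
  have v: "v \<bullet> v \<noteq> 0"
    using False by (simp add: v_def)
  have lin: "linear R"
    by (auto simp: linear_iff R_def inner_add_left add_divide_distrib algebra_simps)
  have Rv: "R x \<bullet> v = - (x \<bullet> v)" for x
    using v by (simp add: R_def inner_diff_left)
  have RR: "R (R x) = x" for x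
  proof -
    have "R (R x) = R x + (2 * (x \<bullet> v) / (v \<bullet> v)) *\<^sub>R v"
      unfolding R_def[of "R x"] Rv by simp
    then show ?thesis
      by (simp add: R_def)
  qed
  have "R x \<bullet> R x = x \<bullet> x" for x
  proof -
    have "R x \<bullet> R x = R x \<bullet> x - (2 * (x \<bullet> v) / (v \<bullet> v)) * (R x \<bullet> v)"
      by (subst (2) R_def) (simp add: inner_diff_right)
    also have "\<dots> = x \<bullet> x"
      unfolding Rv using v by (simp add: R_def inner_diff_left inner_commute[of v x])
    finally show ?thesis .
  qed
  then have "norm (R x) = norm x" for x
    by (simp add: norm_eq_sqrt_inner)
  with lin RR have "linear_isometry R R"
    by (intro linear_isometry.intro)
  moreover have "R a = a'"
  proof -
    have "a \<bullet> a = a' \<bullet> a'"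
      using assms by (simp add: norm_eq)
    then have "2 * (a \<bullet> v) = v \<bullet> v"
      by (simp add: v_def inner_diff_left inner_diff_right inner_commute)
    then show ?thesis
      using v by (simp add: R_def) (simp add: v_def)
  qed
  ultimately show ?thesis by (rule that)
qed

section \<open>Volumes of cones over subsets of a hyperplane\<close>

text \<open>For a unit vector \<open>a\<close> and a subset of the hyperplane
  \<open>a \<bullet> x = 0\<close>, the value is the volume of the cone with apex 0 over the
  parallel copy of the set at height \<open>r\<close>. The final shift by
  \<open>r *\<^sub>R a\<close> makes the measure live on a linear subspace.\<close>

definition cone_measure :: "'a::euclidean_space \<Rightarrow> real \<Rightarrow> 'a measure" where
  "cone_measure a r = distr (density lborel (indicator {z. 0 < a \<bullet> z \<and> a \<bullet> z \<le> r})) borel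
     (\<lambda>z. (r / (a \<bullet> z)) *\<^sub>R z - r *\<^sub>R a)"

lemma sets_cone_measure [simp]: "sets (cone_measure a r) = sets borel"
  by (simp add: cone_measure_def)

lemma cone_borel:
  fixes a :: "'a::euclidean_space"
  assumes [measurable]: "A \<in> sets borel"
  shows "{z. (0 < a \<bullet> z \<and> a \<bullet> z \<le> r) \<and> (r / (a \<bullet> z)) *\<^sub>R z - r *\<^sub>R a \<in> A} \<in> sets borel"
  by measurable

lemma emeasure_cone_measure:
  assumes A [measurable]: "A \<in> sets borel"
  shows "emeasure (cone_measure a r) A
    = emeasure lborel {z. (0 < a \<bullet> z \<and> a \<bullet> z \<le> r) \<and> (r / (a \<bullet> z)) *\<^sub>R z - r *\<^sub>R a \<in> A}"
proof -
  let ?E = "{z. 0 < a \<bullet> z \<and> a \<bullet> z \<le> r}" and ?p = "\<lambda>z. (r / (a \<bullet> z)) *\<^sub>R z - r *\<^sub>R a"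
  have [measurable]: "?E \<in> sets borel" "?p \<in> borel_measurable borel"
    by measurable
  have "emeasure (cone_measure a r) A = emeasure (density lborel (indicator ?E)) (?p -` A)"
    unfolding cone_measure_def by (subst emeasure_distr) auto
  also have "\<dots> = (\<integral>\<^sup>+z. indicator ?E z * indicator (?p -` A) z \<partial>lborel)"
    using measurable_sets[of ?p borel borel A] by (subst emeasure_density) auto
  also have "\<dots> = (\<integral>\<^sup>+z. indicator {z. (0 < a \<bullet> z \<and> a \<bullet> z \<le> r) \<and> ?p z \<in> A} z \<partial>lborel)"
    by (intro nn_integral_cong) (auto simp: indicator_def)
  also have "\<dots> = emeasure lborel {z. (0 < a \<bullet> z \<and> a \<bullet> z \<le> r) \<and> ?p z \<in> A}"
    using cone_borel[OF A] by (intro nn_integral_indicator) simp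
  finally show ?thesis .
qed

text \<open>Translating the base of a cone by \<open>v\<close> shears the cone: a point at height
  \<open>a \<bullet> z\<close> moves by the fraction \<open>(a \<bullet> z) / r\<close> of
  \<open>v\<close>. Shears preserve volume.\<close>

lemma cone_measure_translate:
  assumes "r > 0" "a \<bullet> v = 0" and A: "A \<in> sets borel"
  shows "emeasure (cone_measure a r) {x. x + v \<in> A} = emeasure (cone_measure a r) A"
proof -
  have [measurable]: "A \<in> sets borel" by fact
  have Av: "{x. x + v \<in> A} \<in> sets borel"
    by measurable
  let ?Z = "{z. (0 < a \<bullet> z \<and> a \<bullet> z \<le> r) \<and> (r / (a \<bullet> z)) *\<^sub>R z - r *\<^sub>R a \<in> A}"
  define \<phi> where "\<phi> z = (a \<bullet> z) / r" for z
  define p where "p z = (r / (a \<bullet> z)) *\<^sub>R z - r *\<^sub>R a" for z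
  have i: "a \<bullet> (z + \<phi> z *\<^sub>R v) = a \<bullet> z" for z
    using assms(2) by (simp add: inner_add_right)
  have "p (z + \<phi> z *\<^sub>R v) = p z + v" if "0 < a \<bullet> z" for z
    unfolding p_def i using that \<open>r > 0\<close> by (simp add: \<phi>_def scaleR_add_right)
  then have "{z. (0 < a \<bullet> z \<and> a \<bullet> z \<le> r) \<and> p z \<in> {x. x + v \<in> A}}
      = {z. z + \<phi> z *\<^sub>R v \<in> {z. (0 < a \<bullet> z \<and> a \<bullet> z \<le> r) \<and> p z \<in> A}}"
    unfolding mem_Collect_eq i by metis
  then have "{z. (0 < a \<bullet> z \<and> a \<bullet> z \<le> r) \<and> (r / (a \<bullet> z)) *\<^sub>R z - r *\<^sub>R a \<in> {x. x + v \<in> A}}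
      = {z. z + \<phi> z *\<^sub>R v \<in> ?Z}"
    by (simp only: p_def)
  moreover have "emeasure lborel {z. z + \<phi> z *\<^sub>R v \<in> ?Z} = emeasure lborel ?Z"
  proof (rule lborel_shear)
    show "\<phi> (x + \<tau> *\<^sub>R v) = \<phi> x" for x \<tau>
      using assms(2) by (simp add: \<phi>_def inner_add_right)
    show "\<phi> \<in> borel_measurable borel"
      unfolding \<phi>_def by measurable
    show "?Z \<in> sets borel"
      by (rule cone_borel[OF A])
  qed
  ultimately show ?thesis
    unfolding emeasure_cone_measure[OF A] emeasure_cone_measure[OF Av] by simp
qed

lemma AE_cone_measure:
  assumes "norm a = 1" "r > 0"
  shows "AE x in cone_measure a r. x \<in> {x. a \<bullet> x = 0}"
proof (rule AE_I)
  have aa: "a \<bullet> a = 1"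
    using assms(1) by (simp add: norm_eq_1)
  have B: "{x. a \<bullet> x \<noteq> 0} \<in> sets borel"
    by measurable
  have "{z. (0 < a \<bullet> z \<and> a \<bullet> z \<le> r) \<and> (r / (a \<bullet> z)) *\<^sub>R z - r *\<^sub>R a \<in> {x. a \<bullet> x \<noteq> 0}} = {}"
    by (auto simp: inner_diff_right aa)
  then show "emeasure (cone_measure a r) {x. a \<bullet> x \<noteq> 0} = 0"
    unfolding emeasure_cone_measure[OF B] by (simp only: emeasure_empty)
qed (auto simp: sets_eq_imp_space_eq[OF sets_cone_measure])

text \<open>Radial projection to height \<open>r\<close> does not decrease the norm, so the cone
  over a bounded set is bounded.\<close>

lemma cone_measure_finite:
  assumes "norm a = 1" "r > 0"
  shows "emeasure (cone_measure a r) (cball 0 \<rho>) \<noteq> \<infinity>"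
proof -
  have "{z. (0 < a \<bullet> z \<and> a \<bullet> z \<le> r) \<and> (r / (a \<bullet> z)) *\<^sub>R z - r *\<^sub>R a \<in> cball 0 \<rho>} \<subseteq> cball 0 (\<rho> + r)"
  proof
    fix z assume z: "z \<in> {z. (0 < a \<bullet> z \<and> a \<bullet> z \<le> r) \<and> (r / (a \<bullet> z)) *\<^sub>R z - r *\<^sub>R a \<in> cball 0 \<rho>}"
    have "norm ((r / (a \<bullet> z)) *\<^sub>R z) \<le> norm ((r / (a \<bullet> z)) *\<^sub>R z - r *\<^sub>R a) + norm (r *\<^sub>R a)"
      by (metis diff_add_cancel norm_triangle_ineq)
    also have "\<dots> \<le> \<rho> + r"
      using z assms by simp
    finally have "r / (a \<bullet> z) * norm z \<le> \<rho> + r"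
      using z assms by simp
    moreover have "norm z \<le> r / (a \<bullet> z) * norm z"
      using z mult_right_mono[of 1 "r / (a \<bullet> z)" "norm z"] by simp
    ultimately show "z \<in> cball 0 (\<rho> + r)"
      by simp
  qed
  then have "emeasure (cone_measure a r) (cball 0 \<rho>) \<le> emeasure lborel (cball (0 :: 'a) (\<rho> + r))"
    unfolding emeasure_cone_measure[OF borel_closed[OF closed_cball]] by (intro emeasure_mono) auto
  then show ?thesis
    using emeasure_lborel_cball_finite[of "0 :: 'a" "\<rho> + r"] by (auto simp: top_unique)
qed

text \<open>Points near \<open>(r / 2) *\<^sub>R a\<close> project close to the foot point and form
  an open subset of the cone.\<close>

lemma cone_measure_pos:
  assumes "norm a = 1" "r > 0" "\<rho> > 0"
  shows "emeasure (cone_measure a r) (cball 0 \<rho>) \<noteq> 0"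
proof -
  have aa: "a \<bullet> a = 1"
    using assms(1) by (simp add: norm_eq_1)
  let ?p = "\<lambda>z. (r / (a \<bullet> z)) *\<^sub>R z - r *\<^sub>R a" and ?S = "{z. 0 < a \<bullet> z \<and> a \<bullet> z < r}"
  let ?U = "?S \<inter> ?p -` ball 0 \<rho>"
  have "?S = {z. 0 < a \<bullet> z} \<inter> {z. a \<bullet> z < r}"
    by auto
  then have "open ?S"
    by (simp add: open_Int open_halfspace_gt open_halfspace_lt)
  moreover have "continuous_on ?S ?p"
    by (intro continuous_intros) auto
  ultimately have "open ?U"
    by (intro continuous_open_preimage) auto
  moreover have "(r / 2) *\<^sub>R a \<in> ?U"
    using assms aa by simp
  ultimately obtain e where e: "e > 0" "ball ((r / 2) *\<^sub>R a) e \<subseteq> ?U"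
    using open_contains_ball by blast
  have "0 < emeasure lborel (ball ((r / 2) *\<^sub>R a) e)"
    using content_ball_pos[OF e(1), of "(r / 2) *\<^sub>R a"] by (auto simp: measure_def zero_less_iff_neq_zero)
  also have "\<dots> \<le> emeasure lborel {z. (0 < a \<bullet> z \<and> a \<bullet> z \<le> r) \<and> ?p z \<in> cball 0 \<rho>}"
    using e(2) cone_borel[of "cball 0 \<rho>" a r] by (intro emeasure_mono) auto
  finally show ?thesis
    unfolding emeasure_cone_measure[OF borel_closed[OF closed_cball]] by simp
qed

text \<open>Used with a reflection that carries one facet normal to another: cones of equal height
  over balls of equal radius have the same volume for all normals.\<close>

lemma cone_measure_isometry:
  fixes R :: "'a::euclidean_space \<Rightarrow> 'a"
  assumes "linear_isometry R S"
  shows "emeasure (cone_measure (R a) r) (cball 0 \<rho>) = emeasure (cone_measure a r) (cball 0 \<rho>)"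
proof -
  interpret linear_isometry R S by fact
  let ?Z = "\<lambda>a. {z. (0 < a \<bullet> z \<and> a \<bullet> z \<le> r) \<and> (r / (a \<bullet> z)) *\<^sub>R z - r *\<^sub>R a \<in> cball 0 \<rho>}"
  have "R a \<bullet> R z = a \<bullet> z" for z
    using inner_T[of a "R z"] by (simp add: ST)
  moreover have "norm ((r / (a \<bullet> z)) *\<^sub>R R z - r *\<^sub>R R a) = norm ((r / (a \<bullet> z)) *\<^sub>R z - r *\<^sub>R a)" for z
    using norm_T[of "(r / (a \<bullet> z)) *\<^sub>R z - r *\<^sub>R a"]
    by (simp add: linear_diff[OF linear_T] linear_scale[OF linear_T])
  ultimately have "R -` ?Z (R a) = ?Z a"
    by (auto simp: mem_cball_0 simp del: mem_cball)
  moreover have "?Z (R a) \<in> sets borel"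
    by (rule cone_borel) simp
  ultimately show ?thesis
    using lborel_isometry[OF assms, of "?Z (R a)"]
    unfolding emeasure_cone_measure[OF borel_closed[OF closed_cball]] by simp
qed

section \<open>Surface measure on a hyperplane\<close>

context
  fixes H :: "'a::euclidean_space measure"
  assumes sets_H [measurable_cong]: "sets H = sets borel"
    and H_isometry: "\<And>T A. (\<And>x y. dist (T x) (T y) = dist x y) \<Longrightarrow> bij T \<Longrightarrow> A \<in> sets borel \<Longrightarrow> emeasure H (T -` A) = emeasure H A"
begin

lemma H_translate: "A \<in> sets borel \<Longrightarrow> emeasure H {x. x + v \<in> A} = emeasure H A"
proof -
  assume "A \<in> sets borel"
  moreover have "bij (\<lambda>x. x + v)"
    by (intro o_bij[of "\<lambda>x. x - v"]) auto
  ultimately show ?thesis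
    using H_isometry[of "\<lambda>x. x + v" A] by (simp add: vimage_def)
qed

definition plane_measure :: "'a \<Rightarrow> 'a measure" where
  "plane_measure a = density H (indicator {x. a \<bullet> x = 0})"

lemma plane_borel: "{x. a \<bullet> x = 0} \<in> sets H"
  unfolding sets_H by measurable

lemma emeasure_plane_measure:
  "A \<in> sets borel \<Longrightarrow> emeasure (plane_measure a) A = emeasure H ({x. a \<bullet> x = 0} \<inter> A)"
proof -
  assume "A \<in> sets borel"
  then have [measurable]: "A \<in> sets H" by (simp add: sets_H)
  have "emeasure (plane_measure a) A = (\<integral>\<^sup>+x. indicator {x. a \<bullet> x = 0} x * indicator A x \<partial>H)"
    unfolding plane_measure_def using plane_borel by (intro emeasure_density) auto
  also have "\<dots> = (\<integral>\<^sup>+x. indicator ({x. a \<bullet> x = 0} \<inter> A) x \<partial>H)"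
    by (intro nn_integral_cong) (auto simp: indicator_def)
  also have "\<dots> = emeasure H ({x. a \<bullet> x = 0} \<inter> A)"
    using plane_borel by (intro nn_integral_indicator) auto
  finally show ?thesis .
qed

lemma plane_measure_translate:
  assumes "a \<bullet> v = 0" and A: "A \<in> sets borel"
  shows "emeasure (plane_measure a) {x. x + v \<in> A} = emeasure (plane_measure a) A"
proof -
  have [measurable]: "A \<in> sets borel" by fact
  have "{x. a \<bullet> x = 0} \<inter> {x. x + v \<in> A} = {x. x + v \<in> {x. a \<bullet> x = 0} \<inter> A}"
    using assms by (auto simp: inner_add_right)
  moreover have "{x. x + v \<in> A} \<in> sets borel" "{x. a \<bullet> x = 0} \<inter> A \<in> sets borel"
    by measurable
  ultimately show ?thesis
    using A H_translate[of "{x. a \<bullet> x = 0} \<inter> A" v] by (simp only: emeasure_plane_measure)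
qed

text \<open>Finiteness of the surface measure is known only for parts of the boundary of the
  polytope. Translates of one small ball of finite mass cover every compact part of the hyperplane,
  which will give sigma-finiteness.\<close>

lemma plane_measure_finite:
  assumes fin: "emeasure (plane_measure a) (cball 0 \<rho>) \<noteq> \<infinity>" and "\<rho> > 0"
  shows "emeasure (plane_measure a) (cball 0 R) \<noteq> \<infinity>"
proof -
  let ?V = "{x. a \<bullet> x = 0}"
  have "compact (?V \<inter> cball 0 R)"
    by (intro closed_Int_compact closed_hyperplane) auto
  moreover have "open (ball v \<rho>)" if "v \<in> ?V" for v
    by simp
  moreover have "?V \<inter> cball 0 R \<subseteq> (\<Union>v\<in>?V. ball v \<rho>)"
    using \<open>\<rho> > 0\<close> by auto
  ultimately obtain W where W: "W \<subseteq> ?V" "finite W" "?V \<inter> cball 0 R \<subseteq> (\<Union>v\<in>W. ball v \<rho>)"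
    by (rule compactE_image)
  have W': "emeasure (plane_measure a) (cball v \<rho>) = emeasure (plane_measure a) (cball 0 \<rho>)" if "v \<in> W" for v
  proof -
    have "{x. x + - v \<in> cball 0 \<rho>} = cball v \<rho>"
      by (auto simp: dist_norm norm_minus_commute)
    moreover have "a \<bullet> - v = 0"
      using that W(1) by auto
    ultimately show ?thesis
      using plane_measure_translate[of a "- v" "cball 0 \<rho>"] by simp
  qed
  have "emeasure (plane_measure a) (cball 0 R) = emeasure (plane_measure a) (?V \<inter> cball 0 R)"
  proof -
    have "?V \<inter> cball 0 R \<in> sets borel" by measurable
    then show ?thesis
      by (simp add: emeasure_plane_measure)
  qed
  also have "\<dots> \<le> emeasure (plane_measure a) (\<Union>v\<in>W. cball v \<rho>)"
    using W by (intro emeasure_mono) (auto simp: plane_measure_def sets_H subset_iff less_imp_le intro!: borel_closed closed_UN, meson less_imp_le)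
  also have "\<dots> \<le> (\<Sum>v\<in>W. emeasure (plane_measure a) (cball v \<rho>))"
    using W(2) by (intro emeasure_subadditive_finite) (auto simp: plane_measure_def sets_H)
  also have "\<dots> = (\<Sum>v\<in>W. emeasure (plane_measure a) (cball 0 \<rho>))"
    by (intro sum.cong refl W')
  also have "\<dots> < \<infinity>"
    using fin W(2) by (simp add: ennreal_mult_less_top less_top of_nat_less_top)
  finally show ?thesis by simp
qed

lemma sigma_finite_balls:
  fixes M :: "'a measure"
  assumes "sets M = sets borel" "\<And>R. emeasure M (cball 0 R) \<noteq> \<infinity>"
  shows "sigma_finite_measure M"
proof
  have sp: "space M = UNIV"
    using sets_eq_imp_space_eq[OF assms(1)] by simp
  show "\<exists>A. countable A \<and> A \<subseteq> sets M \<and> \<Union> A = space M \<and> (\<forall>a\<in>A. emeasure M a \<noteq> \<infinity>)"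
  proof (intro exI[of _ "range (\<lambda>n::nat. cball 0 (real n))"] conjI)
    have "\<exists>n::nat. norm x \<le> real n" for x :: 'a
      by (rule real_arch_simple)
    then show "\<Union> (range (\<lambda>n::nat. cball 0 (real n))) = space M"
      by (auto simp: sp)
  qed (use assms in auto)
qed

text \<open>Both measures are concentrated on the hyperplane and invariant under its translations,
  hence proportional; the ball of radius \<open>\<rho>\<close> fixes the factor.\<close>

lemma plane_measure_eq_cone_measure:
  assumes a: "norm a = 1" and r: "r > 0" and \<rho>: "\<rho> > 0"
    and fin: "emeasure (plane_measure a) (cball 0 \<rho>) \<noteq> \<infinity>" and A: "A \<in> sets borel"
  shows "emeasure (plane_measure a) A * emeasure (cone_measure a r) (cball 0 \<rho>)
    = emeasure (plane_measure a) (cball 0 \<rho>) * emeasure (cone_measure a r) A"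
proof (rule translation_invariant_unique[where V = "{x. a \<bullet> x = 0}" and C = "cball 0 \<rho>"])
  show sp: "sets (plane_measure a) = sets borel"
    by (simp add: plane_measure_def sets_H)
  show "sigma_finite_measure (cone_measure a r)"
    by (intro sigma_finite_balls cone_measure_finite a r) simp
  show "sigma_finite_measure (plane_measure a)"
    by (intro sigma_finite_balls plane_measure_finite[OF fin \<rho>] sp)
  show "subspace {x. a \<bullet> x = 0}"
    by (rule subspace_hyperplane)
  show "AE x in plane_measure a. x \<in> {x. a \<bullet> x = 0}"
    unfolding plane_measure_def using plane_borel by (subst AE_density) (auto simp: indicator_def)
qed (use AE_cone_measure[OF a r] cone_measure_translate[OF r] plane_measure_translate A
     cone_measure_pos[OF a r \<rho>] cone_measure_finite[OF a r] in auto)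

lemma plane_measure_isometry:
  assumes "linear_isometry R S"
  shows "emeasure (plane_measure (R a)) (cball 0 \<rho>) = emeasure (plane_measure a) (cball 0 \<rho>)"
proof -
  interpret linear_isometry R S by fact
  have "R a \<bullet> R z = a \<bullet> z" for z
    using inner_T[of a "R z"] by (simp add: ST)
  then have "R -` ({x. R a \<bullet> x = 0} \<inter> cball 0 \<rho>) = {x. a \<bullet> x = 0} \<inter> cball 0 \<rho>"
    using norm_T by auto
  moreover have "{x. R a \<bullet> x = 0} \<inter> cball 0 \<rho> \<in> sets borel"
    by measurable
  ultimately show ?thesis
    using H_isometry[of R "{x. R a \<bullet> x = 0} \<inter> cball 0 \<rho>"] dist_T bij_T by (simp add: emeasure_plane_measure)
qed

end

section \<open>Facets tangent to the inscribed sphere\<close>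

text \<open>A hyperplane that meets a sphere in a single point meets it at the foot of the
  perpendicular from the centre. So all facet hyperplanes have the same distance \<open>r\<close>
  from \<open>c\<close>.\<close>

lemma facet_hyperplane:
  fixes K :: "'a::euclidean_space set"
  assumes K: "polytope K" "interior K \<noteq> {}" and F: "F facet_of K"
    and r: "r > 0" "sphere c r \<subseteq> K" "sphere_tangent_to c r F"
  obtains a where "norm a = 1" "\<And>x. x \<in> K \<Longrightarrow> a \<bullet> (x - c) \<le> r" "F = K \<inter> {x. a \<bullet> (x - c) = r}"
    "affine hull F = {x. a \<bullet> (x - c) = r}"
proof -
  obtain \<alpha> \<beta> where \<alpha>: "\<alpha> \<noteq> 0" "K \<subseteq> {x. \<alpha> \<bullet> x \<le> \<beta>}" "F = K \<inter> {x. \<alpha> \<bullet> x = \<beta>}"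
    using facet_of_polyhedron[OF polytope_imp_polyhedron[OF K(1)] F] by metis
  define a where "a = (1 / norm \<alpha>) *\<^sub>R \<alpha>"
  define d where "d = \<beta> / norm \<alpha> - a \<bullet> c"
  have a1: "norm a = 1" and aa: "a \<bullet> a = 1"
    using \<alpha>(1) by (simp_all add: a_def dot_square_norm power2_eq_square)
  have le_iff: "\<alpha> \<bullet> x \<le> \<beta> \<longleftrightarrow> a \<bullet> (x - c) \<le> d" and eq_iff: "\<alpha> \<bullet> x = \<beta> \<longleftrightarrow> a \<bullet> (x - c) = d" for x
    using \<alpha>(1) by (auto simp: a_def d_def inner_diff_right field_simps)
  have hull: "affine hull F = {x. \<alpha> \<bullet> x = \<beta>}"
  proof (rule affine_dim_equal)
    show "affine {x. \<alpha> \<bullet> x = \<beta>}"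
      by (rule affine_hyperplane)
    have "F \<noteq> {}"
      using F by (simp add: facet_of_def)
    then show "affine hull F \<noteq> {}"
      by simp
    show "affine hull F \<subseteq> {x. \<alpha> \<bullet> x = \<beta>}"
      using \<alpha>(3) by (intro hull_minimal affine_hyperplane) auto
    show "aff_dim (affine hull F) = aff_dim {x. \<alpha> \<bullet> x = \<beta>}"
      using F \<alpha>(1) aff_dim_nonempty_interior[OF K(2)] by (simp add: facet_of_def aff_dim_hyperplane)
  qed simp
  obtain x where x: "affine hull F \<inter> sphere c r = {x}"
    using r(3) by (auto simp: sphere_tangent_to_def)
  have xs: "a \<bullet> (x - c) = d" "norm (x - c) = r"
    using x hull eq_iff[of x] by (auto simp: dist_norm norm_minus_commute)
  \<comment> \<open>The reflection of \<open>x\<close> in the foot of the perpendicular from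
    \<open>c\<close>. It also lies in the hyperplane and on the sphere, so it is \<open>x\<close>
    itself.\<close>
  define y where "y = 2 *\<^sub>R (c + d *\<^sub>R a) - x"
  have yc: "y - c = (2 * d) *\<^sub>R a - (x - c)"
    by (simp add: y_def algebra_simps scaleR_2)
  have "a \<bullet> (y - c) = d"
    unfolding yc using xs aa by (simp add: inner_diff_right)
  moreover have "norm (y - c) = r"
  proof -
    have "(y - c) \<bullet> (y - c) = 4 * d * d * (a \<bullet> a) - 4 * d * (a \<bullet> (x - c)) + (x - c) \<bullet> (x - c)"
      unfolding yc by (simp only: inner_diff_left inner_diff_right inner_scaleR_left inner_scaleR_right)
        (simp add: inner_commute algebra_simps)
    also have "\<dots> = (x - c) \<bullet> (x - c)"
      using xs aa by simp
    finally show ?thesis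
      using xs(2) by (simp add: norm_eq_sqrt_inner)
  qed
  ultimately have "y \<in> affine hull F \<inter> sphere c r"
    unfolding hull using eq_iff[of y] by (simp add: dist_norm norm_minus_commute)
  then have "y = x"
    using x by blast
  then have "2 *\<^sub>R (x - c) = 2 *\<^sub>R (d *\<^sub>R a)"
    using yc by (simp add: scaleR_2 algebra_simps)
  then have "x - c = d *\<^sub>R a"
    by (simp only: scaleR_cancel_left) simp
  then have "\<bar>d\<bar> = r"
    using xs(2) a1 by simp
  \<comment> \<open>This point of the sphere belongs to \<open>K\<close> and excludes the sign
    \<open>d = - r\<close>.\<close>
  moreover have "c + r *\<^sub>R a \<in> K"
    using r(1,2) a1 by (auto simp: dist_norm)
  then have "r \<le> d"
    using \<alpha>(2) le_iff[of "c + r *\<^sub>R a"] aa by auto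
  ultimately have "d = r"
    using r(1) by linarith
  then show ?thesis
    using that[OF a1] \<alpha> le_iff eq_iff hull by auto
qed

lemma hausdorff_measure_isometry_vimage:
  fixes T :: "'a::euclidean_space \<Rightarrow> 'a"
  assumes H: "\<And>A. A \<in> sets borel \<Longrightarrow> emeasure (hausdorff_measure k :: 'a measure) A = hausdorff_outer k A"
    and T: "\<And>x y. dist (T x) (T y) = dist x y" "bij T" and A: "A \<in> sets borel"
  shows "emeasure (hausdorff_measure k) (T -` A) = emeasure (hausdorff_measure k) A"
proof -
  have "continuous_on UNIV T"
    unfolding continuous_on_iff by (auto simp: T(1))
  then have "T \<in> measurable (hausdorff_measure k) borel"
    using borel_measurable_continuous_onI measurable_cong_sets[OF sets_hausdorff_measure refl] by blast
  then show ?thesis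
    using A by (subst (2) hausdorff_measure_isometry[OF T H, symmetric]) (auto simp: emeasure_distr)
qed

lemma circumscribed_convex_order:
  fixes K :: "'a::euclidean_space set"
  assumes K: "polytope K" "interior K \<noteq> {}" and sph: "inscribed_sphere K c r"
    and H: "\<And>A. A \<in> sets borel \<Longrightarrow> emeasure (hausdorff_measure k :: 'a measure) A = hausdorff_outer k A"
      "emeasure (hausdorff_measure k) (frontier K) \<noteq> 0" "emeasure (hausdorff_measure k) (frontier K) \<noteq> \<infinity>"
    and mean: "\<And>u. (\<integral>x. u \<bullet> x \<partial>uniform_measure lborel K) = u \<bullet> c"
      "\<And>u. (\<integral>x. u \<bullet> x \<partial>uniform_measure (hausdorff_measure k) (frontier K)) = u \<bullet> c"
    and f: "convex_on UNIV f"
  shows "(\<integral>x. f x \<partial>uniform_measure lborel K) \<le> (\<integral>x. f x \<partial>uniform_measure (hausdorff_measure k) (frontier K))"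
proof -
  let ?H = "hausdorff_measure k :: 'a measure"
  let ?\<mu> = "uniform_measure lborel K" and ?\<nu> = "uniform_measure ?H (frontier K)"
  have r: "r > 0" "sphere c r \<subseteq> K" and tang: "\<And>F. F facet_of K \<Longrightarrow> sphere_tangent_to c r F"
    using sph by (auto simp: inscribed_sphere_def)
  have body: "convex_body K" and comp: "compact K" and conv: "convex K"
    using K polytope_imp_compact polytope_imp_convex by (auto simp: convex_body_def)
  then have clo: "closed K"
    by (simp add: compact_imp_closed)
  note Kb = convex_body_emeasure[OF body]
  define \<F> where "\<F> = {F. F facet_of K}"
  have fin\<F>: "finite \<F>"
    unfolding \<F>_def by (rule finite_polytope_facets[OF K(1)])
  have frontier: "frontier K = \<Union>\<F>"
    using rel_frontier_of_polyhedron[OF polytope_imp_polyhedron[OF K(1)]] rel_frontier_nonempty_interior[OF K(2)]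
    by (simp add: \<F>_def)
  have "\<exists>a. norm a = 1 \<and> (\<forall>x\<in>K. a \<bullet> (x - c) \<le> r) \<and> F = K \<inter> {x. a \<bullet> (x - c) = r}
      \<and> affine hull F = {x. a \<bullet> (x - c) = r}" if "F \<in> \<F>" for F
  proof -
    have F: "F facet_of K"
      using that by (simp add: \<F>_def)
    obtain a where "norm a = 1" "\<And>x. x \<in> K \<Longrightarrow> a \<bullet> (x - c) \<le> r" "F = K \<inter> {x. a \<bullet> (x - c) = r}"
      "affine hull F = {x. a \<bullet> (x - c) = r}"
      by (rule facet_hyperplane[OF K F r tang[OF F]]) (rule that)
    then show ?thesis
      by (intro exI[of _ a] conjI ballI)
  qed
  then have "\<forall>F\<in>\<F>. \<exists>a. norm a = 1 \<and> (\<forall>x\<in>K. a \<bullet> (x - c) \<le> r) \<and> F = K \<inter> {x. a \<bullet> (x - c) = r}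
      \<and> affine hull F = {x. a \<bullet> (x - c) = r}"
    by blast
  from bchoice[OF this] obtain a where a': "\<forall>F\<in>\<F>. norm (a F) = 1 \<and> (\<forall>x\<in>K. a F \<bullet> (x - c) \<le> r)
      \<and> F = K \<inter> {x. a F \<bullet> (x - c) = r} \<and> affine hull F = {x. a F \<bullet> (x - c) = r}" ..
  have a: "\<And>F. F \<in> \<F> \<Longrightarrow> norm (a F) = 1" "\<And>F x. F \<in> \<F> \<Longrightarrow> x \<in> K \<Longrightarrow> a F \<bullet> (x - c) \<le> r"
      "\<And>F. F \<in> \<F> \<Longrightarrow> F = K \<inter> {x. a F \<bullet> (x - c) = r}" "\<And>F. F \<in> \<F> \<Longrightarrow> affine hull F = {x. a F \<bullet> (x - c) = r}"
    using a' by blast+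
  have frK: "frontier K \<subseteq> K"
    using clo by (simp add: frontier_subset_closed)
  have "frontier K \<noteq> {}"
    using H(2) by auto
  then have \<F>ne: "\<F> \<noteq> {}"
    using frontier by auto
  have Fborel: "F \<in> sets borel" if "F \<in> \<F>" for F
  proof -
    have "closed F"
      using that K(1) unfolding \<F>_def
      by (metis face_of_imp_closed facet_of_imp_face_of mem_Collect_eq conv clo)
    then show ?thesis by simp
  qed
  have cK: "c \<in> K"
  proof -
    obtain e :: 'a where e: "norm e = 1"
      using a(1) \<F>ne by blast
    then have "c + r *\<^sub>R e \<in> K" "c - r *\<^sub>R e \<in> K"
      using r by (auto simp: dist_norm)
    then have "(1 / 2) *\<^sub>R (c + r *\<^sub>R e) + (1 / 2) *\<^sub>R (c - r *\<^sub>R e) \<in> K"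
      using conv by (intro convexD) auto
    also have "(1 / 2) *\<^sub>R (c + r *\<^sub>R e) + (1 / 2) *\<^sub>R (c - r *\<^sub>R e) = c"
      by (simp add: scaleR_add_right[symmetric] flip: scaleR_2)
    finally show ?thesis .
  qed
  have cint: "c \<in> interior K"
  proof -
    have "c \<notin> frontier K"
      unfolding frontier using a(3) r(1) by force
    then show ?thesis
      using cK clo by (simp add: frontier_def closure_closed)
  qed
  \<comment> \<open>The gauge of \<open>K\<close> with centre \<open>c\<close>: \<open>K\<close> is
    the set where \<open>h\<close> is at most 1, and \<open>p\<close> below is the radial projection
    to the boundary.\<close>
  define h where "h x = Max ((\<lambda>F. a F \<bullet> (x - c) / r) ` \<F>)" for x
  define p where "p x = c + (1 / h x) *\<^sub>R (x - c)" for x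
  have h_ge: "a F \<bullet> (x - c) / r \<le> h x" if "F \<in> \<F>" for F x
    unfolding h_def using that fin\<F> by (intro Max_ge) auto
  have h_attained: "\<exists>F\<in>\<F>. h x = a F \<bullet> (x - c) / r" for x
  proof -
    have "h x \<in> (\<lambda>F. a F \<bullet> (x - c) / r) ` \<F>"
      unfolding h_def using fin\<F> \<F>ne by (intro Max_in) auto
    then show ?thesis by blast
  qed
  have h_scale: "h (c + t *\<^sub>R (x - c)) = t * h x" if "t > 0" for t x
  proof (rule antisym)
    obtain F where F: "F \<in> \<F>" "h (c + t *\<^sub>R (x - c)) = a F \<bullet> (c + t *\<^sub>R (x - c) - c) / r"
      using h_attained by blast
    then have "h (c + t *\<^sub>R (x - c)) = t * (a F \<bullet> (x - c) / r)"
      by simp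
    also have "\<dots> \<le> t * h x"
      using h_ge[OF F(1)] that by (intro mult_left_mono) auto
    finally show "h (c + t *\<^sub>R (x - c)) \<le> t * h x" .
    obtain G where G: "G \<in> \<F>" "h x = a G \<bullet> (x - c) / r"
      using h_attained by blast
    then have "t * h x = a G \<bullet> (c + t *\<^sub>R (x - c) - c) / r"
      by simp
    also have "\<dots> \<le> h (c + t *\<^sub>R (x - c))"
      by (rule h_ge[OF G(1)])
    finally show "t * h x \<le> h (c + t *\<^sub>R (x - c))" .
  qed
  have h_le: "h x \<le> 1" if "x \<in> K" for x
    using h_attained[of x] a(2)[OF _ that] r(1) by auto
  \<comment> \<open>The segment from \<open>c\<close> to a point outside \<open>K\<close> crosses a
    facet at a parameter below 1; by linearity the functional of that facet exceeds \<open>r\<close>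
    at the end of the segment.\<close>
  have in_K: "x \<in> K" if "h x \<le> 1" for x
  proof (rule ccontr)
    assume x: "x \<notin> K"
    then have "closed_segment c x \<inter> frontier K \<noteq> {}"
      using cK by (intro connected_Int_frontier connected_segment) auto
    then obtain y where y: "y \<in> closed_segment c x" "y \<in> frontier K" by blast
    then obtain t where t: "0 \<le> t" "t \<le> 1" "y = (1 - t) *\<^sub>R c + t *\<^sub>R x"
      by (auto simp: in_segment)
    have yc: "y - c = t *\<^sub>R (x - c)"
      unfolding t(3) by (simp add: algebra_simps)
    obtain F where F: "F \<in> \<F>" "y \<in> F"
      using y(2) frontier by blast
    then have "a F \<bullet> (y - c) = r"
      using a(3) by blast
    then have e: "t * (a F \<bullet> (x - c)) = r"
      unfolding yc by simp
    have "t \<noteq> 1"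
      using x y(2) frK t(3) by auto
    then have "t < 1" "t > 0"
      using t e r(1) by (auto simp: less_le)
    moreover have "a F \<bullet> (x - c) \<le> r"
      using order_trans[OF h_ge[OF F(1), of x] that] r(1) by (simp add: divide_le_eq)
    then have "t * (a F \<bullet> (x - c)) \<le> t * r"
      using t(1) by (rule mult_left_mono)
    ultimately show False
      using e r(1) by simp
  qed
  have h_pos: "h x > 0" if "x \<noteq> c" for x
  proof (rule ccontr)
    assume "\<not> h x > 0"
    obtain B where B: "\<And>y. y \<in> K \<Longrightarrow> norm y \<le> B"
      using compact_imp_bounded[OF comp] by (auto simp: bounded_iff)
    \<comment> \<open>Far enough out to leave the ball of radius \<open>B\<close>: a ray on which
      \<open>h\<close> is not positive would stay in \<open>K\<close>, against boundedness.\<close>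
    define t where "t = (\<bar>B\<bar> + norm c + 1) / norm (x - c)"
    have t: "t > 0" "t * norm (x - c) = \<bar>B\<bar> + norm c + 1"
      using that by (auto simp: t_def add_nonneg_pos)
    have "t * h x \<le> 1"
      using t(1) \<open>\<not> h x > 0\<close> mult_nonneg_nonpos[of t "h x"] by simp
    then have "c + t *\<^sub>R (x - c) \<in> K"
      using in_K h_scale[OF t(1), of x] by simp
    from B[OF this] have "norm (c + t *\<^sub>R (x - c)) \<le> B" .
    moreover have "norm (t *\<^sub>R (x - c)) \<le> norm (c + t *\<^sub>R (x - c)) + norm c"
      using norm_triangle_ineq4[of "c + t *\<^sub>R (x - c)" c] by simp
    ultimately show False
      using t by simp
  qed
  have p_frontier: "p x \<in> frontier K" if "x \<noteq> c" for x
  proof -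
    have hp: "h (p x) = 1"
      unfolding p_def using h_scale[of "1 / h x" x] h_pos[OF that] by simp
    obtain F where F: "F \<in> \<F>" "h (p x) = a F \<bullet> (p x - c) / r"
      using h_attained by blast
    then have "a F \<bullet> (p x - c) = r"
      using hp r(1) by simp
    moreover have "p x \<in> K"
      using hp by (intro in_K) simp
    ultimately show ?thesis
      using F(1) a(3) frontier by blast
  qed
  have hm [measurable]: "h \<in> borel_measurable borel"
    unfolding h_def using fin\<F> by (intro borel_measurable_Max) auto
  have pm [measurable]: "p \<in> borel_measurable borel"
    unfolding p_def by measurable
  define Q where "Q A = {x. (x \<in> K \<and> x \<noteq> c) \<and> p x \<in> A}" for A
  have Qb: "Q A \<in> sets borel" if "A \<in> sets borel" for A
  proof -
    have [measurable]: "A \<in> sets borel" "K \<in> sets borel"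
      using that Kb by auto
    show ?thesis
      unfolding Q_def by measurable
  qed
  obtain F0 where F0: "F0 \<in> \<F>" using \<F>ne by blast
  have "rel_interior F0 \<noteq> {}"
    using F0 conv unfolding \<F>_def
    by (metis facet_of_def face_of_imp_convex mem_Collect_eq rel_interior_eq_empty)
  \<comment> \<open>A ball of the hyperplane inside one facet. It is part of the boundary of
    \<open>K\<close> and therefore has finite surface measure.\<close>
  then obtain y0 \<rho> where y0: "y0 \<in> F0" and \<rho>: "\<rho> > 0" "cball y0 \<rho> \<inter> affine hull F0 \<subseteq> F0"
    using mem_rel_interior_cball by blast
  have sH: "sets ?H = sets borel" by simp
  have iso: "emeasure ?H (T -` A) = emeasure ?H A"
    if "\<And>x y. dist (T x) (T y) = dist x y" "bij T" "A \<in> sets borel" for T A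
    by (rule hausdorff_measure_isometry_vimage[OF _ that]) (rule H(1))
  have pl1: "emeasure (plane_measure ?H b) A = emeasure ?H ({x. b \<bullet> x = 0} \<inter> A)" if "A \<in> sets borel" for b A
    by (rule emeasure_plane_measure[OF sH _ that]) (fact iso)
  have pl2: "emeasure (plane_measure ?H b) A * emeasure (cone_measure b r) (cball 0 \<rho>)
      = emeasure (plane_measure ?H b) (cball 0 \<rho>) * emeasure (cone_measure b r) A"
    if "norm b = 1" "emeasure (plane_measure ?H b) (cball 0 \<rho>) \<noteq> \<infinity>" "A \<in> sets borel" for b A
    by (rule plane_measure_eq_cone_measure[OF sH _ that(1) r(1) \<rho>(1) that(2,3)]) (fact iso)
  have pl3: "emeasure (plane_measure ?H (R b)) (cball 0 \<rho>) = emeasure (plane_measure ?H b) (cball 0 \<rho>)"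
    if "linear_isometry R R" for R b
    by (rule plane_measure_isometry[OF sH _ that]) (fact iso)
  have pl4: "emeasure ?H {x. x + v \<in> A} = emeasure ?H A" if "A \<in> sets borel" for v A
    by (rule H_translate[OF sH _ that]) (fact iso)
  define m0 where "m0 = emeasure (cone_measure (a F0) r) (cball 0 \<rho>)"
  define h0 where "h0 = emeasure (plane_measure ?H (a F0)) (cball 0 \<rho>)"
  have m0: "m0 \<noteq> 0" "m0 \<noteq> \<infinity>"
    unfolding m0_def using cone_measure_pos cone_measure_finite a(1)[OF F0] r(1) \<rho>(1) by blast+
  have h0: "h0 \<noteq> \<infinity>"
  proof -
    let ?D = "{x. a F0 \<bullet> x = 0} \<inter> cball 0 \<rho>"
    have D: "?D \<in> sets borel" by measurable
    have "h0 = emeasure ?H ?D"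
      unfolding h0_def by (rule pl1) auto
    also have "\<dots> = emeasure ?H {x. x + - y0 \<in> ?D}"
      by (rule pl4[symmetric]) (use D in auto)
    also have "\<dots> \<le> emeasure ?H (frontier K)"
    proof (rule emeasure_mono)
      have "a F0 \<bullet> (y0 - c) = r"
        using y0 a(3)[OF F0] by blast
      then have "{x. x + - y0 \<in> ?D} \<subseteq> cball y0 \<rho> \<inter> affine hull F0"
        unfolding a(4)[OF F0] by (auto simp: inner_diff_right dist_norm norm_minus_commute)
      then show "{x. x + - y0 \<in> ?D} \<subseteq> frontier K"
        using \<rho>(2) F0 frontier by blast
    qed simp
    finally show ?thesis
      using H(3) by (auto simp: top_unique)
  qed
  \<comment> \<open>Reflections carry one facet normal to another, so the two constants are the same
    for all facets.\<close>
  have normals: "emeasure (cone_measure (a F) r) (cball 0 \<rho>) = m0 \<and> emeasure (plane_measure ?H (a F)) (cball 0 \<rho>) = h0"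
    if F: "F \<in> \<F>" for F
  proof -
    obtain R where R: "linear_isometry R R" "R (a F0) = a F"
      using linear_isometry_reflection[of "a F0" "a F"] a(1)[OF F0] a(1)[OF F] by auto
    show ?thesis
      using cone_measure_isometry[OF R(1), of "a F0" r \<rho>] pl3[OF R(1), of "a F0"]
      unfolding m0_def h0_def R(2) by blast
  qed
  \<comment> \<open>With the foot point \<open>c + r *\<^sub>R a F\<close> moved to the origin,
    surface measure on the facet becomes a plane measure, and the volume of \<open>Q A\<close> a
    cone measure. The factor is common to all facets because the height is always
    \<open>r\<close>.\<close>
  have facet_law: "emeasure ?H A * m0 = h0 * emeasure lborel (Q A)"
    if F: "F \<in> \<F>" and A: "A \<in> sets borel" "A \<subseteq> F" for F A
  proof -
    have [measurable]: "A \<in> sets borel" by fact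
    let ?o = "c + r *\<^sub>R a F"
    define A' where "A' = {y. y + ?o \<in> A}"
    have A'[measurable]: "A' \<in> sets borel"
      unfolding A'_def by measurable
    have aa: "a F \<bullet> a F = 1"
      using a(1)[OF F] by (simp add: norm_eq_1)
    have onF: "a F \<bullet> (x - c) = r" if "x \<in> A" for x
      using that A(2) a(3)[OF F] by blast
    have "A' \<subseteq> {x. a F \<bullet> x = 0}"
    proof
      fix y assume "y \<in> A'"
      then have "a F \<bullet> (y + ?o - c) = r"
        using onF[of "y + ?o"] by (simp only: A'_def mem_Collect_eq)
      then show "y \<in> {x. a F \<bullet> x = 0}"
        using aa by (simp add: inner_add_right inner_diff_right)
    qed
    then have "{x. a F \<bullet> x = 0} \<inter> A' = A'"
      by blast
    then have "emeasure (plane_measure ?H (a F)) A' = emeasure ?H A'"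
      using pl1[of A' "a F"] A' by simp
    also have "\<dots> = emeasure ?H A"
      unfolding A'_def by (rule pl4) (use A in auto)
    finally have plane: "emeasure (plane_measure ?H (a F)) A' = emeasure ?H A" .
    let ?Z = "{z. (0 < a F \<bullet> z \<and> a F \<bullet> z \<le> r) \<and> (r / (a F \<bullet> z)) *\<^sub>R z - r *\<^sub>R a F \<in> A'}"
    have "x \<in> Q A \<longleftrightarrow> x + - c \<in> ?Z" for x
    proof
      assume x: "x \<in> Q A"
      then have "x \<in> K" "x \<noteq> c" "p x \<in> A"
        by (auto simp: Q_def)
      note hx = h_pos[OF \<open>x \<noteq> c\<close>] h_le[OF \<open>x \<in> K\<close>]
      have "a F \<bullet> (p x - c) = r"
        by (rule onF) fact
      moreover have "a F \<bullet> (p x - c) = (a F \<bullet> (x - c)) / h x"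
        by (simp add: p_def)
      ultimately have e: "a F \<bullet> (x - c) = r * h x"
        using hx(1) by (simp add: divide_eq_eq)
      then have "r / (a F \<bullet> (x - c)) = 1 / h x"
        using r(1) by simp
      moreover have "r * h x \<le> r * 1"
        using hx r(1) by (intro mult_left_mono) auto
      ultimately show "x + - c \<in> ?Z"
        using e hx r(1) \<open>p x \<in> A\<close> by (simp add: A'_def p_def add.commute)
    next
      assume x: "x + - c \<in> ?Z"
      define t where "t = (a F \<bullet> (x - c)) / r"
      have t: "0 < t" "t \<le> 1" "r / (a F \<bullet> (x - c)) = 1 / t"
        using x r(1) by (auto simp: t_def)
      have y: "c + (1 / t) *\<^sub>R (x - c) \<in> A"
        using x unfolding mem_Collect_eq A'_def by (simp add: t(3)[symmetric] add.commute)
      define y where "y = c + (1 / t) *\<^sub>R (x - c)"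
      have "y \<in> K" "a F \<bullet> (y - c) = r"
        using y A(2) a(3)[OF F] onF unfolding y_def by blast+
      then have "h y = 1"
        using h_le[of y] h_ge[OF F, of y] r(1) by simp
      moreover have xy: "x = c + t *\<^sub>R (y - c)"
        using t by (simp add: y_def)
      ultimately have hx: "h x = t"
        using h_scale[OF t(1), of y] by simp
      then have "x \<in> K"
        using t by (intro in_K) simp
      moreover have "p x \<in> A"
        using y by (simp add: p_def hx)
      moreover have "x \<noteq> c"
        using x by auto
      ultimately show "x \<in> Q A"
        by (simp add: Q_def)
    qed
    then have "Q A = {x. x + - c \<in> ?Z}"
      by blast
    then have "emeasure lborel (Q A) = emeasure lborel ?Z"
      using lborel_translate[OF cone_borel[OF A', of "a F" r], of "- c"] by (simp only:)
    also have "\<dots> = emeasure (cone_measure (a F) r) A'"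
      by (rule emeasure_cone_measure[OF A', symmetric])
    finally have "emeasure lborel (Q A) = emeasure (cone_measure (a F) r) A'" .
    then show ?thesis
      using pl2[of "a F" A'] a(1)[OF F] A' plane normals[OF F] h0 by simp
  qed
  \<comment> \<open>Facets overlap in lower-dimensional faces. Splitting off
    \<open>A \<inter> F\<close> for one facet at a time avoids showing that the overlaps are
    null.\<close>
  have law': "A \<subseteq> \<Union>\<G> \<longrightarrow> emeasure ?H A * m0 = h0 * emeasure lborel (Q A)"
    if "finite \<G>" "\<G> \<subseteq> \<F>" "A \<in> sets borel" for \<G> A
    using that
  proof (induction \<G> arbitrary: A rule: finite_induct)
    case (insert F \<G>)
    have AF: "A \<inter> F \<in> sets borel" "A - F \<in> sets borel"
      using insert.prems Fborel by auto
    have un: "A = (A \<inter> F) \<union> (A - F)" "Q A = Q (A \<inter> F) \<union> Q (A - F)" "Q (A \<inter> F) \<inter> Q (A - F) = {}"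
      by (auto simp: Q_def)
    have "emeasure ?H A = emeasure ?H (A \<inter> F) + emeasure ?H (A - F)"
      using AF by (subst un(1), intro plus_emeasure[symmetric]) auto
    moreover have "emeasure lborel (Q A) = emeasure lborel (Q (A \<inter> F)) + emeasure lborel (Q (A - F))"
      using Qb[OF AF(1)] Qb[OF AF(2)] un(3) by (subst un(2), intro plus_emeasure[symmetric]) auto
    moreover have "emeasure ?H (A \<inter> F) * m0 = h0 * emeasure lborel (Q (A \<inter> F))"
      using insert.prems AF by (intro facet_law[of F]) auto
    ultimately show ?case
      using insert.IH[of "A - F"] insert.prems AF by (auto simp: distrib_left distrib_right)
  qed (auto simp: Q_def)
  have law: "emeasure ?H A * m0 = h0 * emeasure lborel (Q A)" if "A \<in> sets borel" "A \<subseteq> frontier K" for A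
    using law'[OF fin\<F> order_refl that(1)] that(2) frontier by simp
  have Qfr: "Q (frontier K \<inter> B) = (K \<inter> p -` B) - {c}" for B
    using p_frontier by (auto simp: Q_def)
  have Qfr_meas: "emeasure lborel (Q (frontier K \<inter> B)) = emeasure lborel (K \<inter> p -` B)" if "B \<in> sets borel" for B
    unfolding Qfr using measurable_sets[OF pm that] Kb(1) by (intro emeasure_Diff_null_set) auto
  have push: "distr ?\<mu> borel p = ?\<nu>"
  proof (rule measure_eqI)
    fix B assume "B \<in> sets (distr ?\<mu> borel p)"
    then have B: "B \<in> sets borel" by simp
    have pB: "p -` B \<in> sets borel"
      using measurable_sets[OF pm B] by simp
    have l1: "emeasure ?H (frontier K \<inter> B) * m0 = h0 * emeasure lborel (K \<inter> p -` B)"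
      using law[of "frontier K \<inter> B"] Qfr_meas[OF B] B by simp
    have l2: "emeasure ?H (frontier K) * m0 = h0 * emeasure lborel K"
      using law[of "frontier K"] Qfr_meas[of UNIV] by simp
    have "m0 * (emeasure lborel (K \<inter> p -` B) * emeasure ?H (frontier K))
        = emeasure lborel (K \<inter> p -` B) * (emeasure ?H (frontier K) * m0)"
      by (simp add: mult_ac)
    also have "\<dots> = (h0 * emeasure lborel (K \<inter> p -` B)) * emeasure lborel K"
      unfolding l2 by (simp add: mult_ac)
    also have "\<dots> = m0 * (emeasure lborel K * emeasure ?H (frontier K \<inter> B))"
      unfolding l1[symmetric] by (simp add: mult_ac)
    finally have "emeasure lborel (K \<inter> p -` B) * emeasure ?H (frontier K)
        = emeasure lborel K * emeasure ?H (frontier K \<inter> B)"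
      using m0 by (auto simp only: ennreal_mult_cancel_left infinity_ennreal_def)
    then have "emeasure lborel (K \<inter> p -` B) / emeasure lborel K = emeasure ?H (frontier K \<inter> B) / emeasure ?H (frontier K)"
      by (rule ennreal_cross_divide) (use Kb H in auto)
    then show "emeasure (distr ?\<mu> borel p) B = emeasure ?\<nu> B"
      using B pB Kb(1) by (simp add: emeasure_distr emeasure_uniform_measure)
  qed simp
  have prob: "prob_space ?\<mu>" "prob_space ?\<nu>"
    using Kb H by (auto intro!: prob_space_uniform_measure)
  have AE\<mu>: "AE x in ?\<mu>. x \<in> K \<and> x \<noteq> c"
    using Kb(1) AE_lborel_singleton[of c] by (intro AE_uniform_measureI) auto
  have AE\<nu>: "AE x in ?\<nu>. x \<in> frontier K"
    by (rule AE_uniform_measureI) auto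
  have int: "integrable ?\<mu> g" "integrable ?\<nu> g" if "continuous_on UNIV g" for g :: "'a \<Rightarrow> real"
    using integrable_continuous_compact[of ?\<mu> K g] integrable_continuous_compact[of ?\<nu> "frontier K" g]
      prob[THEN prob_space.finite_measure] AE\<mu> AE\<nu> comp compact_frontier[OF comp] that by auto
  obtain g where g: "\<And>y. f c + g \<bullet> (y - c) \<le> f y"
    using convex_subgradient[OF f, of c] by blast
  define f' where "f' x = f x - f c - g \<bullet> (x - c)" for x
  have contf: "continuous_on UNIV f"
    using convex_on_continuous[OF open_UNIV f] .
  have contf': "continuous_on UNIV f'"
    unfolding f'_def by (intro continuous_intros contf)
  have "f' x \<le> f' (p x)" if "x \<in> K" "x \<noteq> c" for x
  proof -
    note hx = h_pos[OF that(2)] h_le[OF that(1)]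
    have xe: "x = (1 - h x) *\<^sub>R c + h x *\<^sub>R p x"
      using hx by (simp add: p_def algebra_simps)
    have "f x \<le> (1 - h x) * f c + h x * f (p x)"
      using convex_onD[OF f, of "h x" c "p x"] hx xe by simp
    moreover have "g \<bullet> (x - c) = h x * (g \<bullet> (p x - c))"
      using hx by (simp add: p_def)
    ultimately have "f' x \<le> h x * f' (p x)"
      by (simp add: f'_def algebra_simps)
    also have "\<dots> \<le> 1 * f' (p x)"
      using hx g[of "p x"] by (intro mult_right_mono) (auto simp: f'_def)
    finally show ?thesis by simp
  qed
  then have AEf: "AE x in ?\<mu>. f' x \<le> f' (p x)"
    using AE\<mu> by auto
  have pm': "p \<in> measurable ?\<mu> borel"
    by simp
  have f'm: "f' \<in> borel_measurable borel"
    using contf' by (rule borel_measurable_continuous_onI)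
  have "integrable (distr ?\<mu> borel p) f'"
    unfolding push by (rule int(2)[OF contf'])
  then have intp: "integrable ?\<mu> (\<lambda>x. f' (p x))"
    using integrable_distr[OF pm'] by blast
  have main: "(\<integral>x. f' x \<partial>?\<mu>) \<le> (\<integral>x. f' (p x) \<partial>?\<mu>)"
    by (rule integral_mono_AE[OF int(1)[OF contf'] intp AEf])
  also have "\<dots> = (\<integral>x. f' x \<partial>distr ?\<mu> borel p)"
    by (rule integral_distr[OF pm' f'm, symmetric])
  also have "\<dots> = (\<integral>x. f' x \<partial>?\<nu>)"
    unfolding push ..
  finally have main: "(\<integral>x. f' x \<partial>?\<mu>) \<le> (\<integral>x. f' x \<partial>?\<nu>)" .
  have cg: "continuous_on UNIV (\<lambda>x. g \<bullet> x)"
    by (intro continuous_intros)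
  have p1: "measure ?\<mu> UNIV = 1" "measure ?\<nu> UNIV = 1"
    using prob[THEN prob_space.prob_space] by simp_all
  note fm = prob[THEN prob_space.finite_measure]
  have e: "f' = (\<lambda>x. (f x - g \<bullet> x) - (f c - g \<bullet> c))"
    by (auto simp: f'_def inner_diff_right)
  have "(\<integral>x. f' x \<partial>?\<mu>) = (\<integral>x. f x \<partial>?\<mu>) - g \<bullet> c - (f c - g \<bullet> c)"
    unfolding e using int(1)[OF contf] int(1)[OF cg] mean(1)[of g] fm p1
    by (simp add: Bochner_Integration.integral_diff finite_measure.integrable_const)
  moreover have "(\<integral>x. f' x \<partial>?\<nu>) = (\<integral>x. f x \<partial>?\<nu>) - g \<bullet> c - (f c - g \<bullet> c)"
    unfolding e using int(2)[OF contf] int(2)[OF cg] mean(2)[of g] fm p1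
    by (simp add: Bochner_Integration.integral_diff finite_measure.integrable_const)
  ultimately show ?thesis
    using main by simp
qed

section \<open>Volume of the convex hull as a function of one point\<close>

lemma measurable_line_section:
  fixes w :: "'a::euclidean_space"
  assumes [measurable]: "A \<in> sets borel"
  shows "(\<lambda>y. emeasure lborel {\<tau>. y + \<tau> *\<^sub>R w \<in> A}) \<in> borel_measurable borel"
proof -
  let ?S = "{z. fst z + snd z *\<^sub>R w \<in> A} :: ('a \<times> real) set"
  have "?S = (\<lambda>z. fst z + snd z *\<^sub>R w) -` A \<inter> space (borel \<Otimes>\<^sub>M lborel)"
    by (auto simp: space_pair_measure)
  also have "\<dots> \<in> sets (borel \<Otimes>\<^sub>M lborel)"
    by (rule measurable_sets[OF _ assms]) measurable
  finally have "(\<lambda>y. emeasure lborel (Pair y -` ?S)) \<in> borel_measurable borel"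
    by (rule lborel.measurable_emeasure_Pair)
  then show ?thesis
    by (simp add: vimage_def)
qed

text \<open>For parameters in the wrong order the left-hand side is 0, so applying this in both
  orders bounds the absolute difference.\<close>

lemma section_length_ge:
  fixes A :: "'a::euclidean_space set"
  assumes "convex A" "A \<in> sets borel" "y + \<sigma> *\<^sub>R w \<in> A" "y + \<sigma>' *\<^sub>R w \<in> A"
  shows "ennreal (\<sigma>' - \<sigma>) \<le> emeasure lborel {\<tau>. y + \<tau> *\<^sub>R w \<in> A}"
proof (cases "\<sigma> \<le> \<sigma>'")
  case True
  have "{\<sigma>..\<sigma>'} \<subseteq> {\<tau>. y + \<tau> *\<^sub>R w \<in> A}"
  proof
    fix \<tau> assume \<tau>: "\<tau> \<in> {\<sigma>..\<sigma>'}"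
    show "\<tau> \<in> {\<tau>. y + \<tau> *\<^sub>R w \<in> A}"
    proof (cases "\<sigma> = \<sigma>'")
      case False
      define u where "u = (\<tau> - \<sigma>) / (\<sigma>' - \<sigma>)"
      have u: "0 \<le> u" "u \<le> 1" "u * (\<sigma>' - \<sigma>) = \<tau> - \<sigma>"
        using \<tau> False by (auto simp: u_def divide_le_eq)
      have "(1 - u) *\<^sub>R (y + \<sigma> *\<^sub>R w) + u *\<^sub>R (y + \<sigma>' *\<^sub>R w) = y + (\<sigma> + u * (\<sigma>' - \<sigma>)) *\<^sub>R w"
        by (simp add: algebra_simps)
      then show ?thesis
        using convexD_alt[OF assms(1,3,4) u(1,2)] u(3) by simp
    qed (use \<tau> assms in auto)
  qed
  moreover have "{\<tau>. y + \<tau> *\<^sub>R w \<in> A} \<in> sets lborel"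
  proof -
    have [measurable]: "A \<in> sets borel" by fact
    show ?thesis by simp
  qed
  ultimately have "emeasure lborel {\<sigma>..\<sigma>'} \<le> emeasure lborel {\<tau>. y + \<tau> *\<^sub>R w \<in> A}"
    by (rule emeasure_mono)
  with True show ?thesis by simp
qed (simp add: ennreal_neg)

text \<open>Volumes are compared line by line along \<open>w = x1 - x0\<close>. A point of the hull
  at \<open>x\<close> is \<open>t *\<^sub>R x + v *\<^sub>R b\<close> with \<open>b\<close> in the
  hull of \<open>S\<close>; putting \<open>x0\<close> or \<open>x1\<close> for \<open>x\<close>
  moves its parameter on the line by \<open>- t * q\<close> or \<open>t * (1 - q)\<close>. Applied
  to both ends of a chord, this exhibits its length as a convex combination of signed distances
  within the other two chords.\<close>

lemma convex_on_measure_hull_insert: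
  fixes S :: "'a::euclidean_space set"
  assumes "finite S"
  shows "convex_on UNIV (\<lambda>x. measure lborel (convex hull (insert x S)))"
proof (cases "S = {}")
  case False
  let ?A = "\<lambda>x. convex hull (insert x S)"
  have comp: "compact (?A x)" and conv: "convex (?A x)" for x
    using assms by (auto intro: finite_imp_compact_convex_hull)
  then have bor: "?A x \<in> sets borel" for x
    by (simp add: compact_imp_closed)
  have fin: "emeasure lborel (?A x) = ennreal (measure lborel (?A x))" for x
    using emeasure_bounded_finite[OF compact_imp_bounded[OF comp]] emeasure_eq_ennreal_measure
    by (metis infinity_ennreal_def less_irrefl)
  show ?thesis
  proof (intro convex_onI)
    fix q :: real and x0 x1 :: 'a assume l: "0 < q" "q < 1"
    define w where "w = x1 - x0"
    define x where "x = (1 - q) *\<^sub>R x0 + q *\<^sub>R x1"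
    have x0: "x0 = x - q *\<^sub>R w" and x1: "x1 = x + (1 - q) *\<^sub>R w"
      by (simp_all add: x_def w_def algebra_simps)
    show "measure lborel (?A ((1 - q) *\<^sub>R x0 + q *\<^sub>R x1)) \<le> (1 - q) * measure lborel (?A x0) + q * measure lborel (?A x1)"
    proof (cases "w = 0")
      case True
      then show ?thesis
        using x_def x0 x1 by (simp add: algebra_simps)
    next
      case False
      let ?\<psi> = "\<lambda>A y. emeasure lborel {\<tau>. y + \<tau> *\<^sub>R w \<in> A}"
      have sec: "?\<psi> (?A x) y \<le> ennreal (1 - q) * ?\<psi> (?A x0) y + ennreal q * ?\<psi> (?A x1) y" for y
      proof (cases "{\<tau>. y + \<tau> *\<^sub>R w \<in> ?A x} = {}")
        case True
        then show ?thesis by (simp only: emeasure_empty) simp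
      next
        case ne: False
        let ?T = "{\<tau>. y + \<tau> *\<^sub>R w \<in> ?A x}"
        have eq: "?T = (\<lambda>\<tau>. y + \<tau> *\<^sub>R w) -` ?A x" by auto
        have cl: "closed ?T"
          unfolding eq by (intro closed_vimage compact_imp_closed comp continuous_intros)
        have bd: "bounded ?T"
        proof -
          obtain R where R: "\<forall>z\<in>?A x. norm z \<le> R"
            using compact_imp_bounded[OF comp] unfolding bounded_iff by blast
          have "\<bar>\<tau>\<bar> \<le> (R + norm y) / norm w" if "\<tau> \<in> ?T" for \<tau>
          proof -
            have "norm (\<tau> *\<^sub>R w) \<le> norm (y + \<tau> *\<^sub>R w) + norm y"
              using norm_triangle_ineq4[of "y + \<tau> *\<^sub>R w" y] by simp
            also have "\<dots> \<le> R + norm y"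
              using R that by auto
            finally show ?thesis
              using False by (simp add: le_divide_eq)
          qed
          then show ?thesis
            unfolding bounded_iff by (intro exI[of _ "(R + norm y) / norm w"]) simp
        qed
        define \<tau>1 where "\<tau>1 = Inf ?T"
        define \<tau>2 where "\<tau>2 = Sup ?T"
        have bdd: "bdd_below ?T" "bdd_above ?T"
          using bd by (rule bounded_imp_bdd_below, rule bounded_imp_bdd_above)
        have "\<tau>1 \<in> ?T"
          unfolding \<tau>1_def by (rule closed_contains_Inf[OF ne bdd(1) cl])
        moreover have "\<tau>2 \<in> ?T"
          unfolding \<tau>2_def by (rule closed_contains_Sup[OF ne bdd(2) cl])
        moreover have "?T \<subseteq> {\<tau>1..\<tau>2}"
          unfolding \<tau>1_def \<tau>2_def
          by (rule subsetI, rule atLeastAtMost_iff[THEN iffD2]) (intro conjI cInf_lower cSup_upper bdd; assumption)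
        ultimately have \<tau>12: "\<tau>1 \<in> ?T" "\<tau>2 \<in> ?T" "?T \<subseteq> {\<tau>1..\<tau>2}"
          by blast+
        have le: "\<tau>1 \<le> \<tau>2"
          using \<tau>12 by auto
        have split: "\<exists>t. y + (\<tau> - t * q) *\<^sub>R w \<in> ?A x0 \<and> y + (\<tau> + t * (1 - q)) *\<^sub>R w \<in> ?A x1"
          if "\<tau> \<in> ?T" for \<tau>
        proof -
          have "y + \<tau> *\<^sub>R w \<in> ?A x"
            using that by simp
          then obtain t v b where t: "0 \<le> t" "0 \<le> v" "t + v = 1" "b \<in> convex hull S" "y + \<tau> *\<^sub>R w = t *\<^sub>R x + v *\<^sub>R b"
            unfolding convex_hull_insert[OF \<open>S \<noteq> {}\<close>] by blast
          have sub: "convex hull S \<subseteq> ?A z" for z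
            by (intro hull_mono) auto
          have "t *\<^sub>R z + v *\<^sub>R b \<in> ?A z" for z
            using t sub[of z] by (intro convexD[OF conv]) (auto intro: hull_inc)
          from this[of x0] this[of x1] have "t *\<^sub>R x0 + v *\<^sub>R b \<in> ?A x0" "t *\<^sub>R x1 + v *\<^sub>R b \<in> ?A x1" .
          moreover have "t *\<^sub>R x0 + v *\<^sub>R b = y + (\<tau> - t * q) *\<^sub>R w"
          proof -
            have "y + (\<tau> - t * q) *\<^sub>R w = (y + \<tau> *\<^sub>R w) - (t * q) *\<^sub>R w"
              by (simp add: algebra_simps)
            also have "\<dots> = t *\<^sub>R (x - q *\<^sub>R w) + v *\<^sub>R b"
              unfolding t(5) by (simp add: algebra_simps)
            finally show ?thesis
              using x0 by simp
          qed
          moreover have "t *\<^sub>R x1 + v *\<^sub>R b = y + (\<tau> + t * (1 - q)) *\<^sub>R w"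
          proof -
            have "y + (\<tau> + t * (1 - q)) *\<^sub>R w = (y + \<tau> *\<^sub>R w) + (t * (1 - q)) *\<^sub>R w"
              by (simp add: algebra_simps)
            also have "\<dots> = t *\<^sub>R (x + (1 - q) *\<^sub>R w) + v *\<^sub>R b"
              unfolding t(5) by (simp add: algebra_simps)
            finally show ?thesis
              using x1 by simp
          qed
          ultimately show ?thesis by metis
        qed
        obtain t1 where t1: "y + (\<tau>1 - t1 * q) *\<^sub>R w \<in> ?A x0" "y + (\<tau>1 + t1 * (1 - q)) *\<^sub>R w \<in> ?A x1"
          using split[OF \<tau>12(1)] by blast
        obtain t2 where t2: "y + (\<tau>2 - t2 * q) *\<^sub>R w \<in> ?A x0" "y + (\<tau>2 + t2 * (1 - q)) *\<^sub>R w \<in> ?A x1"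
          using split[OF \<tau>12(2)] by blast
        \<comment> \<open>The shifted ends may appear in reversed order, so these differences can be
          negative; their absolute values are still bounded by the lengths of the chords.\<close>
        define s0 where "s0 = (\<tau>2 - t2 * q) - (\<tau>1 - t1 * q)"
        define s1 where "s1 = (\<tau>2 + t2 * (1 - q)) - (\<tau>1 + t1 * (1 - q))"
        have s0: "ennreal \<bar>s0\<bar> \<le> ?\<psi> (?A x0) y"
          using section_length_ge[OF conv bor t1(1) t2(1)] section_length_ge[OF conv bor t2(1) t1(1)]
          by (auto simp: s0_def abs_if)
        have s1: "ennreal \<bar>s1\<bar> \<le> ?\<psi> (?A x1) y"
          using section_length_ge[OF conv bor t1(2) t2(2)] section_length_ge[OF conv bor t2(2) t1(2)]
          by (auto simp: s1_def abs_if)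
        have "?\<psi> (?A x) y \<le> emeasure lborel {\<tau>1..\<tau>2}"
          using \<tau>12(3) by (intro emeasure_mono) auto
        also have "\<dots> = ennreal (\<tau>2 - \<tau>1)"
          using le by simp
        also have "\<tau>2 - \<tau>1 = (1 - q) * s0 + q * s1"
          by (simp add: s0_def s1_def algebra_simps)
        also have "ennreal ((1 - q) * s0 + q * s1) \<le> ennreal ((1 - q) * \<bar>s0\<bar> + q * \<bar>s1\<bar>)"
          using l by (intro ennreal_leI add_mono mult_left_mono) auto
        also have "\<dots> = ennreal (1 - q) * ennreal \<bar>s0\<bar> + ennreal q * ennreal \<bar>s1\<bar>"
          using l by (simp add: ennreal_plus ennreal_mult)
        also have "\<dots> \<le> ennreal (1 - q) * ?\<psi> (?A x0) y + ennreal q * ?\<psi> (?A x1) y"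
          by (intro add_mono mult_left_mono s0 s1) auto
        finally show ?thesis .
      qed
      let ?E = "{y. 0 \<le> y \<bullet> w \<and> y \<bullet> w < w \<bullet> w}"
      have [measurable]: "?E \<in> sets borel" by measurable
      note [measurable] = measurable_line_section[OF bor, of w]
      have "emeasure lborel (?A x) = (\<integral>\<^sup>+y. indicator ?E y * ?\<psi> (?A x) y \<partial>lborel)"
        by (rule emeasure_lborel_lines[OF False bor])
      also have "\<dots> \<le> (\<integral>\<^sup>+y. ennreal (1 - q) * (indicator ?E y * ?\<psi> (?A x0) y)
          + ennreal q * (indicator ?E y * ?\<psi> (?A x1) y) \<partial>lborel)"
        using sec by (intro nn_integral_mono) (auto simp: indicator_def)
      also have "\<dots> = ennreal (1 - q) * (\<integral>\<^sup>+y. indicator ?E y * ?\<psi> (?A x0) y \<partial>lborel)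
          + ennreal q * (\<integral>\<^sup>+y. indicator ?E y * ?\<psi> (?A x1) y \<partial>lborel)"
        by (subst nn_integral_add; (subst nn_integral_cmult)?; (subst nn_integral_cmult)?; simp)
      also have "\<dots> = ennreal (1 - q) * emeasure lborel (?A x0) + ennreal q * emeasure lborel (?A x1)"
        by (simp only: emeasure_lborel_lines[OF False bor, symmetric])
      finally have "ennreal (measure lborel (?A x)) \<le> ennreal ((1 - q) * measure lborel (?A x0) + q * measure lborel (?A x1))"
        unfolding fin using l by (simp add: ennreal_plus ennreal_mult)
      then show ?thesis
        unfolding x_def[symmetric] using l by (subst (asm) ennreal_le_iff) auto
    qed
  qed simp
qed (simp add: convex_on_def)

text \<open>If one of the numbers is 0, the claim reduces to \<open>s powr p \<le> s\<close> for
  \<open>s\<close> between 0 and 1; otherwise both are positive and convexity of the power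
  applies.\<close>

lemma powr_le_mean:
  fixes a b :: real
  assumes "0 \<le> a" "0 \<le> b" "0 < t" "t < 1" "p \<ge> 1"
  shows "((1 - t) * a + t * b) powr p \<le> (1 - t) * a powr p + t * b powr p"
proof -
  have shrink: "(s * c) powr p \<le> s * c powr p" if "0 < s" "s < 1" "0 \<le> c" for s c :: real
  proof -
    have "s powr p \<le> s powr 1"
      using that assms by (intro powr_mono') auto
    then have "s powr p * c powr p \<le> s * c powr p"
      using that by (intro mult_right_mono) auto
    then show ?thesis
      using that by (simp add: powr_mult)
  qed
  show ?thesis
  proof (cases "a = 0 \<or> b = 0")
    case True
    then show ?thesis
      using shrink[of t b] shrink[of "1 - t" a] assms by auto
  next
    case False
    then show ?thesis
      using convex_onD[OF powr_convex[OF assms(5)], of t a b] assms by simp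
  qed
qed

lemma convex_on_powr:
  assumes "convex_on UNIV g" "\<And>x. 0 \<le> g x" "p \<ge> (1::real)"
  shows "convex_on UNIV (\<lambda>x. g x powr p)"
proof (intro convex_onI)
  fix t x y assume t: "0 < t" "t < (1::real)"
  have "g ((1 - t) *\<^sub>R x + t *\<^sub>R y) powr p \<le> ((1 - t) * g x + t * g y) powr p"
    using convex_onD[OF assms(1), of t x y] t assms by (intro powr_mono2) auto
  also have "\<dots> \<le> (1 - t) * g x powr p + t * g y powr p"
    using assms t by (intro powr_le_mean) auto
  finally show "g ((1 - t) *\<^sub>R x + t *\<^sub>R y) powr p \<le> (1 - t) * g x powr p + t * g y powr p" .
qed simp

section \<open>Planar convex bodies\<close>

text \<open>Orthogonal projection onto the direction of the chord does not increase the outer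
  measure, and by the intermediate value theorem the projected arc covers the interior of the
  projected chord.\<close>

lemma dist_chord_le_hausdorff_outer:
  fixes \<phi> :: "real \<Rightarrow> real"
  assumes "s < t" and cont: "continuous_on {s..t} \<phi>"
    and sub: "\<And>x. s < x \<Longrightarrow> x < t \<Longrightarrow> (x, \<phi> x) \<in> A"
  shows "ennreal (dist (s, \<phi> s) (t, \<phi> t)) \<le> hausdorff_outer 1 A"
proof -
  let ?p = "(s, \<phi> s)" and ?q = "(t, \<phi> t)"
  define d where "d = ?q - ?p"
  define e where "e = (1 / norm d) *\<^sub>R d"
  have ne: "d \<noteq> 0"
    using \<open>s < t\<close> by (simp add: d_def zero_prod_def)
  then have e1: "norm e = 1"
    by (simp add: e_def)
  have len: "e \<bullet> ?q - e \<bullet> ?p = dist ?p ?q"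
  proof -
    have "e \<bullet> ?q - e \<bullet> ?p = e \<bullet> d"
      by (simp only: inner_diff_right d_def)
    also have "\<dots> = norm d"
      using ne by (simp add: e_def dot_square_norm power2_eq_square)
    also have "\<dots> = dist ?p ?q"
      by (metis d_def dist_commute dist_norm)
    finally show ?thesis .
  qed
  have "{e \<bullet> ?p<..<e \<bullet> ?q} \<subseteq> (\<lambda>z. e \<bullet> z) ` A"
  proof
    fix v assume v: "v \<in> {e \<bullet> ?p<..<e \<bullet> ?q}"
    have "continuous_on {s..t} (\<lambda>x. e \<bullet> (x, \<phi> x))"
      by (intro continuous_intros cont)
    then obtain x where x: "s \<le> x" "x \<le> t" "e \<bullet> (x, \<phi> x) = v"
      using IVT'[of "\<lambda>x. e \<bullet> (x, \<phi> x)" s v t] v \<open>s < t\<close> by auto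
    then have "x \<noteq> s" "x \<noteq> t"
      using v by auto
    then have "(x, \<phi> x) \<in> A"
      using x sub by auto
    then show "v \<in> (\<lambda>z. e \<bullet> z) ` A"
      using x by blast
  qed
  then have "ennreal (e \<bullet> ?q - e \<bullet> ?p) \<le> hausdorff_outer 1 ((\<lambda>z. e \<bullet> z) ` A)"
    by (rule emeasure_interval_le_hausdorff_outer)
  also have "\<dots> \<le> hausdorff_outer 1 A"
  proof (rule hausdorff_outer_lipschitz_image)
    fix x y :: "real \<times> real"
    have "\<bar>e \<bullet> (x - y)\<bar> \<le> norm e * norm (x - y)"
      by (rule Cauchy_Schwarz_ineq2)
    then show "dist (e \<bullet> x) (e \<bullet> y) \<le> dist x y"
      using e1 by (simp add: dist_norm inner_diff_right)
  qed
  finally show ?thesis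
    using len by simp
qed

definition polygon_length :: "(real \<Rightarrow> real) \<Rightarrow> real \<Rightarrow> real \<Rightarrow> nat \<Rightarrow> real" where
  "polygon_length \<phi> s t n = (\<Sum>i<n. dist (s + (t - s) * real i / real n, \<phi> (s + (t - s) * real i / real n))
     (s + (t - s) * real (Suc i) / real n, \<phi> (s + (t - s) * real (Suc i) / real n)))"

text \<open>Over an interval a monotone graph lies in the box spanned by its end points, whose
  diameter is the chord. For a fine subdivision these parts form an admissible cover, and their
  total diameter is at most the length of the inscribed polygon.\<close>

lemma hausdorff_outer_graph_le:
  fixes \<phi> :: "real \<Rightarrow> real"
  assumes "s < t" and cont: "continuous_on {s..t} \<phi>"
    and mono: "mono_on {s..t} \<phi> \<or> mono_on {s..t} (\<lambda>x. - \<phi> x)"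
    and fin: "hausdorff_outer 1 A \<noteq> \<infinity>" and A: "A \<subseteq> {z. s \<le> fst z \<and> fst z < t \<and> snd z = \<phi> (fst z)}"
    and "e > 0"
  shows "\<exists>N>0. \<forall>n\<ge>N. hausdorff_outer 1 A \<le> ennreal (polygon_length \<phi> s t n + e)"
proof -
  obtain h where h: "h \<ge> 0" "hausdorff_outer 1 A = ennreal h"
    using fin by (cases "hausdorff_outer 1 A") auto
  have "ennreal (h - e) < hausdorff_outer 1 A \<or> h = 0"
    using h \<open>e > 0\<close> by (auto simp: ennreal_less_iff ennreal_neg intro: ennreal_lessI)
  moreover have ?thesis if "h = 0"
    using h that by (intro exI[of _ 1]) auto
  moreover have ?thesis if lt: "ennreal (h - e) < hausdorff_outer 1 A"
  proof -
    obtain \<delta> where \<delta>: "\<delta> > 0" "ennreal (h - e) < hausdorff_premeasure 1 \<delta> A"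
      using lt unfolding hausdorff_outer_def less_SUP_iff by auto
    have "uniformly_continuous_on {s..t} \<phi>"
      using cont by (simp add: compact_uniformly_continuous)
    then obtain \<eta> where \<eta>: "\<eta> > 0" "\<And>x y. x \<in> {s..t} \<Longrightarrow> y \<in> {s..t} \<Longrightarrow> dist y x < \<eta> \<Longrightarrow> dist (\<phi> y) (\<phi> x) < \<delta> / 2"
      unfolding uniformly_continuous_on_def using \<delta>(1) half_gt_zero by meson
    \<comment> \<open>Both the step and the oscillation of \<open>\<phi>\<close> over a step stay
      below \<open>\<delta> / 2\<close>, so that the pieces have diameter at most
      \<open>\<delta>\<close>.\<close>
    define \<rho> where "\<rho> = min \<eta> (\<delta> / 2)"
    have "\<rho> > 0"
      using \<eta> \<delta> by (simp add: \<rho>_def)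
    then obtain N :: nat where N: "(t - s) / \<rho> < real N"
      using reals_Archimedean2 by blast
    have N0: "N > 0"
      using N \<open>\<rho> > 0\<close> \<open>s < t\<close> by (cases N) (auto simp: field_simps)
    have "hausdorff_outer 1 A \<le> ennreal (polygon_length \<phi> s t n + e)" if "n \<ge> N" for n
    proof -
      have n: "n > 0" "(t - s) / real n < \<rho>"
      proof -
        show n0: "n > 0" using N0 that by simp
        have "t - s < real N * \<rho>"
          using N \<open>\<rho> > 0\<close> by (simp add: field_simps)
        also have "\<dots> \<le> real n * \<rho>"
          using that \<open>\<rho> > 0\<close> by simp
        finally show "(t - s) / real n < \<rho>"
          using n0 by (simp add: field_simps)
      qed
      define \<tau> where "\<tau> i = s + (t - s) * real i / real n" for i
      have \<tau>_step: "\<tau> (Suc i) = \<tau> i + (t - s) / real n" for i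
        by (simp add: \<tau>_def distrib_left add_divide_distrib)
      have \<tau>_le: "\<tau> i \<le> \<tau> (Suc i)" for i
        using \<open>s < t\<close> by (simp add: \<tau>_step)
      have \<tau>_in: "\<tau> i \<in> {s..t}" if "i \<le> n" for i
      proof -
        have "(t - s) * real i \<le> (t - s) * real n"
          using that \<open>s < t\<close> by (intro mult_left_mono) auto
        then have "(t - s) * real i / real n \<le> t - s" "0 \<le> (t - s) * real i / real n"
          using n \<open>s < t\<close> by (simp_all add: divide_le_eq)
        then show ?thesis
          by (simp add: \<tau>_def)
      qed
      let ?c = "\<lambda>i. dist (\<tau> i, \<phi> (\<tau> i)) (\<tau> (Suc i), \<phi> (\<tau> (Suc i)))"
      have c_le: "?c i \<le> \<delta>" if "i < n" for i
      proof -
        have "dist (\<tau> i) (\<tau> (Suc i)) = (t - s) / real n"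
          using \<open>s < t\<close> by (simp add: \<tau>_step dist_real_def)
        then have d: "dist (\<tau> i) (\<tau> (Suc i)) < \<rho>"
          using n by simp
        then have "dist (\<phi> (\<tau> i)) (\<phi> (\<tau> (Suc i))) < \<delta> / 2"
          using \<eta>(2)[of "\<tau> (Suc i)" "\<tau> i"] \<tau>_in that by (simp add: \<rho>_def)
        moreover have "?c i \<le> dist (\<tau> i) (\<tau> (Suc i)) + dist (\<phi> (\<tau> i)) (\<phi> (\<tau> (Suc i)))"
          unfolding dist_Pair_Pair by (rule sqrt_sum_squares_le_sum) auto
        ultimately show ?thesis
          using d by (simp add: \<rho>_def)
      qed
      define U where "U i = (if i < n then {z. \<tau> i \<le> fst z \<and> fst z \<le> \<tau> (Suc i) \<and> snd z = \<phi> (fst z)} else {})" for i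
      have U_dist: "dist z w \<le> ?c i" if zw: "z \<in> U i" "w \<in> U i" for z w i
      proof -
        have i: "i < n"
          using zw by (auto simp: U_def split: if_splits)
        obtain x y where xy: "z = (x, \<phi> x)" "w = (y, \<phi> y)" "\<tau> i \<le> x" "x \<le> \<tau> (Suc i)" "\<tau> i \<le> y" "y \<le> \<tau> (Suc i)"
          using zw i by (cases z, cases w) (auto simp: U_def)
        have xyst: "x \<in> {s..t}" "y \<in> {s..t}" "\<tau> i \<in> {s..t}" "\<tau> (Suc i) \<in> {s..t}"
          using xy \<tau>_in[of i] \<tau>_in[of "Suc i"] i by auto
        have "\<bar>\<phi> x - \<phi> y\<bar> \<le> \<bar>\<phi> (\<tau> i) - \<phi> (\<tau> (Suc i))\<bar>"
          using mono
        proof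
          assume m: "mono_on {s..t} \<phi>"
          have "\<phi> (\<tau> i) \<le> \<phi> x" "\<phi> x \<le> \<phi> (\<tau> (Suc i))" "\<phi> (\<tau> i) \<le> \<phi> y" "\<phi> y \<le> \<phi> (\<tau> (Suc i))"
            by (rule mono_onD[OF m]; use xyst xy in simp)+
          then show ?thesis by simp
        next
          assume m: "mono_on {s..t} (\<lambda>x. - \<phi> x)"
          have "- \<phi> (\<tau> i) \<le> - \<phi> x" "- \<phi> x \<le> - \<phi> (\<tau> (Suc i))" "- \<phi> (\<tau> i) \<le> - \<phi> y" "- \<phi> y \<le> - \<phi> (\<tau> (Suc i))"
            by (rule mono_onD[OF m]; use xyst xy in simp)+
          then show ?thesis by simp
        qed
        moreover have "\<bar>x - y\<bar> \<le> \<bar>\<tau> i - \<tau> (Suc i)\<bar>"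
          using xy by linarith
        ultimately show ?thesis
          unfolding xy(1,2) dist_Pair_Pair dist_real_def
          by (intro real_sqrt_le_mono add_mono) (auto simp: abs_le_square_iff)
      qed
      have U_bdd: "bounded (U i)" for i
      proof (cases "U i = {}")
        case False
        then obtain z where "z \<in> U i" by blast
        then show ?thesis
          using U_dist[of z i] unfolding bounded_def by blast
      qed simp
      have U_diam: "U i \<noteq> {} \<Longrightarrow> diameter (U i) \<le> ?c i" for i
        using U_dist[of _ i] by (intro diameter_le) (auto simp: dist_norm)
      have cover: "A \<subseteq> (\<Union>i. U i)"
      proof
        fix z assume "z \<in> A"
        then obtain x where x: "z = (x, \<phi> x)" "s \<le> x" "x < t"
          using A by (cases z) auto
        \<comment> \<open>The subinterval containing \<open>x\<close>; the strict inequality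
          \<open>x < t\<close> keeps the index below \<open>n\<close>.\<close>
        define i where "i = nat \<lfloor>real n * (x - s) / (t - s)\<rfloor>"
        have q: "0 \<le> real n * (x - s) / (t - s)" "real n * (x - s) / (t - s) < real n"
          using x \<open>s < t\<close> n by (auto simp: field_simps)
        have i: "real i \<le> real n * (x - s) / (t - s)" "real n * (x - s) / (t - s) < real i + 1"
          unfolding i_def using q by linarith+
        then have "i < n"
          using q by linarith
        moreover have "\<tau> i \<le> x" "x \<le> \<tau> (Suc i)"
          using i \<open>s < t\<close> n by (auto simp: \<tau>_def field_simps)
        ultimately have "z \<in> U i"
          using x by (simp add: U_def)
        then show "z \<in> (\<Union>i. U i)" by blast
      qed
      have "diameter (U i) \<le> \<delta>" for i
      proof (cases "U i = {}")
        case False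
        then have "i < n"
          by (auto simp: U_def split: if_splits)
        then show ?thesis
          using U_diam[OF False] c_le[of i] by linarith
      qed (use \<delta> in simp)
      then have "hausdorff_premeasure 1 \<delta> A \<le> (\<Sum>i. if U i = {} then 0 else ennreal (diameter (U i) ^ 1))"
        unfolding hausdorff_premeasure_def using U_bdd cover by (intro INF_lower) auto
      also have "\<dots> = (\<Sum>i<n. if U i = {} then 0 else ennreal (diameter (U i) ^ 1))"
        by (rule suminf_finite) (auto simp: U_def)
      also have "\<dots> \<le> (\<Sum>i<n. ennreal (?c i))"
        using U_diam by (intro sum_mono) (auto intro: ennreal_leI)
      also have "\<dots> = ennreal (polygon_length \<phi> s t n)"
        by (simp add: polygon_length_def \<tau>_def sum_ennreal)
      finally have "ennreal (h - e) < ennreal (polygon_length \<phi> s t n)"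
        using \<delta>(2) by (rule less_le_trans[rotated])
      then have "h - e < polygon_length \<phi> s t n"
        by (metis ennreal_leI leD leI)
      then show ?thesis
        using h by (auto intro: ennreal_leI)
    qed
    then show ?thesis
      using N0 by blast
  qed
  ultimately show ?thesis by blast
qed

section \<open>A planar convex body between two graphs\<close>

locale planar_body =
  fixes K :: "(real \<times> real) set"
  assumes compact_K: "compact K" and convex_K: "convex K" and interior_K: "interior K \<noteq> {}"
begin

definition left :: real where "left = Inf (fst ` K)"
definition right :: real where "right = Sup (fst ` K)"
definition up :: "real \<Rightarrow> real" where "up s = Sup {y. (s, y) \<in> K}"
definition lo :: "real \<Rightarrow> real" where "lo s = Inf {y. (s, y) \<in> K}"
definition len :: "real \<Rightarrow> real" where "len s = up s - lo s"

lemma closed_K: "closed K"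
  using compact_K by (rule compact_imp_closed)

lemma nonempty_K: "K \<noteq> {}"
  using interior_K interior_subset by blast

lemma fst_image: "fst ` K = {left..right}"
proof -
  have c: "compact (fst ` K)"
    by (intro compact_continuous_image compact_K continuous_intros)
  have "connected (fst ` K)"
    by (intro connected_continuous_image convex_connected convex_K continuous_intros)
  with c have "\<exists>a b. fst ` K = cbox a b"
    using connected_compact_interval_1[of "fst ` K"] by simp
  then obtain a b where ab: "fst ` K = {a..b}"
    by (auto simp: cbox_interval)
  moreover have "a \<le> b"
    using ab nonempty_K by (metis atLeastatMost_empty_iff2 image_is_empty not_le)
  ultimately show ?thesis
    by (simp add: left_def right_def)
qed

lemma slice:
  assumes "s \<in> {left..right}"
  shows "{y. (s, y) \<in> K} = {lo s..up s}" "lo s \<le> up s"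
proof -
  let ?S = "{y. (s, y) \<in> K}"
  have eq: "?S = snd ` (K \<inter> {z. fst z = s})"
    by force
  have ne: "?S \<noteq> {}"
    using assms fst_image by force
  have "closed {z :: real \<times> real. fst z = s}"
    by (intro closed_Collect_eq continuous_intros)
  then have "compact (snd ` (K \<inter> {z. fst z = s}))"
     using compact_K by (intro compact_continuous_image compact_Int_closed continuous_intros)
  then have c: "compact ?S"
    by (simp only: eq)
  have "connected ?S"
  proof -
    have "convex {z :: real \<times> real. fst z = s}"
      by (auto simp: convex_def algebra_simps) (metis distrib_right mult_1)
    then have "convex (K \<inter> {z. fst z = s})"
      by (intro convex_Int convex_K)
    then show ?thesis
      unfolding eq by (intro connected_continuous_image convex_connected continuous_intros)
  qed
  with c have "\<exists>a b. ?S = cbox a b"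
    using connected_compact_interval_1[of ?S] by simp
  then obtain a b where ab: "?S = {a..b}"
    by (auto simp: cbox_interval)
  moreover have "a \<le> b"
    using ab ne by (metis atLeastatMost_empty_iff2 not_le)
  ultimately show "?S = {lo s..up s}" "lo s \<le> up s"
    by (simp_all add: lo_def up_def)
qed

lemma mem_K: "(s, y) \<in> K \<longleftrightarrow> left \<le> s \<and> s \<le> right \<and> lo s \<le> y \<and> y \<le> up s"
proof
  assume "(s, y) \<in> K"
  moreover from this have "s \<in> {left..right}"
    using fst_image by force
  ultimately show "left \<le> s \<and> s \<le> right \<and> lo s \<le> y \<and> y \<le> up s"
    using slice(1)[of s] by auto
next
  assume "left \<le> s \<and> s \<le> right \<and> lo s \<le> y \<and> y \<le> up s"
  then show "(s, y) \<in> K"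
    using slice(1)[of s] by auto
qed

lemma len_nonneg: "s \<in> {left..right} \<Longrightarrow> 0 \<le> len s"
  using slice(2) by (simp add: len_def)

lemma up_lo_convex:
  assumes "s \<in> {left..right}" "t \<in> {left..right}" "0 \<le> u" "u \<le> 1"
  shows "(1 - u) * up s + u * up t \<le> up ((1 - u) * s + u * t)"
    "lo ((1 - u) * s + u * t) \<le> (1 - u) * lo s + u * lo t"
proof -
  have "(s, up s) \<in> K" "(t, up t) \<in> K" "(s, lo s) \<in> K" "(t, lo t) \<in> K"
    using assms slice(2) by (auto simp: mem_K)
  then have "(1 - u) *\<^sub>R (s, up s) + u *\<^sub>R (t, up t) \<in> K" "(1 - u) *\<^sub>R (s, lo s) + u *\<^sub>R (t, lo t) \<in> K"
    using assms by (intro convexD_alt[OF convex_K]; simp)+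
  then show "(1 - u) * up s + u * up t \<le> up ((1 - u) * s + u * t)"
    "lo ((1 - u) * s + u * t) \<le> (1 - u) * lo s + u * lo t"
    by (auto simp: mem_K)
qed

lemma len_concave:
  assumes "s \<in> {left..right}" "t \<in> {left..right}" "0 \<le> u" "u \<le> 1"
  shows "(1 - u) * len s + u * len t \<le> len ((1 - u) * s + u * t)"
  using up_lo_convex[OF assms] by (simp add: len_def algebra_simps)

lemma convex_on_up_lo: "convex_on {left..right} lo" "convex_on {left..right} (\<lambda>s. - up s)"
proof -
  show "convex_on {left..right} lo"
  proof (intro convex_onI)
    fix t x y :: real
    assume "0 < t" "t < 1" "x \<in> {left..right}" "y \<in> {left..right}"
    then show "lo ((1 - t) *\<^sub>R x + t *\<^sub>R y) \<le> (1 - t) * lo x + t * lo y"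
      using up_lo_convex(2)[of x y t] by simp
  qed simp
  show "convex_on {left..right} (\<lambda>s. - up s)"
  proof (intro convex_onI)
    fix t x y :: real
    assume "0 < t" "t < 1" "x \<in> {left..right}" "y \<in> {left..right}"
    then show "- up ((1 - t) *\<^sub>R x + t *\<^sub>R y) \<le> (1 - t) * - up x + t * - up y"
      using up_lo_convex(1)[of x y t] by simp
  qed simp
qed

lemma continuous_up_lo:
  "continuous_on {left<..<right} lo" "continuous_on {left<..<right} up"
proof -
  have sub: "{left<..<right} \<subseteq> {left..right}"
    by auto
  show "continuous_on {left<..<right} lo"
    by (intro convex_on_continuous convex_on_subset[OF convex_on_up_lo(1)] sub) auto
  have "continuous_on {left<..<right} (\<lambda>s. - up s)"
    by (intro convex_on_continuous convex_on_subset[OF convex_on_up_lo(2)] sub) auto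
  from continuous_on_minus[OF this] show "continuous_on {left<..<right} up"
    by simp
qed

lemma continuous_len: "continuous_on {left<..<right} len"
  unfolding len_def by (intro continuous_intros continuous_up_lo)

lemma interior_point: "\<exists>s. left < s \<and> s < right \<and> len s > 0"
proof -
  obtain z where "z \<in> interior K"
    using interior_K by blast
  then obtain e where e: "e > 0" "cball z e \<subseteq> K"
    using mem_interior_cball by blast
  obtain s y where z: "z = (s, y)" by (cases z)
  have "(s - e, y) \<in> cball z e" "(s + e, y) \<in> cball z e" "(s, y - e) \<in> cball z e" "(s, y + e) \<in> cball z e"
    using e by (auto simp: z dist_Pair_Pair dist_real_def)
  then have "(s - e, y) \<in> K" "(s + e, y) \<in> K" "(s, y - e) \<in> K" "(s, y + e) \<in> K"
    using e by blast+
  then have "left < s \<and> s < right \<and> len s > 0"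
    using e by (auto simp: mem_K len_def)
  then show ?thesis by blast
qed

lemma left_less_right: "left < right"
  using interior_point by fastforce

text \<open>By concavity, positivity at one interior abscissa spreads to all of them, since
  \<open>len\<close> is nonnegative at the ends.\<close>

lemma len_pos:
  assumes "left < s" "s < right"
  shows "len s > 0"
proof -
  obtain s0 where s0: "left < s0" "s0 < right" "len s0 > 0"
    using interior_point by blast
  show ?thesis
  proof (cases "s \<le> s0")
    case True
    define u where "u = (s - left) / (s0 - left)"
    have u: "0 < u" "u \<le> 1" "u * (s0 - left) = s - left"
      using assms s0 True by (auto simp: u_def)
    have "(1 - u) * left + u * s0 = s"
      using u(3) by (simp add: algebra_simps)
    moreover have "(1 - u) * len left + u * len s0 \<le> len ((1 - u) * left + u * s0)"
      by (rule len_concave) (use u s0 left_less_right in auto)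
    ultimately have "(1 - u) * len left + u * len s0 \<le> len s"
      by (simp only:)
    moreover have "0 \<le> (1 - u) * len left"
      using u len_nonneg[of left] left_less_right by (intro mult_nonneg_nonneg) auto
    moreover have "0 < u * len s0"
      using u s0 by simp
    ultimately show ?thesis by linarith
  next
    case False
    define u where "u = (right - s) / (right - s0)"
    have u: "0 < u" "u \<le> 1" "u * (right - s0) = right - s"
      using assms s0 False by (auto simp: u_def)
    have "(1 - u) * right + u * s0 = s"
      using u(3) by (simp add: algebra_simps)
    moreover have "(1 - u) * len right + u * len s0 \<le> len ((1 - u) * right + u * s0)"
      by (rule len_concave) (use u s0 left_less_right in auto)
    ultimately have "(1 - u) * len right + u * len s0 \<le> len s"
      by (simp only:)
    moreover have "0 \<le> (1 - u) * len right"
      using u len_nonneg[of right] left_less_right by (intro mult_nonneg_nonneg) auto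
    moreover have "0 < u * len s0"
      using u s0 by simp
    ultimately show ?thesis by linarith
  qed
qed

lemma frontier_K: "frontier K = K - interior K"
  using closed_K by (simp add: frontier_def closure_closed)

text \<open>A point strictly between the graphs has a neighbourhood in \<open>K\<close>, because
  \<open>lo\<close> and \<open>up\<close> are continuous on the open interval; from a point on a
  graph an arbitrarily small vertical move leaves \<open>K\<close>.\<close>

lemma frontier_slice:
  assumes "left < s" "s < right"
  shows "(s, y) \<in> frontier K \<longleftrightarrow> y = lo s \<or> y = up s"
proof
  assume fr: "(s, y) \<in> frontier K"
  show "y = lo s \<or> y = up s"
  proof (rule ccontr)
    assume "\<not> ?thesis"
    then have y: "lo s < y" "y < up s"
      using fr by (auto simp: frontier_K mem_K)
    let ?S = "{left<..<right} \<times> (UNIV :: real set)"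
    have c: "continuous_on ?S (\<lambda>z. snd z - lo (fst z))" "continuous_on ?S (\<lambda>z. up (fst z) - snd z)"
      by (intro continuous_intros continuous_on_compose2[OF continuous_up_lo(1)]
          continuous_on_compose2[OF continuous_up_lo(2)]; force)+
    have oS: "open ?S"
      by (intro open_Times) auto
    let ?U = "(?S \<inter> (\<lambda>z. snd z - lo (fst z)) -` {0<..}) \<inter> (?S \<inter> (\<lambda>z. up (fst z) - snd z) -` {0<..})"
    have "open ?U"
      by (intro open_Int continuous_open_preimage c oS) auto
    moreover have "?U \<subseteq> K"
      by (auto simp: mem_K)
    moreover have "(s, y) \<in> ?U"
      using y assms by auto
    ultimately have "(s, y) \<in> interior K"
      using interior_maximal by blast
    then show False
      using fr by (simp add: frontier_K)
  qed
next
  have notint: "(s, v) \<notin> interior K" if "\<And>e. e > 0 \<Longrightarrow> (s, v + c * e) \<notin> K" "\<bar>c\<bar> = 1" for v c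
  proof
    assume "(s, v) \<in> interior K"
    then obtain e where e: "e > 0" "cball (s, v) e \<subseteq> K"
      using mem_interior_cball by blast
    have "(s, v + c * e) \<in> cball (s, v) e"
      using e that(2) by (simp add: dist_Pair_Pair dist_real_def abs_mult)
    then show False
      using e that(1) by blast
  qed
  assume "y = lo s \<or> y = up s"
  moreover have "(s, lo s) \<in> K" "(s, up s) \<in> K"
    using assms slice(2)[of s] by (auto simp: mem_K)
  moreover have "(s, lo s) \<notin> interior K"
    using notint[of "lo s" "-1"] by (auto simp: mem_K)
  moreover have "(s, up s) \<notin> interior K"
    using notint[of "up s" 1] by (auto simp: mem_K)
  ultimately show "(s, y) \<in> frontier K"
    by (auto simp: frontier_K)
qed

text \<open>For each ordinate between \<open>lo s\<close> and \<open>up s\<close>, the rightmost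
  point of \<open>K\<close> with this ordinate is a boundary point in the cap. So the projection to
  the second coordinate covers the interior of the slice.\<close>

lemma hausdorff_outer_cap:
  assumes "s \<in> {left..right}"
  shows "ennreal (len s) \<le> hausdorff_outer 1 (frontier K \<inter> {z. s \<le> fst z})"
proof -
  have "{lo s<..<up s} \<subseteq> snd ` (frontier K \<inter> {z. s \<le> fst z})"
  proof
    fix y assume y: "y \<in> {lo s<..<up s}"
    let ?S = "K \<inter> {z. snd z = y}"
    have "closed {z :: real \<times> real. snd z = y}"
      by (intro closed_Collect_eq continuous_intros)
    then have "compact ?S"
      by (intro compact_Int_closed compact_K)
    moreover have sS: "(s, y) \<in> ?S"
      using y assms by (auto simp: mem_K)
    moreover have "continuous_on ?S fst"
      by (intro continuous_intros)
    ultimately obtain z where z: "z \<in> ?S" "\<And>w. w \<in> ?S \<Longrightarrow> fst w \<le> fst z"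
      using continuous_attains_sup[of ?S fst] by blast
    have "z \<notin> interior K"
    proof
      assume "z \<in> interior K"
      then obtain e where e: "e > 0" "cball z e \<subseteq> K"
        using mem_interior_cball by blast
      have "(fst z + e, snd z) \<in> cball z e"
        using e by (cases z) (simp add: dist_Pair_Pair dist_real_def)
      then have "(fst z + e, snd z) \<in> ?S"
        using e z(1) by auto
      from z(2)[OF this] show False
        using e by simp
    qed
    then have "z \<in> frontier K \<inter> {z. s \<le> fst z}"
      using z(1) z(2)[OF sS] by (auto simp: frontier_K)
    then show "y \<in> snd ` (frontier K \<inter> {z. s \<le> fst z})"
      using z(1) by force
  qed
  then have "ennreal (up s - lo s) \<le> hausdorff_outer 1 (snd ` (frontier K \<inter> {z. s \<le> fst z}))"
    by (rule emeasure_interval_le_hausdorff_outer)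
  also have "\<dots> \<le> hausdorff_outer 1 (frontier K \<inter> {z. s \<le> fst z})"
    by (rule hausdorff_outer_lipschitz_image) (rule dist_snd_le)
  finally show ?thesis
    by (simp add: len_def)
qed

definition area :: "real \<Rightarrow> real" where
  "area t = measure lborel (K \<inter> {z. t \<le> fst z})"

lemma cap_borel [measurable, simp]: "K \<inter> {z. t \<le> fst z} \<in> sets borel" "frontier K \<inter> {z. t \<le> fst z} \<in> sets borel"
proof -
  have "closed {z :: real \<times> real. t \<le> fst z}"
    by (intro closed_Collect_le continuous_intros)
  then show "K \<inter> {z. t \<le> fst z} \<in> sets borel" "frontier K \<inter> {z. t \<le> fst z} \<in> sets borel"
    using closed_K by (auto intro!: borel_closed closed_Int)
qed

lemma slice_cap:
  assumes "left \<le> t"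
  shows "emeasure lborel (Pair x -` (K \<inter> {z. t \<le> fst z})) = ennreal (len x) * indicator {t..right} x"
proof -
  have "Pair x -` (K \<inter> {z. t \<le> fst z}) = (if x \<in> {t..right} then {lo x..up x} else {})"
    using assms by (auto simp: mem_K)
  moreover have "lo x \<le> up x" if "x \<in> {t..right}"
    using that assms slice(2)[of x] by simp
  ultimately show ?thesis
    by (auto simp: len_def)
qed

lemma measurable_len:
  assumes "left \<le> t"
  shows "(\<lambda>x. ennreal (len x) * indicator {t..right} x) \<in> borel_measurable lborel"
proof -
  have "(\<lambda>x. emeasure lborel (Pair x -` (K \<inter> {z. t \<le> fst z}))) \<in> borel_measurable lborel"
    by (rule lborel.measurable_emeasure_Pair) (simp only: lborel_prod sets_lborel cap_borel)
  then show ?thesis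
    unfolding slice_cap[OF assms] .
qed

lemma emeasure_cap:
  assumes "left \<le> t"
  shows "emeasure lborel (K \<inter> {z. t \<le> fst z}) = (\<integral>\<^sup>+x. ennreal (len x) * indicator {t..right} x \<partial>lborel)"
proof -
  have "emeasure lborel (K \<inter> {z. t \<le> fst z}) = emeasure (lborel \<Otimes>\<^sub>M lborel) (K \<inter> {z. t \<le> fst z})"
    by (simp only: lborel_prod)
  also have "\<dots> = (\<integral>\<^sup>+x. emeasure lborel (Pair x -` (K \<inter> {z. t \<le> fst z})) \<partial>lborel)"
    by (rule lborel.emeasure_pair_measure_alt) (simp only: lborel_prod sets_lborel cap_borel)
  finally show ?thesis
    unfolding slice_cap[OF assms] .
qed

lemma emeasure_K_finite: "emeasure lborel K < \<infinity>"
  using emeasure_bounded_finite[OF compact_imp_bounded[OF compact_K]] by simp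

lemma emeasure_cap_eq: "emeasure lborel (K \<inter> {z. t \<le> fst z}) = ennreal (area t)"
proof -
  have "emeasure lborel (K \<inter> {z. t \<le> fst z}) \<le> emeasure lborel K"
    using closed_K by (intro emeasure_mono) auto
  then have "emeasure lborel (K \<inter> {z. t \<le> fst z}) \<noteq> \<infinity>"
    using emeasure_K_finite by (auto simp: top_unique)
  then show ?thesis
    unfolding area_def using emeasure_eq_ennreal_measure by auto
qed

lemma area_nonneg: "0 \<le> area t"
  by (simp add: area_def)

lemma area_slab:
  assumes "left \<le> s" "s < t" "t \<le> right" and anti: "\<And>x. s \<le> x \<Longrightarrow> x \<le> t \<Longrightarrow> len t \<le> len x"
  shows "area t + (t - s) * len t \<le> area s"
proof -
  have l: "0 \<le> len t"
    using len_nonneg assms by simp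
  have "ennreal (area t) + ennreal ((t - s) * len t)
      = (\<integral>\<^sup>+x. ennreal (len x) * indicator {t..right} x \<partial>lborel) + (\<integral>\<^sup>+x. ennreal (len t) * indicator {s..<t} x \<partial>lborel)"
    using assms emeasure_cap[of t] l
    by (simp add: emeasure_cap_eq[symmetric] nn_integral_cmult_indicator ennreal_mult' mult.commute)
  also have "\<dots> = (\<integral>\<^sup>+x. ennreal (len x) * indicator {t..right} x + ennreal (len t) * indicator {s..<t} x \<partial>lborel)"
    using assms measurable_len by (intro nn_integral_add[symmetric]) auto
  also have "\<dots> \<le> (\<integral>\<^sup>+x. ennreal (len x) * indicator {s..right} x \<partial>lborel)"
    using assms by (intro nn_integral_mono) (auto simp: indicator_def intro: ennreal_leI)
  also have "\<dots> = ennreal (area s)"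
    using assms emeasure_cap[of s] by (simp add: emeasure_cap_eq)
  finally show ?thesis
    using l assms by (simp add: area_nonneg flip: ennreal_plus)
qed

end

declare One_nat_def [simp del]

lemma graph_borel:
  fixes \<phi> :: "real \<Rightarrow> real"
  assumes "continuous_on {s..t} \<phi>"
  shows "{z. s \<le> fst z \<and> fst z < t \<and> snd z = \<phi> (fst z)} \<in> sets borel"
proof -
  have "closed ({s..t} \<times> (UNIV :: real set))"
    by (intro closed_Times) auto
  moreover have "continuous_on ({s..t} \<times> UNIV) (\<lambda>z. snd z - \<phi> (fst z))"
    by (intro continuous_intros continuous_on_compose2[OF assms]) auto
  ultimately have "closed {z \<in> {s..t} \<times> UNIV. snd z - \<phi> (fst z) = 0}"
    by (rule continuous_closed_preimage_constant[rotated])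
  moreover have "open {z :: real \<times> real. fst z < t}"
    by (intro open_Collect_less continuous_intros)
  ultimately have "{z \<in> {s..t} \<times> UNIV. snd z - \<phi> (fst z) = 0} \<inter> {z. fst z < t} \<in> sets borel"
    by (intro sets.Int) auto
  also have "{z \<in> {s..t} \<times> UNIV. snd z - \<phi> (fst z) = 0} \<inter> {z. fst z < t}
      = {z. s \<le> fst z \<and> fst z < t \<and> snd z = \<phi> (fst z)}"
    by auto
  finally show ?thesis .
qed

lemma chord_scale:
  fixes a b :: real
  assumes "s < t" "0 < m"
  shows "dist (s, a) (t, b) / (t - s) * m = norm (m, (b - a) / (t - s) * m)"
proof -
  have "(m, (b - a) / (t - s) * m) = (m / (t - s)) *\<^sub>R ((t, b) - (s, a))"
    using assms by simp
  then have "norm (m, (b - a) / (t - s) * m) = m / (t - s) * norm ((t, b) - (s, a))"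
    using assms by (simp only: norm_scaleR) simp
  moreover have "norm ((t, b) - (s, a)) = dist (s, a) (t, b)"
    by (metis dist_commute dist_norm)
  ultimately show ?thesis
    by simp
qed

lemma norm_Pair_le: "norm (m, a :: real) \<le> norm (m :: real, b) + \<bar>a - b\<bar>"
proof -
  have "(m, a) = (m, b) + (0, a - b)"
    by simp
  then show ?thesis
    using norm_triangle_ineq[of "(m, b)" "(0, a - b)"] by (simp add: norm_Pair)
qed

section \<open>Perimeter and area of caps\<close>

text \<open>These facts about the surface measure are supplied by the existence of a uniform
  boundary point and are stable under isometries. Positivity of the perimeter is derived from
  them.\<close>

locale planar_body_perimeter = planar_body +
  assumes H_outer: "\<And>A. A \<in> sets borel \<Longrightarrow>
      emeasure (hausdorff_measure 1 :: (real \<times> real) measure) A = hausdorff_outer 1 A"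
    and H_finite: "emeasure (hausdorff_measure 1) (frontier K) \<noteq> \<infinity>"
begin

abbreviation "H \<equiv> hausdorff_measure 1 :: (real \<times> real) measure"

definition perim :: "real \<Rightarrow> real" where
  "perim t = measure H (frontier K \<inter> {z. t \<le> fst z})"

lemma H_sub_finite: "A \<subseteq> frontier K \<Longrightarrow> emeasure H A \<noteq> \<infinity>"
  using emeasure_mono[of A "frontier K" H] H_finite by (auto simp: top_unique)

lemma H_outer_le:
  assumes "A \<in> sets borel" "A \<subseteq> frontier K" "ennreal x \<le> hausdorff_outer 1 A"
  shows "x \<le> measure H A"
proof -
  have "ennreal x \<le> ennreal (measure H A)"
    using assms H_outer[OF assms(1)] emeasure_eq_ennreal_measure[of H A] H_sub_finite[OF assms(2)] by auto
  then show ?thesis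
    by (simp add: ennreal_le_iff)
qed

lemma perim_nonneg: "0 \<le> perim t"
  by (simp add: perim_def)

lemma len_le_perim: "t \<in> {left..right} \<Longrightarrow> len t \<le> perim t"
  unfolding perim_def by (intro H_outer_le hausdorff_outer_cap) auto

abbreviation graph :: "(real \<Rightarrow> real) \<Rightarrow> real \<Rightarrow> real \<Rightarrow> (real \<times> real) set" where
  "graph \<phi> s t \<equiv> {z. s \<le> fst z \<and> fst z < t \<and> snd z = \<phi> (fst z)}"

lemma continuous_on_sub:
  assumes "left < s" "t < right"
  shows "continuous_on {s..t} up" "continuous_on {s..t} lo" "continuous_on {s..t} len"
  by (rule continuous_on_subset[OF continuous_up_lo(2)] continuous_on_subset[OF continuous_up_lo(1)]
      continuous_on_subset[OF continuous_len]; use assms in auto)+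

lemma graph_frontier:
  assumes "left < s" "t < right"
  shows "graph up s t \<subseteq> frontier K" "graph lo s t \<subseteq> frontier K"
  using assms frontier_slice by force+

text \<open>The arcs are half-open on the right, which makes them disjoint from the remaining cap;
  they are disjoint from each other because inner chords have positive length.\<close>

lemma perim_slab:
  assumes "left < s" "s \<le> t" "t < right"
  shows "perim s = perim t + measure H (graph up s t) + measure H (graph lo s t)"
proof -
  have b: "graph up s t \<in> sets borel" "graph lo s t \<in> sets borel"
    using graph_borel continuous_on_sub[of s t] assms by auto
  have sub: "graph up s t \<subseteq> frontier K" "graph lo s t \<subseteq> frontier K"
    using graph_frontier assms by auto
  let ?F = "frontier K \<inter> {z. t \<le> fst z}"
  have eq: "frontier K \<inter> {z. s \<le> fst z} = ?F \<union> graph up s t \<union> graph lo s t"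
  proof -
    have "z \<in> frontier K \<inter> {z. s \<le> fst z} \<longleftrightarrow> z \<in> ?F \<union> graph up s t \<union> graph lo s t" for z
      using frontier_slice[of "fst z" "snd z"] assms by (cases "fst z < t") auto
    then show ?thesis by blast
  qed
  have "up x \<noteq> lo x" if "s \<le> x" "x < t" for x
    using len_pos[of x] that assms by (auto simp: len_def)
  then have d: "graph up s t \<inter> graph lo s t = {}" "?F \<inter> graph up s t = {}" "?F \<inter> graph lo s t = {}"
    by auto
  have "measure H (?F \<union> graph up s t \<union> graph lo s t) = measure H (?F \<union> graph up s t) + measure H (graph lo s t)"
    using b sub d by (intro measure_Union H_sub_finite) auto
  also have "measure H (?F \<union> graph up s t) = measure H ?F + measure H (graph up s t)"
    using b sub d by (intro measure_Union H_sub_finite) auto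
  finally show ?thesis
    unfolding perim_def eq .
qed

lemma chord_le_graph:
  assumes "left < s" "s < t" "t < right"
  shows "dist (s, up s) (t, up t) \<le> measure H (graph up s t)"
    "dist (s, lo s) (t, lo t) \<le> measure H (graph lo s t)"
  using assms graph_borel continuous_on_sub[of s t] graph_frontier
  by (intro H_outer_le dist_chord_le_hausdorff_outer; auto)+

text \<open>Slopes of the concave \<open>up\<close> decrease and those of the convex
  \<open>lo\<close> increase, so beyond \<open>t\<close> the prolonged chords over
  \<open>[s, t]\<close> do not enter the interior of the body.\<close>

lemma up_lo_extend:
  assumes "left \<le> s" "s < t" "t + m \<le> right" "0 < m"
  shows "up (t + m) - up t \<le> (up t - up s) / (t - s) * m"
    "(lo t - lo s) / (t - s) * m \<le> lo (t + m) - lo t"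
proof -
  define d where "d = t - s"
  have d: "d > 0" using assms by (simp add: d_def)
  \<comment> \<open>The weight with \<open>t = (1 - u) * s + u * (t + m)\<close>.\<close>
  define u where "u = d / (d + m)"
  have u: "0 \<le> u" "u \<le> 1" "u * (d + m) = d"
    using d assms by (auto simp: u_def)
  have eq: "(1 - u) * s + u * (t + m) = t"
  proof -
    have "(1 - u) * s + u * (t + m) = s + u * (d + m)"
      by (simp add: d_def algebra_simps)
    then show ?thesis
      using u(3) by (simp add: d_def)
  qed
  have r: "s \<in> {left..right}" "t + m \<in> {left..right}"
    using assms by auto
  have "(d + m) * ((1 - u) * up s + u * up (t + m)) \<le> (d + m) * up t"
    using up_lo_convex(1)[OF r u(1,2)] d assms unfolding eq by (intro mult_left_mono) auto
  moreover have "(d + m) * ((1 - u) * up s + u * up (t + m)) = m * up s + d * up (t + m)"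
  proof -
    have "(d + m) * ((1 - u) * up s + u * up (t + m))
        = (d + m) * up s - (u * (d + m)) * up s + (u * (d + m)) * up (t + m)"
      by (simp add: algebra_simps)
    then show ?thesis
      unfolding u(3) by (simp add: algebra_simps)
  qed
  ultimately have "(up (t + m) - up t) * d \<le> (up t - up s) * m"
    by (simp add: algebra_simps)
  then show "up (t + m) - up t \<le> (up t - up s) / (t - s) * m"
    using d unfolding d_def[symmetric] by (simp add: field_simps)
  have "(d + m) * lo t \<le> (d + m) * ((1 - u) * lo s + u * lo (t + m))"
    using up_lo_convex(2)[OF r u(1,2)] d assms unfolding eq by (intro mult_left_mono) auto
  moreover have "(d + m) * ((1 - u) * lo s + u * lo (t + m)) = m * lo s + d * lo (t + m)"
  proof -
    have "(d + m) * ((1 - u) * lo s + u * lo (t + m))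
        = (d + m) * lo s - (u * (d + m)) * lo s + (u * (d + m)) * lo (t + m)"
      by (simp add: algebra_simps)
    then show ?thesis
      unfolding u(3) by (simp add: algebra_simps)
  qed
  ultimately have "(lo t - lo s) * m \<le> (lo (t + m) - lo t) * d"
    by (simp add: algebra_simps)
  then show "(lo t - lo s) / (t - s) * m \<le> lo (t + m) - lo t"
    using d unfolding d_def[symmetric] by (simp add: field_simps)
qed

definition chords :: "real \<Rightarrow> real \<Rightarrow> real" where
  "chords s t = dist (s, up s) (t, up t) + dist (s, lo s) (t, lo t)"

lemma chords_nonneg: "0 \<le> chords s t"
  by (simp add: chords_def)

text \<open>Prolonging the two chords over \<open>[s, t]\<close> up to height \<open>t + m\<close> encloses the body there, so the
  triangle inequality compares the prolonged chords with the boundary arcs.\<close>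
lemma chords_le_perim:
  assumes s: "left < s" "s < t" and m: "0 < m" "t + m < right"
    and le: "len t \<le> len s" and half: "len t \<le> 2 * len (t + m)"
  shows "chords s t / (t - s) * m \<le> perim t"
proof -
  let ?x = "(up t - up s) / (t - s) * m" and ?y = "(lo t - lo s) / (t - s) * m"
  let ?x' = "up (t + m) - up t" and ?y' = "lo (t + m) - lo t"
  have ext: "?x' \<le> ?x" "?y \<le> ?y'"
    using up_lo_extend[of s t m] assms by auto
  have "?x - ?y = (len t - len s) / (t - s) * m"
    by (simp add: len_def diff_divide_distrib add_divide_distrib algebra_simps)
  also have "\<dots> \<le> 0"
    using s m le by (simp add: mult_le_0_iff divide_le_0_iff)
  finally have xy: "?x \<le> ?y" by simp
  have "chords s t / (t - s) * m = norm (m, ?x) + norm (m, ?y)"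
    unfolding chords_def add_divide_distrib distrib_right using chord_scale[OF s(2) m(1)] by simp
  \<comment> \<open>Each prolonged chord misses the end of the corresponding chord of the body by a
    vertical gap. As \<open>?x \<le> ?y\<close>, the gaps add up to at most
    \<open>len t - len (t + m)\<close>, which \<open>half\<close> bounds by
    \<open>len (t + m)\<close>; the cap beyond \<open>t + m\<close> has at least this
    perimeter.\<close>
  also have "\<dots> \<le> norm (m, ?x') + \<bar>?x - ?x'\<bar> + (norm (m, ?y') + \<bar>?y - ?y'\<bar>)"
    by (intro add_mono norm_Pair_le)
  also have "\<dots> \<le> norm (m, ?x') + norm (m, ?y') + len t - len (t + m)"
    using ext xy by (simp add: len_def)
  also have "\<dots> \<le> norm (m, ?x') + norm (m, ?y') + len (t + m)"
    using half by simp
  also have "\<dots> = chords t (t + m) + len (t + m)"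
    by (simp add: chords_def dist_norm norm_Pair power2_commute)
  also have "\<dots> \<le> measure H (graph up t (t + m)) + measure H (graph lo t (t + m)) + perim (t + m)"
    unfolding chords_def using assms by (intro add_mono chord_le_graph len_le_perim) auto
  also have "\<dots> = perim t"
    using perim_slab[of t "t + m"] assms by simp
  finally show ?thesis .
qed

lemma area_le: "left \<le> t \<Longrightarrow> t < right \<Longrightarrow> (\<And>x. t \<le> x \<Longrightarrow> x \<le> right \<Longrightarrow> len x \<le> len t) \<Longrightarrow> area t \<le> len t * (right - t)"
proof -
  assume t: "left \<le> t" "t < right" and le: "\<And>x. t \<le> x \<Longrightarrow> x \<le> right \<Longrightarrow> len x \<le> len t"
  have l: "0 \<le> len t"
    using len_nonneg t by simp
  have "ennreal (area t) = (\<integral>\<^sup>+x. ennreal (len x) * indicator {t..right} x \<partial>lborel)"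
    using emeasure_cap[of t] t by (simp add: emeasure_cap_eq)
  also have "\<dots> \<le> (\<integral>\<^sup>+x. ennreal (len t) * indicator {t..right} x \<partial>lborel)"
    using le by (intro nn_integral_mono) (auto simp: indicator_def intro: ennreal_leI)
  also have "\<dots> = ennreal (len t * (right - t))"
    using t l by (simp add: nn_integral_cmult_indicator ennreal_mult)
  finally show ?thesis
    using t l by (simp add: ennreal_le_iff)
qed

text \<open>Folding the cap at the height \<open>t + m\<close> pairs chords whose lengths add up to at most
  \<open>2 * len (t + m) \<le> len t\<close>.\<close>
lemma area_le_half:
  assumes t: "left < t" and m: "0 < m" "t + m < right"
    and anti: "\<And>x. t \<le> x \<Longrightarrow> x \<le> right \<Longrightarrow> len x \<le> len t" and half: "2 * len (t + m) \<le> len t"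
  shows "area t \<le> len t * m"
proof -
  define c where "c = t + m"
  have mid: "len x + len (2 * c - x) \<le> 2 * len c" if "x \<in> {left..right}" "2 * c - x \<in> {left..right}" for x
  proof -
    have "(1 - 1 / 2) * x + 1 / 2 * (2 * c - x) = c"
      by (simp add: field_simps)
    then show ?thesis
      using len_concave[OF that, of "1/2"] by simp
  qed
  have l: "0 \<le> len t"
    using len_nonneg t m by simp
  \<comment> \<open>If the cap reached beyond the mirror image of \<open>t\<close> in
    \<open>c\<close>, there would be a chord of positive length there, and concavity would make
    \<open>len c\<close> more than half of \<open>len t\<close>.\<close>
  have r2: "right \<le> 2 * c - t"
  proof (rule ccontr)
    assume "\<not> ?thesis"
    then have "len (2 * c - t) > 0"
      using t m by (intro len_pos) (auto simp: c_def)
    moreover have "len t + len (2 * c - t) \<le> 2 * len c"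
      by (rule mid) (use \<open>\<not> right \<le> 2 * c - t\<close> t m in \<open>auto simp: c_def\<close>)
    ultimately show False
      using half by (simp add: c_def)
  qed
  let ?f = "\<lambda>x. ennreal (len x) * indicator {t..right} x"
  have meas: "?f \<in> borel_measurable lborel"
    using t by (intro measurable_len) auto
  have "ennreal (area t) = (\<integral>\<^sup>+x. ?f x \<partial>lborel)"
    using emeasure_cap[of t] t by (simp add: emeasure_cap_eq)
  also have "\<dots> = (\<integral>\<^sup>+x. ?f x * indicator {..c} x + ?f x * indicator {c<..} x \<partial>lborel)"
    by (intro nn_integral_cong) (auto simp: indicator_def)
  also have "\<dots> = (\<integral>\<^sup>+x. ?f x * indicator {..c} x \<partial>lborel) + (\<integral>\<^sup>+x. ?f x * indicator {c<..} x \<partial>lborel)"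
    using meas by (intro nn_integral_add) auto
  also have "(\<integral>\<^sup>+x. ?f x * indicator {c<..} x \<partial>lborel)
      = (\<integral>\<^sup>+x. ?f (2 * c - x) * indicator {c<..} (2 * c - x) \<partial>lborel)"
    using nn_integral_real_affine[of "\<lambda>x. ?f x * indicator {c<..} x" "-1" "2 * c"] meas by simp
  also have "(\<integral>\<^sup>+x. ?f x * indicator {..c} x \<partial>lborel) + \<dots>
      = (\<integral>\<^sup>+x. ?f x * indicator {..c} x + ?f (2 * c - x) * indicator {c<..} (2 * c - x) \<partial>lborel)"
  proof (rule nn_integral_add[symmetric])
    have "(\<lambda>x. (\<lambda>x. ?f x * indicator {c<..} x) (2 * c - x)) \<in> borel_measurable lborel"
      using meas by (intro measurable_compose[of "\<lambda>x. 2 * c - x" lborel lborel "\<lambda>x. ?f x * indicator {c<..} x"]) auto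
    then show "(\<lambda>x. ?f (2 * c - x) * indicator {c<..} (2 * c - x)) \<in> borel_measurable lborel"
      by simp
  qed (use meas in auto)
  also have "\<dots> \<le> (\<integral>\<^sup>+x. ennreal (len t) * indicator {t..c} x \<partial>lborel)"
  proof (rule nn_integral_mono)
    fix x
    consider "x < t" | "t \<le> x" "x < c" "2 * c - x \<le> right" | "t \<le> x" "x \<le> c" "\<not> (x < c \<and> 2 * c - x \<le> right)" | "c < x"
      by linarith
    then show "?f x * indicator {..c} x + ?f (2 * c - x) * indicator {c<..} (2 * c - x)
        \<le> ennreal (len t) * indicator {t..c} x"
    proof cases
      case 1
      then show ?thesis using r2 by (auto simp: indicator_def)
    next
      case 2
      have in_range: "x \<in> {left..right}" "2 * c - x \<in> {left..right}"
        using 2 t m by (auto simp: c_def)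
      have "len x + len (2 * c - x) \<le> len t"
        using mid[OF in_range] half by (simp add: c_def)
      moreover have "0 \<le> len x" "0 \<le> len (2 * c - x)"
        using len_nonneg in_range by auto
      ultimately have "ennreal (len x) + ennreal (len (2 * c - x)) \<le> ennreal (len t)"
        by (simp add: ennreal_leI flip: ennreal_plus)
      then show ?thesis
        using 2 m by (auto simp: indicator_def c_def)
    next
      case 3
      then show ?thesis
        using anti[of x] m by (auto simp: indicator_def c_def intro: ennreal_leI)
    next
      case 4
      then show ?thesis by (auto simp: indicator_def)
    qed
  qed
  also have "\<dots> = ennreal (len t * m)"
    using l m by (simp add: nn_integral_cmult_indicator ennreal_mult c_def)
  finally show ?thesis
    using l m by (simp add: ennreal_le_iff)
qed

text \<open>A discrete form of the monotonicity of perimeter over area. With \<open>p\<close> for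
  the length of the chords per unit of abscissa, it amounts to
  \<open>p * area t \<le> perim t * len t\<close>. This follows from
  \<open>p * m \<le> perim t\<close> and \<open>area t \<le> len t * m\<close> for one height
  \<open>m\<close>: the one at which \<open>len\<close> has dropped to half of \<open>len t\<close>,
  or the full height of the cap if this never happens.\<close>

lemma chords_area_le:
  assumes s: "left < s" "s < t" "t < right"
    and anti: "\<And>x y. s \<le> x \<Longrightarrow> x \<le> y \<Longrightarrow> y \<le> right \<Longrightarrow> len y \<le> len x"
  shows "chords s t * area t \<le> perim t * (area s - area t)"
proof -
  define p where "p = chords s t / (t - s)"
  have p: "0 \<le> p" "p * (t - s) = chords s t"
    using s chords_nonneg[of s t] by (auto simp: p_def)
  have lt: "0 < len t"
    using len_pos s by simp
  have le_t: "\<And>x. t \<le> x \<Longrightarrow> x \<le> right \<Longrightarrow> len x \<le> len t"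
    using anti s by simp
  have base: "p * m \<le> perim t" if "0 < m" "t + m < right" "len t \<le> 2 * len (t + m)" for m
    unfolding p_def using chords_le_perim[of s t m] that s anti[of s t] by auto
  have "p * area t \<le> perim t * len t"
  proof (cases "\<exists>v. t < v \<and> v < right \<and> 2 * len v \<le> len t")
    case True
    then obtain v where v: "t < v" "v < right" "2 * len v \<le> len t" by blast
    have "continuous_on {t..v} len"
      using continuous_on_sub(3)[of t v] s v by simp
    then obtain c where c: "t \<le> c" "c \<le> v" "len c = len t / 2"
      using IVT2'[of len v "len t / 2" t] v lt by auto
    then have "c \<noteq> t"
      using lt by auto
    then have m: "0 < c - t" "t + (c - t) < right"
      using c v by auto
    have "p * (c - t) \<le> perim t" "area t \<le> len t * (c - t)"
      using base[OF m] area_le_half[of t "c - t"] m c s le_t by auto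
    then have "p * area t \<le> p * (len t * (c - t))" "len t * (p * (c - t)) \<le> len t * perim t"
      using p lt by (auto intro!: mult_left_mono)
    then show ?thesis
      by (simp add: algebra_simps)
  next
    case False
    have "p * (right - t) \<le> perim t"
    proof (rule ccontr)
      assume c: "\<not> ?thesis"
      then have "p > 0"
        using p(1) perim_nonneg[of t] by (cases "p = 0") auto
      define q where "q = perim t / p"
      define m where "m = (q + (right - t)) / 2"
      have "q < right - t"
        using c \<open>p > 0\<close> by (simp add: q_def field_simps)
      moreover have "0 \<le> q"
        using perim_nonneg \<open>p > 0\<close> by (simp add: q_def)
      ultimately have m: "0 < m" "t + m < right" "q < m"
        using s by (auto simp: m_def field_simps)
      moreover have "len t \<le> 2 * len (t + m)"
        using False m by force
      ultimately have "p * m \<le> perim t"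
        using base by blast
      then show False
        using m(3) \<open>p > 0\<close> by (simp add: q_def field_simps)
    qed
    moreover have "area t \<le> len t * (right - t)"
      using area_le[of t] s le_t by auto
    ultimately have "p * area t \<le> p * (len t * (right - t))" "len t * (p * (right - t)) \<le> len t * perim t"
      using p lt by (auto intro!: mult_left_mono)
    then show ?thesis
      by (simp add: algebra_simps)
  qed
  \<comment> \<open>Multiplication by \<open>t - s\<close> turns \<open>p\<close> into the chords,
    and \<open>len t\<close> into the area of a rectangle inside the slab.\<close>
  then have "p * area t * (t - s) \<le> perim t * len t * (t - s)"
    using s by (intro mult_right_mono) auto
  also have "\<dots> = perim t * ((t - s) * len t)"
    by (simp add: algebra_simps)
  also have "\<dots> \<le> perim t * (area s - area t)"
    using area_slab[of s t] s anti perim_nonneg[of t] by (intro mult_left_mono) (auto simp: algebra_simps)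
  finally show ?thesis
    using p(2) by (metis mult.assoc mult.commute)
qed

end

section \<open>Monotonicity of perimeter over area\<close>

context planar_body_perimeter
begin

definition ratio :: "real \<Rightarrow> real" where
  "ratio t = perim t / area t"

lemma area_pos:
  assumes "left < t" "t < right" and anti: "\<And>x y. t \<le> x \<Longrightarrow> x \<le> y \<Longrightarrow> y \<le> right \<Longrightarrow> len y \<le> len x"
  shows "area t > 0"
proof -
  let ?m = "(t + right) / 2"
  have "area ?m + (?m - t) * len ?m \<le> area t"
    using assms by (intro area_slab) auto
  moreover have "0 < (?m - t) * len ?m"
    using assms by (intro mult_pos_pos len_pos) auto
  ultimately show ?thesis
    using area_nonneg[of ?m] by linarith
qed

text \<open>Over each step of a subdivision \<open>chords_area_le\<close> handles the chords, and
  the excess of the arcs over the chords enters as an error. The errors sum to the length of the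
  arcs minus that of the inscribed polygons, which is small for monotone graphs and fine
  subdivisions.\<close>

lemma ratio_mono_piece:
  assumes s: "left < s" "s < t" "t < right"
    and anti: "\<And>x y. s \<le> x \<Longrightarrow> x \<le> y \<Longrightarrow> y \<le> right \<Longrightarrow> len y \<le> len x"
    and up: "mono_on {s..t} up \<or> mono_on {s..t} (\<lambda>x. - up x)"
    and lo: "mono_on {s..t} lo \<or> mono_on {s..t} (\<lambda>x. - lo x)"
  shows "ratio s \<le> ratio t"
proof -
  have at: "area t > 0"
    using s anti by (intro area_pos) auto
  have "ratio s * area t \<le> ratio t * area t + e" if e: "e > 0" for e
  proof -
    have cont: "continuous_on {s..t} up" "continuous_on {s..t} lo"
      using continuous_on_sub[of s t] s by auto
    have gb: "graph up s t \<in> sets borel" "graph lo s t \<in> sets borel"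
      using graph_borel cont by auto
    have gs: "graph up s t \<subseteq> frontier K" "graph lo s t \<subseteq> frontier K"
      using graph_frontier s by auto
    have fin: "hausdorff_outer 1 (graph up s t) \<noteq> \<infinity>" "hausdorff_outer 1 (graph lo s t) \<noteq> \<infinity>"
      using H_outer[OF gb(1)] H_outer[OF gb(2)] H_sub_finite[OF gs(1)] H_sub_finite[OF gs(2)] by auto
    obtain N1 where N1: "N1 > 0"
      "\<forall>n\<ge>N1. hausdorff_outer 1 (graph up s t) \<le> ennreal (polygon_length up s t n + e / 2)"
      using hausdorff_outer_graph_le[OF s(2) cont(1) up fin(1) subset_refl, of "e / 2"] e by auto
    obtain N2 where N2: "N2 > 0"
      "\<forall>n\<ge>N2. hausdorff_outer 1 (graph lo s t) \<le> ennreal (polygon_length lo s t n + e / 2)"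
      using hausdorff_outer_graph_le[OF s(2) cont(2) lo fin(2) subset_refl, of "e / 2"] e by auto
    define n where "n = max N1 N2"
    have n: "n > 0" using N1 by (simp add: n_def)
    have poly_nonneg: "0 \<le> polygon_length \<phi> s t n" for \<phi>
      unfolding polygon_length_def by (intro sum_nonneg) auto
    have m_up: "measure H (graph up s t) \<le> polygon_length up s t n + e / 2"
    proof -
      have "ennreal (measure H (graph up s t)) \<le> ennreal (polygon_length up s t n + e / 2)"
        using N1(2) H_outer[OF gb(1)] emeasure_eq_ennreal_measure[of H "graph up s t"] H_sub_finite[OF gs(1)]
        by (auto simp: n_def)
      then show ?thesis
        using poly_nonneg[of up] e by (subst (asm) ennreal_le_iff) auto
    qed
    have m_lo: "measure H (graph lo s t) \<le> polygon_length lo s t n + e / 2"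
    proof -
      have "ennreal (measure H (graph lo s t)) \<le> ennreal (polygon_length lo s t n + e / 2)"
        using N2(2) H_outer[OF gb(2)] emeasure_eq_ennreal_measure[of H "graph lo s t"] H_sub_finite[OF gs(2)]
        by (auto simp: n_def)
      then show ?thesis
        using poly_nonneg[of lo] e by (subst (asm) ennreal_le_iff) auto
    qed
    define \<tau> where "\<tau> i = s + (t - s) * real i / real n" for i
    \<comment> \<open>The perimeter between consecutive abscissas in excess of the two
      chords.\<close>
    define \<epsilon> where "\<epsilon> i = perim (\<tau> i) - perim (\<tau> (Suc i)) - chords (\<tau> i) (\<tau> (Suc i))" for i
    have \<tau>0: "\<tau> 0 = s" and \<tau>n: "\<tau> n = t"
      using n by (auto simp: \<tau>_def)
    have \<tau>_less: "\<tau> i < \<tau> (Suc i)" for i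
      using s n unfolding \<tau>_def by (intro add_strict_left_mono divide_strict_right_mono mult_strict_left_mono) auto
    have \<tau>_in: "s \<le> \<tau> i" "\<tau> i \<le> t" if "i \<le> n" for i
    proof -
      have "\<tau> 0 \<le> \<tau> i" "\<tau> i \<le> \<tau> n"
        using lift_Suc_mono_le[of \<tau>] \<tau>_less that by (simp_all add: less_imp_le)
      then show "s \<le> \<tau> i" "\<tau> i \<le> t"
        by (simp_all add: \<tau>0 \<tau>n)
    qed
    have area_\<tau>: "area t \<le> area (\<tau> i)" if "i \<le> n" for i
    proof (cases "\<tau> i = t")
      case False
      then have "\<tau> i < t"
        using \<tau>_in[OF that] by simp
      then have "area t + (t - \<tau> i) * len t \<le> area (\<tau> i)"
        using s \<tau>_in[OF that] anti by (intro area_slab) auto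
      moreover have "0 \<le> (t - \<tau> i) * len t"
        using len_pos[of t] s \<open>\<tau> i < t\<close> by simp
      ultimately show ?thesis by linarith
    qed simp
    have \<epsilon>_nonneg: "0 \<le> \<epsilon> i" if "i < n" for i
    proof -
      have r: "left < \<tau> i" "\<tau> (Suc i) < right"
        using \<tau>_in[of i] \<tau>_in[of "Suc i"] that s by auto
      have "chords (\<tau> i) (\<tau> (Suc i)) \<le> measure H (graph up (\<tau> i) (\<tau> (Suc i))) + measure H (graph lo (\<tau> i) (\<tau> (Suc i)))"
        unfolding chords_def using r \<tau>_less by (intro add_mono chord_le_graph) auto
      then show ?thesis
        using perim_slab[of "\<tau> i" "\<tau> (Suc i)"] r less_imp_le[OF \<tau>_less[of i]] by (simp add: \<epsilon>_def)
    qed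
    have step: "ratio (\<tau> i) * area t \<le> ratio (\<tau> (Suc i)) * area t + \<epsilon> i" if "i < n" for i
    proof -
      let ?a = "area (\<tau> i)" and ?b = "area (\<tau> (Suc i))"
      have ab: "area t \<le> ?a" "area t \<le> ?b"
        using area_\<tau>[of i] area_\<tau>[of "Suc i"] that by auto
      have r: "left < \<tau> i" "\<tau> (Suc i) < right"
        using \<tau>_in[of i] \<tau>_in[of "Suc i"] that s by auto
      have "chords (\<tau> i) (\<tau> (Suc i)) * ?b \<le> perim (\<tau> (Suc i)) * (?a - ?b)"
        using r \<tau>_less[of i] \<tau>_in[of i] that anti by (intro chords_area_le) auto
      then have "perim (\<tau> i) * ?b \<le> perim (\<tau> (Suc i)) * ?a + \<epsilon> i * ?b"
        by (simp add: \<epsilon>_def algebra_simps)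
      then have "ratio (\<tau> i) \<le> ratio (\<tau> (Suc i)) + \<epsilon> i / ?a"
        using ab at unfolding ratio_def by (simp add: field_simps)
      also have "\<epsilon> i / ?a \<le> \<epsilon> i / area t"
        using ab at \<epsilon>_nonneg[OF that] by (intro divide_left_mono) auto
      finally have "ratio (\<tau> i) * area t \<le> (ratio (\<tau> (Suc i)) + \<epsilon> i / area t) * area t"
        using at by (intro mult_right_mono) auto
      then show ?thesis
        using at by (simp add: distrib_right)
    qed
    have "ratio s * area t \<le> ratio (\<tau> k) * area t + (\<Sum>i<k. \<epsilon> i)" if "k \<le> n" for k
      using that
    proof (induction k)
      case 0
      then show ?case by (simp add: \<tau>0)
    next
      case (Suc k)
      then show ?case
        using step[of k] by simp
    qed
    from this[of n] have "ratio s * area t \<le> ratio t * area t + (\<Sum>i<n. \<epsilon> i)"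
      by (simp add: \<tau>n)
    also have "(\<Sum>i<n. \<epsilon> i) = (\<Sum>i<n. perim (\<tau> i) - perim (\<tau> (Suc i))) - (\<Sum>i<n. chords (\<tau> i) (\<tau> (Suc i)))"
      by (simp add: \<epsilon>_def sum_subtractf)
    also have "(\<Sum>i<n. perim (\<tau> i) - perim (\<tau> (Suc i))) = perim s - perim t"
      using sum_lessThan_telescope'[of "\<lambda>i. perim (\<tau> i)" n] by (simp add: \<tau>0 \<tau>n)
    also have "(\<Sum>i<n. chords (\<tau> i) (\<tau> (Suc i))) = polygon_length up s t n + polygon_length lo s t n"
      by (simp add: chords_def polygon_length_def \<tau>_def sum.distrib)
    also have "perim s - perim t = measure H (graph up s t) + measure H (graph lo s t)"
      using perim_slab[of s t] s by simp
    finally show ?thesis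
      using m_up m_lo by simp
  qed
  then have "ratio s * area t \<le> ratio t * area t"
    by (rule field_le_epsilon)
  then show ?thesis
    using at by simp
qed

text \<open>The point \<open>c\<close> is a maximum point. Moving towards it from either side, a
  concave function cannot decrease.\<close>

lemma concave_unimodal:
  assumes "s \<le> t" and cont: "continuous_on {s..t} f"
    and conc: "\<And>x y u. x \<in> {s..t} \<Longrightarrow> y \<in> {s..t} \<Longrightarrow> 0 \<le> u \<Longrightarrow> u \<le> 1 \<Longrightarrow>
      (1 - u) * f x + u * f y \<le> f ((1 - u) * x + u * y)"
  obtains c :: real where "s \<le> c" "c \<le> t" "mono_on {s..c} f" "mono_on {c..t} (\<lambda>x. - f x :: real)"
proof -
  obtain c where c: "c \<in> {s..t}" "\<And>x. x \<in> {s..t} \<Longrightarrow> f x \<le> f c"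
    using continuous_attains_sup[of "{s..t}" f] cont \<open>s \<le> t\<close> by auto
  have key: "f x \<le> f ((1 - u) * x + u * c)" if "x \<in> {s..t}" "0 \<le> u" "u \<le> 1" for x u
  proof -
    have "f x = (1 - u) * f x + u * f x"
      by (simp add: algebra_simps)
    also have "\<dots> \<le> (1 - u) * f x + u * f c"
      using c(2)[OF that(1)] that by (intro add_left_mono mult_left_mono) auto
    also have "\<dots> \<le> f ((1 - u) * x + u * c)"
      using conc that c by blast
    finally show ?thesis .
  qed
  have between: "f x \<le> f y" if "x \<in> {s..t}" "(x \<le> y \<and> y \<le> c) \<or> (c \<le> y \<and> y \<le> x)" for x y
  proof (cases "x = c")
    case False
    define u where "u = (y - x) / (c - x)"
    have u: "u * (c - x) = y - x"
      using False by (simp add: u_def)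
    have "0 \<le> u" "u \<le> 1"
      using that False by (auto simp: u_def divide_le_eq zero_le_divide_iff)
    moreover have "(1 - u) * x + u * c = y"
      using u by (simp add: algebra_simps)
    ultimately show ?thesis
      using key[OF that(1), of u] by simp
  qed (use that in auto)
  show ?thesis
    by (rule that[of c]) (use c between in \<open>auto intro!: mono_onI\<close>)
qed

text \<open>The peaks of \<open>up\<close> and of \<open>- lo\<close> cut the interval into at most
  three parts, on each of which both graphs are monotone.\<close>

lemma ratio_mono:
  assumes s: "left < s" "s \<le> t" "t < right"
    and anti: "\<And>x y. s \<le> x \<Longrightarrow> x \<le> y \<Longrightarrow> y \<le> right \<Longrightarrow> len y \<le> len x"
  shows "ratio s \<le> ratio t"
proof -
  have cont: "continuous_on {s..t} up" "continuous_on {s..t} (\<lambda>x. - lo x)"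
    using continuous_on_sub[of s t] s by (auto intro: continuous_intros)
  obtain c where c: "s \<le> c" "c \<le> t" "mono_on {s..c} up" "mono_on {c..t} (\<lambda>x. - up x)"
    by (rule concave_unimodal[OF s(2) cont(1)]) (use up_lo_convex(1) s in auto)
  obtain d where d: "s \<le> d" "d \<le> t" "mono_on {s..d} (\<lambda>x. - lo x)" "mono_on {d..t} (\<lambda>x. - (- lo x))"
  proof (rule concave_unimodal[OF s(2) cont(2)])
    fix x y u assume "x \<in> {s..t}" "y \<in> {s..t}" "0 \<le> u" "u \<le> (1::real)"
    then show "(1 - u) * - lo x + u * - lo y \<le> - lo ((1 - u) * x + u * y)"
      using up_lo_convex(2)[of x y u] s by auto
  qed
  have piece: "ratio x \<le> ratio y" if "s \<le> x" "x \<le> y" "y \<le> t" "y \<le> c \<or> c \<le> x" "y \<le> d \<or> d \<le> x" for x y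
  proof (cases "x = y")
    case False
    have "mono_on {x..y} up \<or> mono_on {x..y} (\<lambda>x. - up x)"
      using that c mono_on_subset[of "{s..c}" up "{x..y}"] mono_on_subset[of "{c..t}" "\<lambda>x. - up x" "{x..y}"]
      by auto
    moreover have "mono_on {x..y} lo \<or> mono_on {x..y} (\<lambda>x. - lo x)"
      using that d mono_on_subset[of "{s..d}" "\<lambda>x. - lo x" "{x..y}"] mono_on_subset[of "{d..t}" lo "{x..y}"]
      by auto
    ultimately show ?thesis
      using False that s anti by (intro ratio_mono_piece) auto
  qed simp
  have "ratio s \<le> ratio (min c d)"
    using c d by (intro piece) auto
  also have "\<dots> \<le> ratio (max c d)"
    using c d by (intro piece) auto
  also have "\<dots> \<le> ratio t"
    using c d by (intro piece) auto
  finally show ?thesis .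
qed

end

section \<open>Ramps and tail probabilities\<close>

text \<open>The layer cake formula writes the expected ramp as the integral of the tail
  probabilities from \<open>s\<close> on. Above \<open>b\<close> the tails of \<open>X\<close>
  vanish, and the level \<open>b\<close> itself is a null set.\<close>

lemma ramp_integral_mono:
  fixes X :: "'a \<Rightarrow> real" and Y :: "'b \<Rightarrow> real"
  assumes \<mu>: "prob_space \<mu>" and \<nu>: "prob_space \<nu>"
    and X [measurable]: "X \<in> borel_measurable \<mu>" and Y [measurable]: "Y \<in> borel_measurable \<nu>"
    and bX: "AE x in \<mu>. X x \<le> b" 
    and int: "integrable \<mu> (\<lambda>x. max 0 (X x - s))" "integrable \<nu> (\<lambda>y. max 0 (Y y - s))"
    and le: "\<And>t. s \<le> t \<Longrightarrow> t < b \<Longrightarrow> measure \<mu> {x \<in> space \<mu>. t \<le> X x} \<le> measure \<nu> {y \<in> space \<nu>. t \<le> Y y}"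
  shows "(\<integral>x. max 0 (X x - s) \<partial>\<mu>) \<le> (\<integral>y. max 0 (Y y - s) \<partial>\<nu>)"
proof -
  have layer: "(\<integral>\<^sup>+x. ennreal (max 0 (Z x - s)) \<partial>\<rho>)
      = (\<integral>\<^sup>+t. indicator {s..} t * emeasure \<rho> {x \<in> space \<rho>. t \<le> Z x} \<partial>lborel)"
    if "prob_space \<rho>" and [measurable]: "Z \<in> borel_measurable \<rho>" for \<rho> :: "'c measure" and Z
  proof -
    interpret \<rho>: prob_space \<rho> by fact
    interpret pair_sigma_finite \<rho> lborel ..
    have "(\<integral>\<^sup>+x. ennreal (max 0 (Z x - s)) \<partial>\<rho>) = (\<integral>\<^sup>+x. \<integral>\<^sup>+t. indicator {s..} t * indicator {..Z x} t \<partial>lborel \<partial>\<rho>)"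
    proof (rule nn_integral_cong)
      fix x
      have "(\<integral>\<^sup>+t. indicator {s..} t * indicator {..Z x} t \<partial>lborel) = (\<integral>\<^sup>+t. indicator {s..Z x} t \<partial>lborel)"
        by (intro nn_integral_cong) (auto simp: indicator_def)
      then show "ennreal (max 0 (Z x - s)) = (\<integral>\<^sup>+t. indicator {s..} t * indicator {..Z x} t \<partial>lborel)"
        by (cases "s \<le> Z x") (auto simp: max_def)
    qed
    also have "\<dots> = (\<integral>\<^sup>+t. \<integral>\<^sup>+x. indicator {s..} t * indicator {..Z x} t \<partial>\<rho> \<partial>lborel)"
      by (rule Fubini'[symmetric]) (simp add: indicator_def split_beta')
    also have "\<dots> = (\<integral>\<^sup>+t. indicator {s..} t * emeasure \<rho> {x \<in> space \<rho>. t \<le> Z x} \<partial>lborel)"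
    proof (rule nn_integral_cong)
      fix t
      have "(\<integral>\<^sup>+x. indicator {s..} t * indicator {..Z x} t \<partial>\<rho>)
          = (\<integral>\<^sup>+x. indicator {s..} t * indicator {x \<in> space \<rho>. t \<le> Z x} x \<partial>\<rho>)"
        by (intro nn_integral_cong) (auto simp: indicator_def)
      also have "\<dots> = indicator {s..} t * emeasure \<rho> {x \<in> space \<rho>. t \<le> Z x}"
        by (intro nn_integral_cmult_indicator) simp
      finally show "(\<integral>\<^sup>+x. indicator {s..} t * indicator {..Z x} t \<partial>\<rho>)
          = indicator {s..} t * emeasure \<rho> {x \<in> space \<rho>. t \<le> Z x}" .
    qed
    finally show ?thesis .
  qed
  interpret \<mu>: prob_space \<mu> by fact
  interpret \<nu>: prob_space \<nu> by fact
  have "(\<integral>\<^sup>+x. ennreal (max 0 (X x - s)) \<partial>\<mu>) \<le> (\<integral>\<^sup>+y. ennreal (max 0 (Y y - s)) \<partial>\<nu>)"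
    unfolding layer[OF \<mu> X] layer[OF \<nu> Y]
  proof (rule nn_integral_mono_AE)
    have "AE t in lborel. t \<noteq> b"
      by (rule AE_lborel_singleton)
    then show "AE t in lborel. indicator {s..} t * emeasure \<mu> {x \<in> space \<mu>. t \<le> X x}
        \<le> indicator {s..} t * emeasure \<nu> {x \<in> space \<nu>. t \<le> Y x}"
    proof eventually_elim
      case (elim t)
      consider "t < s" | "s \<le> t" "t < b" | "b < t"
        using elim by linarith
      then show ?case
      proof cases
        case 2
        then show ?thesis
          using le[OF 2] by (simp add: \<mu>.emeasure_eq_measure \<nu>.emeasure_eq_measure ennreal_leI)
      next
        case 3
        have "AE x in \<mu>. \<not> t \<le> X x"
          using bX by eventually_elim (use 3 in simp)
        then have "emeasure \<mu> {x \<in> space \<mu>. t \<le> X x} = 0"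
          by (subst (asm) AE_iff_measurable[OF _ refl]) auto
        then show ?thesis by simp
      qed simp
    qed
  qed
  moreover have "(\<integral>\<^sup>+x. ennreal (max 0 (X x - s)) \<partial>\<mu>) = ennreal (\<integral>x. max 0 (X x - s) \<partial>\<mu>)"
    by (intro nn_integral_eq_integral int AE_I2 max.cobounded1)
  moreover have "(\<integral>\<^sup>+y. ennreal (max 0 (Y y - s)) \<partial>\<nu>) = ennreal (\<integral>y. max 0 (Y y - s) \<partial>\<nu>)"
    by (intro nn_integral_eq_integral int AE_I2 max.cobounded1)
  moreover have "0 \<le> (\<integral>y. max 0 (Y y - s) \<partial>\<nu>)"
    by (intro integral_nonneg_AE AE_I2 max.cobounded1)
  ultimately show ?thesis
    by (simp only: ennreal_le_iff)
qed

text \<open>The expected ramp has minus the tail probability as left derivative in its threshold, so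
  a minimum from the left orders the tails. In terms of difference quotients: lowering the threshold
  by \<open>e\<close> raises the ramp of \<open>X\<close> by \<open>e\<close> where
  \<open>s \<le> X\<close>, and the ramp of \<open>Y\<close> by at most \<open>e\<close> and only
  where \<open>s - e \<le> Y\<close>.\<close>

lemma ramp_minimum:
  fixes X :: "'a \<Rightarrow> real" and Y :: "'b \<Rightarrow> real"
  assumes \<mu>: "prob_space \<mu>" and \<nu>: "prob_space \<nu>"
    and int: "integrable \<mu> X" "integrable \<nu> Y" and "\<delta> > 0"
    and le: "\<And>t. s - \<delta> < t \<Longrightarrow> t < s \<Longrightarrow> (\<integral>y. max 0 (Y y - s) \<partial>\<nu>) - (\<integral>x. max 0 (X x - s) \<partial>\<mu>)
      \<le> (\<integral>y. max 0 (Y y - t) \<partial>\<nu>) - (\<integral>x. max 0 (X x - t) \<partial>\<mu>)"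
  shows "measure \<mu> {x \<in> space \<mu>. s \<le> X x} \<le> measure \<nu> {y \<in> space \<nu>. s \<le> Y y}"
proof -
  interpret \<mu>: prob_space \<mu> by fact
  interpret \<nu>: prob_space \<nu> by fact
  have [measurable]: "X \<in> borel_measurable \<mu>" "Y \<in> borel_measurable \<nu>"
    using int by auto
  have iX: "integrable \<mu> (\<lambda>x. max 0 (X x - t))" for t
    using int by (intro integrable_max) auto
  have iY: "integrable \<nu> (\<lambda>y. max 0 (Y y - t))" for t
    using int by (intro integrable_max) auto
  have step: "measure \<mu> {x \<in> space \<mu>. s \<le> X x} \<le> measure \<nu> {y \<in> space \<nu>. s - e \<le> Y y}" if e: "0 < e" "e < \<delta>" for e
  proof -
    have iS: "integrable \<mu> (\<lambda>x. e * indicator {x \<in> space \<mu>. s \<le> X x} x)"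
      "integrable \<nu> (\<lambda>y. e * indicator {y \<in> space \<nu>. s - e \<le> Y y} y)"
      by (intro integrable_mult_right integrable_real_indicator; simp add: \<mu>.emeasure_eq_measure \<nu>.emeasure_eq_measure)+
    have "e * measure \<mu> {x \<in> space \<mu>. s \<le> X x} = (\<integral>x. e * indicator {x \<in> space \<mu>. s \<le> X x} x \<partial>\<mu>)"
      by simp
    also have "\<dots> \<le> (\<integral>x. max 0 (X x - (s - e)) - max 0 (X x - s) \<partial>\<mu>)"
      using e by (intro integral_mono iS Bochner_Integration.integrable_diff iX) (auto simp: indicator_def)
    also have "\<dots> = (\<integral>x. max 0 (X x - (s - e)) \<partial>\<mu>) - (\<integral>x. max 0 (X x - s) \<partial>\<mu>)"
      using iX by (intro Bochner_Integration.integral_diff)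
    also have "\<dots> \<le> (\<integral>y. max 0 (Y y - (s - e)) \<partial>\<nu>) - (\<integral>y. max 0 (Y y - s) \<partial>\<nu>)"
      using le[of "s - e"] e by simp
    also have "\<dots> = (\<integral>y. max 0 (Y y - (s - e)) - max 0 (Y y - s) \<partial>\<nu>)"
      using iY by (intro Bochner_Integration.integral_diff[symmetric])
    also have "\<dots> \<le> (\<integral>y. e * indicator {y \<in> space \<nu>. s - e \<le> Y y} y \<partial>\<nu>)"
      using e by (intro integral_mono iS Bochner_Integration.integrable_diff iY) (auto simp: indicator_def)
    also have "\<dots> = e * measure \<nu> {y \<in> space \<nu>. s - e \<le> Y y}"
      by simp
    finally show ?thesis
      using e by simp
  qed
  \<comment> \<open>The offset 2 keeps every step \<open>\<delta> / real (n + 2)\<close> strictly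
    below \<open>\<delta>\<close>.\<close>
  let ?A = "\<lambda>n::nat. {y \<in> space \<nu>. s - \<delta> / real (n + 2) \<le> Y y}"
  have "(\<lambda>n. measure \<nu> (?A n)) \<longlonglongrightarrow> measure \<nu> (\<Inter>n. ?A n)"
  proof (rule \<nu>.finite_Lim_measure_decseq)
    show "decseq ?A"
    proof (rule decseq_SucI, clarify)
      fix n y assume "s - \<delta> / real (Suc n + 2) \<le> Y y"
      moreover have "\<delta> / real (Suc n + 2) \<le> \<delta> / real (n + 2)"
        using \<open>\<delta> > 0\<close> by (intro divide_left_mono) auto
      ultimately show "s - \<delta> / real (n + 2) \<le> Y y" by linarith
    qed
  qed auto
  moreover have "(\<Inter>n. ?A n) = {y \<in> space \<nu>. s \<le> Y y}"
  proof -
    have "s \<le> Y y" if "\<And>n::nat. s - \<delta> / real (n + 2) \<le> Y y" for y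
    proof (rule ccontr)
      assume "\<not> s \<le> Y y"
      then have "0 < (s - Y y) / \<delta>"
        using \<open>\<delta> > 0\<close> by simp
      then obtain n where "n > 0" "1 / real n < (s - Y y) / \<delta>"
        using ex_inverse_of_nat_less[of "(s - Y y) / \<delta>"] by (auto simp: inverse_eq_divide)
      then have "\<delta> / real n < s - Y y"
        using \<open>\<delta> > 0\<close> by (simp add: field_simps)
      moreover have "\<delta> / real (n + 2) \<le> \<delta> / real n"
        using \<open>\<delta> > 0\<close> \<open>n > 0\<close> by (intro divide_left_mono) auto
      ultimately show False
        using that[of n] by linarith
    qed
    moreover have "s - \<delta> / real (n + 2) \<le> Y y" if "s \<le> Y y" for n :: nat and y
    proof -
      have "0 \<le> \<delta> / real (n + 2)" using \<open>\<delta> > 0\<close> by simp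
      with that show ?thesis by linarith
    qed
    ultimately show ?thesis by auto
  qed
  ultimately have lim: "(\<lambda>n. measure \<nu> (?A n)) \<longlonglongrightarrow> measure \<nu> {y \<in> space \<nu>. s \<le> Y y}"
    by simp
  show ?thesis
  proof (rule LIMSEQ_le_const[OF lim], intro exI allI impI)
    fix n :: nat
    have "\<delta> / real (n + 2) < \<delta>"
      using \<open>\<delta> > 0\<close> by (simp add: field_simps add_pos_nonneg)
    then show "measure \<mu> {x \<in> space \<mu>. s \<le> X x} \<le> measure \<nu> (?A n)"
      using \<open>\<delta> > 0\<close> by (intro step) auto
  qed
qed

section \<open>Ramps under the two uniform laws\<close>

context planar_body_perimeter
begin

abbreviation "\<mu> \<equiv> uniform_measure lborel K"
abbreviation "\<nu> \<equiv> uniform_measure H (frontier K)"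

lemma body: "convex_body K"
  using compact_K convex_K interior_K by (simp add: convex_body_def)

text \<open>A cap has at least the perimeter of the length of its chord, which is positive
  somewhere.\<close>

lemma H_positive: "emeasure H (frontier K) \<noteq> 0"
proof
  assume "emeasure H (frontier K) = 0"
  moreover obtain s where s: "left < s" "s < right" "len s > 0"
    using interior_point by blast
  ultimately have "emeasure H (frontier K \<inter> {z. s \<le> fst z}) = 0"
    using emeasure_mono[of "frontier K \<inter> {z. s \<le> fst z}" "frontier K" H] by simp
  then have "perim s = 0"
    by (simp add: perim_def measure_def)
  then show False
    using len_le_perim[of s] s by simp
qed

lemma prob_\<mu>: "prob_space \<mu>" and prob_\<nu>: "prob_space \<nu>"
  using convex_body_emeasure[OF body] H_positive H_finite
  by (auto intro!: prob_space_uniform_measure)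

lemma sets_\<mu>\<nu> [simp]: "sets \<mu> = sets borel" "sets \<nu> = sets borel" "space \<mu> = UNIV" "space \<nu> = UNIV"
  by (auto simp: space_uniform_measure)

lemma AE_\<mu>: "AE z in \<mu>. z \<in> K" and AE_\<nu>: "AE z in \<nu>. z \<in> frontier K"
  by (rule AE_uniform_measureI; use closed_K in simp)+

lemma integrable_\<mu>\<nu>:
  assumes "continuous_on UNIV (f :: real \<times> real \<Rightarrow> real)"
  shows "integrable \<mu> f" "integrable \<nu> f"
  using integrable_continuous_compact[of \<mu> K f] integrable_continuous_compact[of \<nu> "frontier K" f]
    compact_K compact_frontier[OF compact_K] AE_\<mu> AE_\<nu> prob_\<mu> prob_\<nu> assms
  by (auto simp: prob_space.finite_measure)

lemma measure_cap:
  "measure \<mu> {z. t \<le> fst z} = area t / measure lborel K"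
  "measure \<nu> {z. t \<le> fst z} = perim t / measure H (frontier K)"
proof -
  have "closed {z :: real \<times> real. t \<le> fst z}"
    by (intro closed_Collect_le continuous_intros)
  then have "{z :: real \<times> real. t \<le> fst z} \<in> sets borel"
    by simp
  then show "measure \<mu> {z. t \<le> fst z} = area t / measure lborel K"
    "measure \<nu> {z. t \<le> fst z} = perim t / measure H (frontier K)"
    using convex_body_emeasure[OF body] H_positive H_finite
    by (simp_all add: measure_uniform_measure area_def perim_def)
qed

text \<open>As perimeter over area grows towards the tip, the inequality between the two fractions
  of the cap at \<open>s\<close> passes to all smaller caps, that is, to the tail probabilities
  beyond \<open>s\<close>.\<close>

lemma cap_comparison:
  assumes s: "left < s" "s < right"
    and anti: "\<And>x y. s \<le> x \<Longrightarrow> x \<le> y \<Longrightarrow> y \<le> right \<Longrightarrow> len y \<le> len x"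
    and le: "measure \<mu> {z. s \<le> fst z} \<le> measure \<nu> {z. s \<le> fst z}"
  shows "(\<integral>z. max 0 (fst z - s) \<partial>\<mu>) \<le> (\<integral>z. max 0 (fst z - s) \<partial>\<nu>)"
proof (rule ramp_integral_mono[OF prob_\<mu> prob_\<nu>, where b = right])
  show "AE z in \<mu>. fst z \<le> right"
    using AE_\<mu> by eventually_elim (metis mem_K prod.collapse)
  show "integrable \<mu> (\<lambda>z. max 0 (fst z - s))" "integrable \<nu> (\<lambda>z. max 0 (fst z - s))"
    by (auto intro!: integrable_\<mu>\<nu> continuous_intros)
  fix t assume t: "s \<le> t" "t < right"
  have a: "area s > 0" "area t > 0"
    using area_pos[of s] area_pos[of t] s t anti by auto
  have "ratio s \<le> ratio t"
    using ratio_mono[of s t] s t anti by auto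
  then have "perim s * area t \<le> perim t * area s"
    using a by (simp add: ratio_def field_simps)
  then have 1: "perim s * area t / measure H (frontier K) \<le> perim t * area s / measure H (frontier K)"
    by (intro divide_right_mono) auto
  have "area t * (area s / measure lborel K) \<le> area t * (perim s / measure H (frontier K))"
    using le a by (intro mult_left_mono) (auto simp: measure_cap)
  then have "area s * (area t / measure lborel K) \<le> area s * (perim t / measure H (frontier K))"
    using 1 by (simp add: mult_ac)
  then have "area t / measure lborel K \<le> perim t / measure H (frontier K)"
    using a(1) by (simp only: mult_le_cancel_left_pos)
  then show "measure \<mu> {z \<in> space \<mu>. t \<le> fst z} \<le> measure \<nu> {z \<in> space \<nu>. t \<le> fst z}"
    by (simp add: measure_cap)
qed (auto simp: measurable_cong_sets[OF sets_\<mu>\<nu>(1)] measurable_cong_sets[OF sets_\<mu>\<nu>(2)]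
      intro!: borel_measurable_continuous_onI continuous_intros)

definition excess :: "real \<Rightarrow> real" where
  "excess s = (\<integral>z. max 0 (fst z - s) \<partial>\<nu>) - (\<integral>z. max 0 (fst z - s) \<partial>\<mu>)"

lemma excess_nonneg_at_minimum:
  assumes s: "left < s" "s < right"
    and anti: "\<And>x y. s \<le> x \<Longrightarrow> x \<le> y \<Longrightarrow> y \<le> right \<Longrightarrow> len y \<le> len x"
    and min: "\<And>t. t \<in> {left..right} \<Longrightarrow> excess s \<le> excess t"
  shows "0 \<le> excess s"
proof -
  have "measure \<mu> {z \<in> space \<mu>. s \<le> fst z} \<le> measure \<nu> {z \<in> space \<nu>. s \<le> fst z}"
    by (rule ramp_minimum[OF prob_\<mu> prob_\<nu>, where \<delta> = "s - left"])
      (use s min in \<open>auto intro!: integrable_\<mu>\<nu> continuous_intros simp: excess_def\<close>)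
  then show ?thesis
    using cap_comparison[OF s anti] by (simp add: excess_def)
qed

text \<open>Each ramp is Lipschitz with constant 1 in its threshold, hence so are both
  expectations.\<close>

lemma continuous_excess: "continuous_on UNIV excess"
proof -
  have two: "\<bar>a - b\<bar> \<le> d \<Longrightarrow> \<bar>c - e\<bar> \<le> d \<Longrightarrow> \<bar>(c - a) - (e - b)\<bar> \<le> 2 * d" for a b c d e :: real
    by linarith
  have lip: "dist (excess s) (excess t) \<le> 2 * dist s t" for s t
  proof -
    have diff: "\<bar>(\<integral>z. max 0 (fst z - s) \<partial>\<rho>) - (\<integral>z. max 0 (fst z - t) \<partial>\<rho>)\<bar> \<le> \<bar>s - t\<bar>"
      if \<rho>: "prob_space \<rho>" and int: "\<And>f :: real \<times> real \<Rightarrow> real. continuous_on UNIV f \<Longrightarrow> integrable \<rho> f" for \<rho>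
    proof -
      interpret \<rho>: prob_space \<rho> by fact
      have i: "integrable \<rho> (\<lambda>z. max 0 (fst z - u))" for u
        by (intro int continuous_intros)
      have "\<bar>(\<integral>z. max 0 (fst z - s) \<partial>\<rho>) - (\<integral>z. max 0 (fst z - t) \<partial>\<rho>)\<bar>
          = \<bar>\<integral>z. max 0 (fst z - s) - max 0 (fst z - t) \<partial>\<rho>\<bar>"
        using i by (subst Bochner_Integration.integral_diff) auto
      also have "\<dots> \<le> (\<integral>z. \<bar>max 0 (fst z - s) - max 0 (fst z - t)\<bar> \<partial>\<rho>)"
        by (rule integral_abs_bound)
      also have "\<dots> \<le> (\<integral>z. \<bar>s - t\<bar> \<partial>\<rho>)"
        using i by (intro integral_mono) (auto simp: max_def)
      finally show ?thesis
        by (simp add: \<rho>.prob_space)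
    qed
    have "\<bar>(\<integral>z. max 0 (fst z - s) \<partial>\<mu>) - (\<integral>z. max 0 (fst z - t) \<partial>\<mu>)\<bar> \<le> \<bar>s - t\<bar>"
      by (rule diff[OF prob_\<mu>]) (rule integrable_\<mu>\<nu>(1))
    moreover have "\<bar>(\<integral>z. max 0 (fst z - s) \<partial>\<nu>) - (\<integral>z. max 0 (fst z - t) \<partial>\<nu>)\<bar> \<le> \<bar>s - t\<bar>"
      by (rule diff[OF prob_\<nu>]) (rule integrable_\<mu>\<nu>(2))
    ultimately show ?thesis
      using two[of "\<integral>z. max 0 (fst z - s) \<partial>\<mu>"] unfolding excess_def dist_real_def by blast
  qed
  show ?thesis
    unfolding continuous_on_iff
  proof (intro ballI allI impI)
    fix x e :: real assume "0 < e"
    then show "\<exists>d>0. \<forall>y\<in>UNIV. dist y x < d \<longrightarrow> dist (excess y) (excess x) < e"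
      using lip by (intro exI[of _ "e / 2"]) (auto intro!: le_less_trans[OF lip])
  qed
qed

text \<open>For thresholds to the left of the body the ramp is affine on it and the means agree; for
  thresholds to the right it vanishes on it.\<close>

lemma excess_outside:
  assumes mean: "(\<integral>z. fst z \<partial>\<mu>) = (\<integral>z. fst z \<partial>\<nu>)" and s: "s \<le> left \<or> right \<le> s"
  shows "excess s = 0"
proof -
  have range: "left \<le> fst z \<and> fst z \<le> right" if "z \<in> K" for z
    using that mem_K[of "fst z" "snd z"] by simp
  have frK: "frontier K \<subseteq> K"
    by (auto simp: frontier_K)
  have i: "integrable \<mu> fst" "integrable \<nu> fst"
    by (auto intro!: integrable_\<mu>\<nu> continuous_intros)
  show ?thesis
  proof (cases "s \<le> left")
    case True
    have "(\<integral>z. max 0 (fst z - s) \<partial>\<mu>) = (\<integral>z. fst z - s \<partial>\<mu>)"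
      using AE_\<mu> range True by (intro integral_cong_AE) (auto intro!: borel_measurable_continuous_onI continuous_intros simp: measurable_cong_sets[OF sets_\<mu>\<nu>(1)], force)
    moreover have "(\<integral>z. max 0 (fst z - s) \<partial>\<nu>) = (\<integral>z. fst z - s \<partial>\<nu>)"
      using AE_\<nu> range True frK by (intro integral_cong_AE) (auto intro!: borel_measurable_continuous_onI continuous_intros simp: measurable_cong_sets[OF sets_\<mu>\<nu>(2)], force)
    moreover have "measure \<mu> UNIV = 1" "measure \<nu> UNIV = 1"
      using prob_space.prob_space[OF prob_\<mu>] prob_space.prob_space[OF prob_\<nu>] by simp_all
    ultimately show ?thesis
      using i mean prob_\<mu> prob_\<nu> by (simp add: excess_def Bochner_Integration.integral_diff prob_space.finite_measure finite_measure.integrable_const)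
  next
    case False
    then have "right \<le> s" using s by simp
    have "(\<integral>z. max 0 (fst z - s) \<partial>\<mu>) = (\<integral>z. 0 \<partial>\<mu>)"
      using AE_\<mu> range \<open>right \<le> s\<close> by (intro integral_cong_AE) (auto intro!: borel_measurable_continuous_onI continuous_intros simp: measurable_cong_sets[OF sets_\<mu>\<nu>(1)], force)
    moreover have "(\<integral>z. max 0 (fst z - s) \<partial>\<nu>) = (\<integral>z. 0 \<partial>\<nu>)"
      using AE_\<nu> range \<open>right \<le> s\<close> frK by (intro integral_cong_AE) (auto intro!: borel_measurable_continuous_onI continuous_intros simp: measurable_cong_sets[OF sets_\<mu>\<nu>(2)], force)
    ultimately show ?thesis
      by (simp add: excess_def)
  qed
qed

lemma len_quasiconcave:
  assumes "left \<le> u" "u \<le> v" "v \<le> w" "w \<le> right"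
  shows "min (len u) (len w) \<le> len v"
proof (cases "u = w")
  case False
  define t where "t = (v - u) / (w - u)"
  have t: "0 \<le> t" "t \<le> 1" "t * (w - u) = v - u"
    using assms False by (auto simp: t_def divide_le_eq)
  have "(1 - t) * min (len u) (len w) + t * min (len u) (len w) \<le> (1 - t) * len u + t * len w"
    using t by (intro add_mono mult_left_mono) auto
  also have "\<dots> \<le> len ((1 - t) * u + t * w)"
    using assms t by (intro len_concave) auto
  also have "(1 - t) * u + t * w = v"
    using t(3) by (simp add: algebra_simps)
  finally show ?thesis
    by (simp add: algebra_simps)
qed (use assms in auto)

text \<open>A failure on both sides would create a valley: a shorter chord between two longer ones,
  against quasiconcavity.\<close>

lemma len_unimodal:
  assumes "left < s" "s < right"
  shows "(\<forall>x y. s \<le> x \<longrightarrow> x \<le> y \<longrightarrow> y \<le> right \<longrightarrow> len y \<le> len x)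
    \<or> (\<forall>x y. left \<le> x \<longrightarrow> x \<le> y \<longrightarrow> y \<le> s \<longrightarrow> len x \<le> len y)"
proof (rule ccontr)
  assume "\<not> ?thesis"
  then obtain x y u v where xy: "s \<le> x" "x \<le> y" "y \<le> right" "len x < len y"
    and uv: "left \<le> u" "u \<le> v" "v \<le> s" "len v < len u"
    by (metis not_le)
  have "min (len u) (len y) \<le> len v" "min (len v) (len y) \<le> len x"
    using xy uv by (auto intro!: len_quasiconcave)
  then show False
    using xy uv by (auto simp: min_def split: if_splits)
qed

end

section \<open>Transport by isometries and the planar convex order\<close>

lemma uniform_hausdorff_T:
  fixes T :: "'a::euclidean_space \<Rightarrow> 'b::euclidean_space"
  assumes "linear_isometry T S" and H: "distr (hausdorff_measure k) borel T = hausdorff_measure k"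
    and F: "F \<in> sets borel"
  shows "distr (uniform_measure (hausdorff_measure k) F) borel T = uniform_measure (hausdorff_measure k) (T ` F)"
proof (rule measure_eqI)
  interpret linear_isometry T S by fact
  fix X assume "X \<in> sets (distr (uniform_measure (hausdorff_measure k) F) borel T)"
  then have X: "X \<in> sets borel" by simp
  have TX: "T -` X \<in> sets borel"
    using measurable_sets[OF measurable_T X] by simp
  have e: "emeasure (hausdorff_measure k) Y = emeasure (hausdorff_measure k) (T -` Y)" if "Y \<in> sets borel" for Y
    using that measurable_T by (subst H[symmetric], subst emeasure_distr) auto
  show "emeasure (distr (uniform_measure (hausdorff_measure k) F) borel T) X
      = emeasure (uniform_measure (hausdorff_measure k) (T ` F)) X"
    using X TX F image_T_borel[OF F] e[of "T ` F"] e[of "T ` F \<inter> X"] measurable_T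
    by (simp add: emeasure_distr emeasure_uniform_measure vimage_image_T)
qed simp

lemma planar_body_perimeter_T:
  fixes T :: "real \<times> real \<Rightarrow> real \<times> real"
  assumes "linear_isometry T S" "planar_body_perimeter K"
  shows "planar_body_perimeter (T ` K)"
    "distr (uniform_measure lborel K) borel T = uniform_measure lborel (T ` K)"
    "distr (uniform_measure (hausdorff_measure 1) (frontier K)) borel T
      = uniform_measure (hausdorff_measure 1) (frontier (T ` K))"
proof -
  interpret linear_isometry T S by fact
  interpret planar_body_perimeter K by fact
  have HT: "distr H borel T = H"
    by (rule hausdorff_measure_isometry[OF dist_T bij_T H_outer])
  show "distr (uniform_measure lborel K) borel T = uniform_measure lborel (T ` K)"
    by (rule uniform_lborel_T[OF body])
  show "distr (uniform_measure H (frontier K)) borel T = uniform_measure H (frontier (T ` K))"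
    unfolding frontier_T by (rule uniform_hausdorff_T[OF assms(1) HT]) simp
  have "emeasure H (frontier (T ` K)) = emeasure H (frontier K)"
    by (subst HT[symmetric]) (simp add: emeasure_distr frontier_T image_T_borel vimage_image_T)
  then show "planar_body_perimeter (T ` K)"
    using convex_body_T[OF body] H_outer H_finite
    by unfold_locales (auto simp: convex_body_def)
qed

context planar_body_perimeter
begin

text \<open>A negative minimum would lie strictly inside the range, and from it the chords decrease
  towards one of the two ends. If this is the left end, the body is reflected in the vertical
  axis.\<close>

lemma excess_nonneg:
  assumes mean: "(\<integral>z. fst z \<partial>\<mu>) = (\<integral>z. fst z \<partial>\<nu>)"
  shows "0 \<le> excess s"
proof (rule ccontr)
  assume neg: "\<not> 0 \<le> excess s"
  then have s: "s \<in> {left..right}"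
    using excess_outside[OF mean, of s] by (cases "s \<le> left \<or> right \<le> s") auto
  obtain m where m: "m \<in> {left..right}" "\<And>t. t \<in> {left..right} \<Longrightarrow> excess m \<le> excess t"
    using continuous_attains_inf[of "{left..right}" excess] continuous_on_subset[OF continuous_excess] left_less_right
    by (metis atLeastatMost_empty_iff2 compact_Icc less_imp_le not_le subset_UNIV)
  have neg': "excess m < 0"
    using m(2)[OF s] neg by simp
  then have lr: "left < m" "m < right"
    using excess_outside[OF mean, of m] by (cases "m \<le> left \<or> right \<le> m"; auto)+
  consider (right) "\<And>x y. m \<le> x \<Longrightarrow> x \<le> y \<Longrightarrow> y \<le> right \<Longrightarrow> len y \<le> len x"
    | (left) "\<And>x y. left \<le> x \<Longrightarrow> x \<le> y \<Longrightarrow> y \<le> m \<Longrightarrow> len x \<le> len y"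
    using len_unimodal[OF lr] by blast
  then show False
  proof cases
    case right
    then show False
      using excess_nonneg_at_minimum[OF lr right m(2)] neg' by simp
  next
    case left
    define R :: "real \<times> real \<Rightarrow> real \<times> real" where "R z = (- fst z, snd z)" for z
    have R: "linear_isometry R R"
      by unfold_locales (auto simp: R_def linear_iff norm_prod_def)
    interpret R: linear_isometry R R by fact
    note pbR = planar_body_perimeter_T[OF R planar_body_perimeter_axioms]
    interpret r: planar_body_perimeter "R ` K" by (rule pbR(1))
    have mem: "(t, y) \<in> R ` K \<longleftrightarrow> (- t, y) \<in> K" for t y
      unfolding R.image_T by (simp add: R_def)
    have len: "r.len t = len (- t)" for t
      unfolding r.len_def len_def r.up_def up_def r.lo_def lo_def mem ..
    have "fst ` R ` K = uminus ` fst ` K"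
      by (auto simp: R_def image_image)
    then have "{r.left..r.right} = {- right..- left}"
      unfolding r.fst_image fst_image by simp
    then have ends: "r.left = - right" "r.right = - left"
      using left_less_right r.left_less_right by (auto simp: Icc_eq_Icc)
    \<comment> \<open>Equal means make the excess invariant under the reflection:
      \<open>max 0 (x + t)\<close> and \<open>max 0 (- x - t)\<close> differ by the affine function
      \<open>x + t\<close>.\<close>
    have ex: "r.excess t = excess (- t)" for t
    proof -
      have part: "(\<integral>z. max 0 (fst z - t) \<partial>distr \<rho> borel R) = (\<integral>z. max 0 (fst z - - t) \<partial>\<rho>) - (\<integral>z. fst z \<partial>\<rho>) - t"
        if \<rho>: "prob_space \<rho>" "sets \<rho> = sets borel" and int: "integrable \<rho> fst" "integrable \<rho> (\<lambda>z. max 0 (fst z - - t))" for \<rho>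
      proof -
        interpret \<rho>: prob_space \<rho> by fact
        have "R \<in> measurable \<rho> borel"
          using R.measurable_T measurable_cong_sets[OF \<rho>(2) refl] by blast
        then have "(\<integral>z. max 0 (fst z - t) \<partial>distr \<rho> borel R) = (\<integral>z. max 0 (fst (R z) - t) \<partial>\<rho>)"
          by (rule integral_distr) (intro borel_measurable_continuous_onI continuous_intros)
        also have "\<dots> = (\<integral>z. max 0 (fst z - - t) - fst z - t \<partial>\<rho>)"
          by (intro Bochner_Integration.integral_cong) (auto simp: R_def max_def)
        also have "\<dots> = (\<integral>z. max 0 (fst z - - t) \<partial>\<rho>) - (\<integral>z. fst z \<partial>\<rho>) - t"
          using int by (simp add: Bochner_Integration.integral_diff \<rho>.prob_space)
        finally show ?thesis .
      qed
      have "(\<integral>z. max 0 (fst z - t) \<partial>distr \<mu> borel R) = (\<integral>z. max 0 (fst z - - t) \<partial>\<mu>) - (\<integral>z. fst z \<partial>\<mu>) - t"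
        by (rule part[OF prob_\<mu>]) (auto intro!: integrable_\<mu>\<nu> continuous_intros)
      moreover have "(\<integral>z. max 0 (fst z - t) \<partial>distr \<nu> borel R) = (\<integral>z. max 0 (fst z - - t) \<partial>\<nu>) - (\<integral>z. fst z \<partial>\<nu>) - t"
        by (rule part[OF prob_\<nu>]) (auto intro!: integrable_\<mu>\<nu> continuous_intros)
      ultimately show ?thesis
        unfolding r.excess_def excess_def pbR(2,3)[symmetric] using mean by simp
    qed
    have "0 \<le> r.excess (- m)"
    proof (rule r.excess_nonneg_at_minimum)
      show "r.left < - m" "- m < r.right"
        using lr ends by auto
      show "r.len y \<le> r.len x" if "- m \<le> x" "x \<le> y" "y \<le> r.right" for x y
        unfolding len using that ends by (intro left) auto
      show "r.excess (- m) \<le> r.excess t" if "t \<in> {r.left..r.right}" for t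
        unfolding ex using that ends by (simp add: m(2))
    qed
    then show False
      using neg' by (simp add: ex)
  qed
qed

end

text \<open>A rotation turns an arbitrary ramp into a positive multiple of a ramp in the first
  coordinate, where \<open>excess_nonneg\<close> for the rotated body applies.\<close>

lemma (in planar_body_perimeter) convex_order:
  assumes mean: "\<And>u. (\<integral>z. u \<bullet> z \<partial>\<mu>) = (\<integral>z. u \<bullet> z \<partial>\<nu>)" and f: "convex_on UNIV f"
  shows "(\<integral>z. f z \<partial>\<mu>) \<le> (\<integral>z. f z \<partial>\<nu>)"
proof -
  have ridge: "(\<integral>z. max 0 (aff a z) \<partial>\<mu>) \<le> (\<integral>z. max 0 (aff a z) \<partial>\<nu>)" for a
  proof (cases "fst a = 0")
    case True
    have "measure \<mu> UNIV = 1" "measure \<nu> UNIV = 1"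
      using prob_space.prob_space[OF prob_\<mu>] prob_space.prob_space[OF prob_\<nu>] by simp_all
    then show ?thesis
      using True prob_\<mu> prob_\<nu> by (simp add: aff_def)
  next
    case False
    define w where "w = fst a"
    define \<rho> where "\<rho> = norm w"
    define u where "u = (1 / \<rho>) *\<^sub>R w"
    have \<rho>: "\<rho> > 0" and w: "w = \<rho> *\<^sub>R u" and u1: "norm u = 1"
      using False by (auto simp: \<rho>_def u_def w_def)
    have uu: "fst u * fst u + snd u * snd u = 1"
      using u1 by (simp add: norm_prod_def power2_eq_square)
    \<comment> \<open>The rotation that carries \<open>u\<close> to the first unit vector;
      \<open>S\<close> is the inverse rotation.\<close>
    define T :: "real \<times> real \<Rightarrow> real \<times> real"
      where "T z = (fst u * fst z + snd u * snd z, fst u * snd z - snd u * fst z)" for z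
    define S :: "real \<times> real \<Rightarrow> real \<times> real"
      where "S z = (fst u * fst z - snd u * snd z, snd u * fst z + fst u * snd z)" for z
    have T: "linear_isometry T S"
    proof (rule linear_isometry.intro)
      show "linear T"
        by (auto simp: linear_iff T_def algebra_simps)
    next
      fix x :: "real \<times> real"
      have "(fst u * fst x + snd u * snd x)\<^sup>2 + (fst u * snd x - snd u * fst x)\<^sup>2
          = (fst u * fst u + snd u * snd u) * ((fst x)\<^sup>2 + (snd x)\<^sup>2)"
        by (simp add: power2_eq_square algebra_simps)
      then show "norm (T x) = norm x"
        by (simp add: T_def norm_prod_def uu)
    next
      fix y :: "real \<times> real"
      have "fst u * (fst u * fst y - snd u * snd y) + snd u * (snd u * fst y + fst u * snd y)
          = (fst u * fst u + snd u * snd u) * fst y"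
        "fst u * (snd u * fst y + fst u * snd y) - snd u * (fst u * fst y - snd u * snd y)
          = (fst u * fst u + snd u * snd u) * snd y"
        by (simp_all add: algebra_simps)
      then show "T (S y) = y"
        by (simp add: T_def S_def uu)
    qed
    interpret T: linear_isometry T S by fact
    note pb = planar_body_perimeter_T[OF T planar_body_perimeter_axioms]
    interpret t: planar_body_perimeter "T ` K" by (rule pb(1))
    have T1: "fst (T z) = u \<bullet> z" for z
      by (simp add: T_def inner_prod_def)
    have push: "(\<integral>z. g (fst z) \<partial>distr \<mu> borel T) = (\<integral>z. g (u \<bullet> z) \<partial>\<mu>)"
        "(\<integral>z. g (fst z) \<partial>distr \<nu> borel T) = (\<integral>z. g (u \<bullet> z) \<partial>\<nu>)"
      if "continuous_on UNIV g" for g :: "real \<Rightarrow> real"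
    proof -
      have "(\<lambda>z :: real \<times> real. g (fst z)) \<in> borel_measurable borel"
        by (intro borel_measurable_continuous_onI continuous_on_compose2[OF that] continuous_intros) auto
      moreover have "T \<in> measurable \<mu> borel" "T \<in> measurable \<nu> borel"
        using T.measurable_T measurable_cong_sets[OF sets_\<mu>\<nu>(1) refl] measurable_cong_sets[OF sets_\<mu>\<nu>(2) refl]
        by blast+
      ultimately show "(\<integral>z. g (fst z) \<partial>distr \<mu> borel T) = (\<integral>z. g (u \<bullet> z) \<partial>\<mu>)"
        "(\<integral>z. g (fst z) \<partial>distr \<nu> borel T) = (\<integral>z. g (u \<bullet> z) \<partial>\<nu>)"
        by (simp_all add: integral_distr T1)
    qed
    have "(\<integral>z. fst z \<partial>t.\<mu>) = (\<integral>z. fst z \<partial>t.\<nu>)"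
      unfolding pb(2,3)[symmetric] using push[of "\<lambda>x. x"] mean[of u] by (simp add: continuous_on_id)
    from t.excess_nonneg[OF this, of "- snd a / \<rho>"]
    have "(\<integral>z. max 0 (u \<bullet> z - - snd a / \<rho>) \<partial>\<mu>) \<le> (\<integral>z. max 0 (u \<bullet> z - - snd a / \<rho>) \<partial>\<nu>)"
      unfolding t.excess_def pb(2,3)[symmetric]
      using push[of "\<lambda>x. max 0 (x - - snd a / \<rho>)"] by (simp add: continuous_intros)
    moreover have "max 0 (aff a z) = \<rho> * max 0 (u \<bullet> z - - snd a / \<rho>)" for z
    proof -
      have "aff a z = \<rho> * (u \<bullet> z - - snd a / \<rho>)"
        using \<rho> w by (simp add: aff_def w_def[symmetric] algebra_simps)
      then show ?thesis
        using \<rho> by (simp add: max_mult_distrib_left)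
    qed
    ultimately show ?thesis
      using \<rho> by simp
  qed
  show ?thesis
    by (rule ridge_order_imp_convex_order[OF compact_K convex_K interior_K prob_\<mu> sets_\<mu>\<nu>(1) AE_\<mu>
          prob_\<nu> sets_\<mu>\<nu>(2) AE_\<nu> mean ridge f])
qed

text \<open>An orthonormal basis identifies the space isometrically with
  \<open>real \<times> real\<close>; the uniform laws, the equality of means and convexity are
  carried over.\<close>

lemma planar_convex_order:
  fixes K :: "'a::euclidean_space set"
  assumes dim: "DIM('a) = 2" and K: "convex_body K"
    and H: "\<And>A. A \<in> sets borel \<Longrightarrow> emeasure (hausdorff_measure 1 :: 'a measure) A = hausdorff_outer 1 A"
      "emeasure (hausdorff_measure 1) (frontier K) \<noteq> \<infinity>"
    and mean: "\<And>u. (\<integral>x. u \<bullet> x \<partial>uniform_measure lborel K)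
       = (\<integral>x. u \<bullet> x \<partial>uniform_measure (hausdorff_measure 1) (frontier K))"
    and f: "convex_on UNIV f"
  shows "(\<integral>x. f x \<partial>uniform_measure lborel K) \<le> (\<integral>x. f x \<partial>uniform_measure (hausdorff_measure 1) (frontier K))"
proof -
  obtain b c where bc: "Basis = {b, c :: 'a}" "b \<noteq> c"
    using dim by (auto simp: card_2_iff)
  have "b \<in> Basis" "c \<in> Basis"
    unfolding bc(1) by simp_all
  then have inner [simp]: "b \<bullet> b = 1" "c \<bullet> c = 1" "b \<bullet> c = 0" "c \<bullet> b = 0"
    using bc(2) by (auto simp: inner_Basis)
  define T :: "'a \<Rightarrow> real \<times> real" where "T x = (x \<bullet> b, x \<bullet> c)" for x
  define S :: "real \<times> real \<Rightarrow> 'a" where "S z = fst z *\<^sub>R b + snd z *\<^sub>R c" for z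
  have rep: "x = (x \<bullet> b) *\<^sub>R b + (x \<bullet> c) *\<^sub>R c" for x
  proof -
    have "x = (\<Sum>i\<in>{b, c}. (x \<bullet> i) *\<^sub>R i)"
      using euclidean_representation[of x] unfolding bc(1) by simp
    then show ?thesis
      using bc(2) by simp
  qed
  have T: "linear_isometry T S"
  proof (rule linear_isometry.intro)
    show "linear T"
      by (auto simp: linear_iff T_def algebra_simps)
    show "norm (T x) = norm x" for x
    proof -
      have "x \<bullet> x = (x \<bullet> b)\<^sup>2 + (x \<bullet> c)\<^sup>2"
        using euclidean_inner[of x x] bc(2) unfolding bc(1) by (simp add: power2_eq_square)
      then show ?thesis
        by (simp add: T_def norm_prod_def norm_eq_sqrt_inner)
    qed
    show "T (S z) = z" for z
      by (simp add: T_def S_def algebra_simps)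
  qed
  interpret T: linear_isometry T S by fact
  have HT: "distr (hausdorff_measure 1) borel T = hausdorff_measure 1"
    by (rule hausdorff_measure_isometry[OF T.dist_T T.bij_T H(1)])
  let ?\<mu> = "uniform_measure lborel K" and ?\<nu> = "uniform_measure (hausdorff_measure 1) (frontier K)"
  have \<mu>: "distr ?\<mu> borel T = uniform_measure lborel (T ` K)"
    by (rule T.uniform_lborel_T[OF K])
  have \<nu>: "distr ?\<nu> borel T = uniform_measure (hausdorff_measure 1) (frontier (T ` K))"
    unfolding T.frontier_T by (rule uniform_hausdorff_T[OF T HT]) simp
  interpret p: planar_body_perimeter "T ` K"
  proof
    show "compact (T ` K)" "convex (T ` K)" "interior (T ` K) \<noteq> {}"
      using T.convex_body_T[OF K] by (auto simp: convex_body_def)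
    fix A :: "(real \<times> real) set" assume A: "A \<in> sets borel"
    have "emeasure (hausdorff_measure 1) A = emeasure (hausdorff_measure 1) (T -` A)"
      using A by (subst HT[symmetric]) (simp add: emeasure_distr)
    also have "\<dots> = hausdorff_outer 1 (T -` A)"
      using measurable_sets[OF T.measurable_T A] by (intro H) simp
    also have "\<dots> = hausdorff_outer 1 (T ` (T -` A))"
      by (rule hausdorff_outer_isometry_image[OF T.dist_T T.bij_T, symmetric])
    also have "T ` (T -` A) = A"
      by (rule surj_image_vimage_eq[OF bij_is_surj[OF T.bij_T]])
    finally show "emeasure (hausdorff_measure 1) A = hausdorff_outer 1 A" .
  next
    show "emeasure (hausdorff_measure 1) (frontier (T ` K)) \<noteq> \<infinity>"
      using H(2) by (subst HT[symmetric]) (simp add: emeasure_distr T.frontier_T T.image_T_borel T.vimage_image_T)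
  qed
  have push: "(\<integral>z. g z \<partial>p.\<mu>) = (\<integral>x. g (T x) \<partial>?\<mu>)" "(\<integral>z. g z \<partial>p.\<nu>) = (\<integral>x. g (T x) \<partial>?\<nu>)"
    if "continuous_on UNIV g" for g :: "real \<times> real \<Rightarrow> real"
    unfolding \<mu>[symmetric] \<nu>[symmetric]
    using borel_measurable_continuous_onI[OF that] by (auto intro!: integral_distr)
  have fS: "convex_on UNIV (\<lambda>z. f (S z))"
  proof (intro convex_onI)
    fix t :: real and x y assume "0 < t" "t < 1"
    then show "f (S ((1 - t) *\<^sub>R x + t *\<^sub>R y)) \<le> (1 - t) * f (S x) + t * f (S y)"
      using convex_onD[OF f, of t "S x" "S y"]
      by (simp add: linear_add[OF T.linear_S] linear_scale[OF T.linear_S])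
  qed simp
  have cont: "continuous_on UNIV (\<lambda>z. f (S z))"
    using convex_on_continuous[OF open_UNIV fS] .
  have "(\<integral>z. f (S z) \<partial>p.\<mu>) \<le> (\<integral>z. f (S z) \<partial>p.\<nu>)"
  proof (rule p.convex_order[OF _ fS])
    fix u :: "real \<times> real"
    have c: "continuous_on UNIV (\<lambda>z. u \<bullet> z)"
      by (intro continuous_intros)
    have "u \<bullet> T x = S u \<bullet> x" for x
      using T.inner_T[of x u] by (simp add: inner_commute)
    then show "(\<integral>z. u \<bullet> z \<partial>p.\<mu>) = (\<integral>z. u \<bullet> z \<partial>p.\<nu>)"
      unfolding push[OF c] using mean[of "S u"] by simp
  qed
  then show ?thesis
    unfolding push[OF cont] by (simp add: T.ST)
qed

declare One_nat_def [simp]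

section \<open>Independent points\<close>

lemma (in finite_measure) integrable_bounded_on:
  fixes g :: "'a \<Rightarrow> real"
  assumes "g \<in> borel_measurable M" "AE x in M. \<bar>g x\<bar> \<le> b"
  shows "integrable M g"
  using assms by (intro integrable_const_bound[of _ b]) auto

text \<open>For fixed other coordinates the integrand is convex in the coordinate \<open>j\<close>,
  so its law can be exchanged. The partial integral over \<open>\<nu>\<close> is again nonnegative,
  bounded on bounded sets and convex in each remaining coordinate, so the induction hypothesis
  applies to it. The bounds provide the integrability.\<close>

lemma product_convex_order:
  fixes \<mu> \<nu> :: "'a::euclidean_space measure" and G :: "('i \<Rightarrow> 'a) \<Rightarrow> real"
  assumes \<mu>: "prob_space \<mu>" "sets \<mu> = sets borel" "AE x in \<mu>. norm x \<le> R"
    and \<nu>: "prob_space \<nu>" "sets \<nu> = sets borel" "AE x in \<nu>. norm x \<le> R"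
    and order: "\<And>f. convex_on UNIV f \<Longrightarrow> (\<integral>x. f x \<partial>\<mu>) \<le> (\<integral>x. f x \<partial>\<nu>)"
    and J: "finite J"
    and meas: "G \<in> borel_measurable (PiM J (\<lambda>_. borel))"
    and nn: "\<And>x. 0 \<le> G x"
    and conv: "\<And>x i. x \<in> space (PiM J (\<lambda>_. borel :: 'a measure)) \<Longrightarrow> i \<in> J \<Longrightarrow> convex_on UNIV (\<lambda>v. G (x(i := v)))"
    and bd: "\<And>r. \<exists>\<beta>. \<forall>x \<in> space (PiM J (\<lambda>_. borel :: 'a measure)). (\<forall>i\<in>J. norm (x i) \<le> r) \<longrightarrow> G x \<le> \<beta>"
  shows "(\<integral>\<^sup>+x. ennreal (G x) \<partial>PiM J (\<lambda>_. \<mu>)) \<le> (\<integral>\<^sup>+x. ennreal (G x) \<partial>PiM J (\<lambda>_. \<nu>))"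
  using J meas nn conv bd
proof (induction J arbitrary: G rule: finite_induct)
  case empty
  show ?case by (simp add: PiM_empty)
next
  case (insert j J)
  interpret \<mu>: prob_space \<mu> by fact
  interpret \<nu>: prob_space \<nu> by fact
  interpret p\<mu>: product_sigma_finite "\<lambda>_. \<mu>" by unfold_locales
  interpret p\<nu>: product_sigma_finite "\<lambda>_. \<nu>" by unfold_locales
  note [measurable_cong] = \<mu>(2) \<nu>(2)
  have sp\<mu>: "space \<mu> = UNIV" and sp\<nu>: "space \<nu> = UNIV"
    using sets_eq_imp_space_eq[OF \<mu>(2)] sets_eq_imp_space_eq[OF \<nu>(2)] by auto
  let ?P = "\<lambda>J. PiM J (\<lambda>_. borel :: 'a measure)"
  have sets\<mu>: "sets (PiM I (\<lambda>_. \<mu>)) = sets (?P I)" and sets\<nu>: "sets (PiM I (\<lambda>_. \<nu>)) = sets (?P I)" for I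
    by (rule sets_PiM_cong; simp add: \<mu>(2) \<nu>(2))+
  have space\<mu>: "space (PiM I (\<lambda>_. \<mu>)) = space (?P I)" and space\<nu>: "space (PiM I (\<lambda>_. \<nu>)) = space (?P I)" for I
    by (rule sets_eq_imp_space_eq[OF sets\<mu>], rule sets_eq_imp_space_eq[OF sets\<nu>])
  have G: "G \<in> borel_measurable (?P (insert j J))" by fact
  have G\<mu>: "(\<lambda>x. ennreal (G x)) \<in> borel_measurable (PiM (insert j J) (\<lambda>_. \<mu>))"
    using G by (subst measurable_cong_sets[OF sets\<mu> refl]) measurable
  have G\<nu>: "(\<lambda>x. ennreal (G x)) \<in> borel_measurable (PiM (insert j J) (\<lambda>_. \<nu>))"
    using G by (subst measurable_cong_sets[OF sets\<nu> refl]) measurable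
  have upd: "(\<lambda>(x, y). G (x(j := y))) \<in> borel_measurable (?P J \<Otimes>\<^sub>M borel)"
  proof -
    have "(\<lambda>(x, y). x(j := y)) \<in> measurable (?P J \<Otimes>\<^sub>M borel) (?P (insert j J))"
      by (rule measurable_add_dim)
    from measurable_compose[OF this G] show ?thesis
      by (simp add: split_beta')
  qed
  have ext: "x(j := y) \<in> space (?P (insert j J))" if "x \<in> space (?P J)" for x y
    using that by (auto simp: space_PiM PiE_def extensional_def)
  obtain \<beta> where \<beta>: "\<And>r x. x \<in> space (?P (insert j J)) \<Longrightarrow> (\<And>i. i \<in> insert j J \<Longrightarrow> norm (x i) \<le> r) \<Longrightarrow> G x \<le> \<beta> r"
    using insert.prems(4) by metis
  have bdx: "G (x(j := y)) \<le> \<beta> (max r R)" if "x \<in> space (?P J)" "\<forall>i\<in>J. norm (x i) \<le> r" "norm y \<le> R" for x y r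
    using that by (intro \<beta> ext) (auto simp: le_max_iff_disj)
  have rmax: "\<exists>r. \<forall>i\<in>J. norm (x i) \<le> r" for x :: "'i \<Rightarrow> 'a"
    using insert.hyps(1) by (intro exI[of _ "Max ((\<lambda>i. norm (x i)) ` J)"]) auto
  have sec: "(\<lambda>y. G (x(j := y))) \<in> borel_measurable borel" if "x \<in> space (?P J)" for x
    using measurable_compose[OF measurable_Pair1'[OF that] upd] by simp
  have int\<mu>: "integrable \<mu> (\<lambda>y. G (x(j := y)))" and int\<nu>: "integrable \<nu> (\<lambda>y. G (x(j := y)))"
    if x: "x \<in> space (?P J)" for x
  proof -
    obtain r where r: "\<forall>i\<in>J. norm (x i) \<le> r" using rmax by blast
    have "AE y in \<mu>. \<bar>G (x(j := y))\<bar> \<le> \<beta> (max r R)"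
      using \<mu>(3) by eventually_elim (use bdx[OF x r] insert.prems(2) in auto)
    moreover have "AE y in \<nu>. \<bar>G (x(j := y))\<bar> \<le> \<beta> (max r R)"
      using \<nu>(3) by eventually_elim (use bdx[OF x r] insert.prems(2) in auto)
    ultimately show "integrable \<mu> (\<lambda>y. G (x(j := y)))" "integrable \<nu> (\<lambda>y. G (x(j := y)))"
      using sec[OF x] by (auto intro!: \<mu>.integrable_bounded_on \<nu>.integrable_bounded_on)
  qed
  \<comment> \<open>The average after the coordinate \<open>j\<close> has been given the law
    \<open>\<nu>\<close>.\<close>
  define H where "H x = (\<integral>y. G (x(j := y)) \<partial>\<nu>)" for x
  have "(\<integral>\<^sup>+x. ennreal (G x) \<partial>PiM (insert j J) (\<lambda>_. \<mu>))
      = (\<integral>\<^sup>+x. (\<integral>\<^sup>+y. ennreal (G (x(j := y))) \<partial>\<mu>) \<partial>PiM J (\<lambda>_. \<mu>))"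
    by (rule p\<mu>.product_nn_integral_insert[OF insert.hyps(1,2) G\<mu>])
  also have "\<dots> \<le> (\<integral>\<^sup>+x. ennreal (H x) \<partial>PiM J (\<lambda>_. \<mu>))"
  proof (rule nn_integral_mono)
    fix x assume "x \<in> space (PiM J (\<lambda>_. \<mu>))"
    then have x: "x \<in> space (?P J)" unfolding space\<mu> .
    \<comment> \<open>The point \<open>x\<close> is defined on \<open>J\<close> only; the value 0 at
      \<open>j\<close> is a placeholder that puts it into the larger product.\<close>
    have "convex_on UNIV (\<lambda>v. G ((x(j := 0))(j := v)))"
      by (rule insert.prems(3)[OF ext[OF x]]) simp
    then have "(\<integral>y. G (x(j := y)) \<partial>\<mu>) \<le> H x"
      unfolding H_def by (intro order) simp
    moreover have "(\<integral>\<^sup>+y. ennreal (G (x(j := y))) \<partial>\<mu>) = ennreal (\<integral>y. G (x(j := y)) \<partial>\<mu>)"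
      using int\<mu>[OF x] insert.prems(2) by (intro nn_integral_eq_integral) auto
    ultimately show "(\<integral>\<^sup>+y. ennreal (G (x(j := y))) \<partial>\<mu>) \<le> ennreal (H x)"
      by (simp add: ennreal_leI)
  qed
  also have "\<dots> \<le> (\<integral>\<^sup>+x. ennreal (H x) \<partial>PiM J (\<lambda>_. \<nu>))"
  proof (rule insert.IH)
    have "(\<lambda>(x, y). G (x(j := y))) \<in> borel_measurable (?P J \<Otimes>\<^sub>M \<nu>)"
      using upd by (subst measurable_cong_sets[OF sets_pair_measure_cong[OF refl \<nu>(2)] refl])
    then show "H \<in> borel_measurable (?P J)"
      unfolding H_def by (rule \<nu>.borel_measurable_lebesgue_integral)
    show "0 \<le> H x" for x
      unfolding H_def using insert.prems(2) by (intro integral_nonneg_AE) auto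
    show "convex_on UNIV (\<lambda>v. H (x(i := v)))" if x: "x \<in> space (?P J)" and i: "i \<in> J" for x i
    proof (intro convex_onI)
      fix t :: real and u v :: 'a assume t: "0 < t" "t < 1"
      let ?w = "(1 - t) *\<^sub>R u + t *\<^sub>R v"
      have xi: "x(i := z) \<in> space (?P J)" for z
        using x i by (auto simp: space_PiM PiE_def extensional_def)
      have ij: "i \<noteq> j"
        using i insert.hyps(2) by auto
      have le: "G ((x(i := ?w))(j := y)) \<le> (1 - t) * G ((x(i := u))(j := y)) + t * G ((x(i := v))(j := y))" for y
      proof -
        have "convex_on UNIV (\<lambda>v. G ((x(j := y))(i := v)))"
          by (rule insert.prems(3)[OF ext[OF x]]) (use i in simp)
        from convex_onD[OF this, of t u v] show ?thesis
          using t ij by (simp add: fun_upd_twist)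
      qed
      note ints = int\<nu>[OF xi]
      have "H (x(i := ?w)) \<le> (\<integral>y. (1 - t) * G ((x(i := u))(j := y)) + t * G ((x(i := v))(j := y)) \<partial>\<nu>)"
        unfolding H_def by (intro integral_mono le ints Bochner_Integration.integrable_add integrable_mult_right)
      also have "\<dots> = (1 - t) * H (x(i := u)) + t * H (x(i := v))"
        unfolding H_def using ints
        by (subst Bochner_Integration.integral_add) (auto intro!: integrable_mult_right)
      finally show "H (x(i := ?w)) \<le> (1 - t) * H (x(i := u)) + t * H (x(i := v))" .
    qed simp
    show "\<exists>\<beta>. \<forall>x\<in>space (?P J). (\<forall>i\<in>J. norm (x i) \<le> r) \<longrightarrow> H x \<le> \<beta>" for r
    proof (intro exI[of _ "\<beta> (max r R)"] ballI impI)
      fix x assume x: "x \<in> space (?P J)" "\<forall>i\<in>J. norm (x i) \<le> r"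
      have "AE y in \<nu>. G (x(j := y)) \<le> \<beta> (max r R)"
        using \<nu>(3) by eventually_elim (use bdx[OF x] in auto)
      then show "H x \<le> \<beta> (max r R)"
        unfolding H_def using int\<nu>[OF x(1)] by (intro \<nu>.integral_le_const)
    qed
  qed
  also have "\<dots> = (\<integral>\<^sup>+x. (\<integral>\<^sup>+y. ennreal (G (x(j := y))) \<partial>\<nu>) \<partial>PiM J (\<lambda>_. \<nu>))"
  proof (rule nn_integral_cong)
    fix x assume "x \<in> space (PiM J (\<lambda>_. \<nu>))"
    then have x: "x \<in> space (?P J)" unfolding space\<nu> .
    show "ennreal (H x) = (\<integral>\<^sup>+y. ennreal (G (x(j := y))) \<partial>\<nu>)"
      unfolding H_def using int\<nu>[OF x] insert.prems(2) by (intro nn_integral_eq_integral[symmetric]) auto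
  qed
  also have "\<dots> = (\<integral>\<^sup>+x. ennreal (G x) \<partial>PiM (insert j J) (\<lambda>_. \<nu>))"
    by (rule p\<nu>.product_nn_integral_insert[OF insert.hyps(1,2) G\<nu>, symmetric])
  finally show ?case .
qed

section \<open>Measurability and size of the volume of the hull\<close>

text \<open>For finite \<open>S\<close> the directions that strictly separate \<open>y\<close> from
  \<open>S\<close> form an open set, so a dense set of directions detects separation. With a
  countable \<open>D\<close>, membership in the hull becomes a countable family of measurable
  conditions.\<close>

lemma mem_convex_hull_iff_dense:
  fixes S D :: "'a::euclidean_space set"
  assumes S: "finite S" "S \<noteq> {}" and D: "closure D = UNIV"
  shows "y \<in> convex hull S \<longleftrightarrow> (\<forall>d\<in>D. d \<bullet> y \<le> Max ((\<bullet>) d ` S))"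
proof
  assume y: "y \<in> convex hull S"
  show "\<forall>d\<in>D. d \<bullet> y \<le> Max ((\<bullet>) d ` S)"
  proof
    fix d
    have "convex hull S \<subseteq> {z. d \<bullet> z \<le> Max ((\<bullet>) d ` S)}"
      using S by (intro hull_minimal convex_halfspace_le) auto
    then show "d \<bullet> y \<le> Max ((\<bullet>) d ` S)"
      using y by blast
  qed
next
  assume le: "\<forall>d\<in>D. d \<bullet> y \<le> Max ((\<bullet>) d ` S)"
  show "y \<in> convex hull S"
  proof (rule ccontr)
    assume "y \<notin> convex hull S"
    moreover have "closed (convex hull S)"
      using S by (simp add: finite_imp_compact_convex_hull compact_imp_closed)
    ultimately obtain a b where ab: "a \<bullet> y < b" "\<And>x. x \<in> convex hull S \<Longrightarrow> a \<bullet> x > b"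
      using separating_hyperplane_closed_point[OF convex_convex_hull, of S y] by blast
    define U where "U = (\<Inter>x\<in>S. {d. d \<bullet> x < d \<bullet> y})"
    have "open U"
      unfolding U_def using S by (intro open_INT ballI open_Collect_less continuous_intros) auto
    moreover have "- a \<in> U"
      unfolding U_def using ab hull_inc[of _ S convex] by (fastforce simp: less_trans)
    ultimately obtain d where d: "d \<in> D" "d \<in> U"
      using D open_Int_closure_eq_empty[of U D] by blast
    then have "Max ((\<bullet>) d ` S) < d \<bullet> y"
      using S unfolding U_def by (subst Max_less_iff) auto
    then show False
      using le d(1) by force
  qed
qed

text \<open>The pairs of a configuration and a point of its hull form a measurable set, and the
  volume of the hull is the measure of a section of this set.\<close>

lemma measurable_measure_hull:
  assumes J: "finite J" "J \<noteq> {}"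
  shows "(\<lambda>x. measure lborel (convex hull (x ` J))) \<in> borel_measurable (PiM J (\<lambda>_. borel :: 'a::euclidean_space measure))"
proof -
  let ?P = "PiM J (\<lambda>_. borel :: 'a measure)"
  obtain D :: "'a set" where D: "countable D" "closure D = UNIV"
    using separable[of "UNIV :: 'a set"] by (metis subset_UNIV top.extremum_uniqueI)
  let ?Q = "{z \<in> space (?P \<Otimes>\<^sub>M borel). \<forall>d\<in>D. d \<bullet> snd z \<le> Max ((\<lambda>i. d \<bullet> fst z i) ` J)}"
  have "?Q \<in> sets (?P \<Otimes>\<^sub>M borel)"
    using D(1) J by measurable
  then have Q: "?Q \<in> sets (?P \<Otimes>\<^sub>M lborel)"
    by (simp cong: sets_pair_measure_cong)
  have "Pair x -` ?Q = convex hull (x ` J)" if "x \<in> space ?P" for x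
    using that J mem_convex_hull_iff_dense[OF _ _ D(2), of "x ` J"]
    by (auto simp: space_pair_measure image_image)
  then have "(\<lambda>x. emeasure lborel (convex hull (x ` J))) \<in> borel_measurable ?P"
    using lborel.measurable_emeasure_Pair[OF Q] by (simp cong: measurable_cong)
  then show ?thesis
    unfolding measure_def by measurable
qed

lemma measure_hull_le:
  fixes S :: "'a::euclidean_space set"
  assumes "finite S" "\<And>x. x \<in> S \<Longrightarrow> norm x \<le> r"
  shows "measure lborel (convex hull S) \<le> measure lborel (cball 0 r :: 'a set)"
proof -
  have "convex hull S \<subseteq> cball 0 r"
    using assms by (intro hull_minimal) auto
  moreover have "emeasure lborel (cball 0 r :: 'a set) < \<infinity>"
    by (rule emeasure_bounded_finite) simp
  moreover have "closed (convex hull S)"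
    using assms by (simp add: finite_imp_compact_convex_hull compact_imp_closed)
  ultimately show ?thesis
    by (intro measure_mono_fmeasurable) (auto simp: fmeasurable_def)
qed

lemma convex_on_measure_hull_powr:
  fixes x :: "'i \<Rightarrow> 'a::euclidean_space"
  assumes "finite J" "i \<in> J" "p \<ge> 1"
  shows "convex_on UNIV (\<lambda>v. measure lborel (convex hull (x(i := v) ` J)) powr p)"
proof -
  have "x(i := v) ` J = insert v (x ` (J - {i}))" for v
    using assms(2) by force
  then show ?thesis
    using assms by (auto intro!: convex_on_powr convex_on_measure_hull_insert)
qed

section \<open>From the laws of the random points to expectations\<close>

lemma (in prob_space) expectation_inner_distr:
  fixes X :: "'a \<Rightarrow> 'b::euclidean_space"
  assumes X: "X \<in> borel_measurable M" and bd: "AE x in distr M borel X. norm x \<le> R"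
  shows "(\<integral>x. u \<bullet> x \<partial>distr M borel X) = u \<bullet> expectation X"
proof -
  have "integrable M X"
    using AE_distrD[OF X bd] X by (intro integrable_const_bound)
  moreover have "(\<integral>x. u \<bullet> x \<partial>distr M borel X) = expectation (\<lambda>\<omega>. u \<bullet> X \<omega>)"
    using X by (intro integral_distr) auto
  ultimately show ?thesis by simp
qed

lemma (in prob_space) nn_integral_iid:
  fixes X :: "'i \<Rightarrow> 'a \<Rightarrow> 'b::euclidean_space"
  assumes J: "J \<noteq> {}" and ind: "indep_vars (\<lambda>_. borel) X J"
    and X: "\<And>i. i \<in> J \<Longrightarrow> X i \<in> borel_measurable M \<and> distr M borel (X i) = \<mu>"
    and F: "F \<in> borel_measurable (PiM J (\<lambda>_. borel))"
  shows "(\<integral>\<^sup>+\<omega>. F (\<lambda>i\<in>J. X i \<omega>) \<partial>M) = (\<integral>\<^sup>+x. F x \<partial>PiM J (\<lambda>_. \<mu>))"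
proof -
  have m: "(\<lambda>\<omega>. \<lambda>i\<in>J. X i \<omega>) \<in> measurable M (PiM J (\<lambda>_. borel))"
    using X by (intro measurable_restrict) auto
  have "distr M (PiM J (\<lambda>_. borel)) (\<lambda>\<omega>. \<lambda>i\<in>J. X i \<omega>) = PiM J (\<lambda>i. distr M borel (X i))"
    using ind X by (subst (asm) indep_vars_iff_distr_eq_PiM'[OF J]) auto
  also have "\<dots> = PiM J (\<lambda>_. \<mu>)"
    using X by (intro PiM_cong) auto
  finally have "(\<integral>\<^sup>+x. F x \<partial>PiM J (\<lambda>_. \<mu>)) = (\<integral>\<^sup>+x. F x \<partial>distr M (PiM J (\<lambda>_. borel)) (\<lambda>\<omega>. \<lambda>i\<in>J. X i \<omega>))"
    by simp
  also have "\<dots> = (\<integral>\<^sup>+\<omega>. F (\<lambda>i\<in>J. X i \<omega>) \<partial>M)"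
    using m F by (intro nn_integral_distr) simp_all
  finally show ?thesis ..
qed

text \<open>The boundary law is the law of a random variable, hence a probability measure. From this
  come the regularity of the surface measure and its finite positive mass on the boundary, in both
  cases of the hypothesis.\<close>

lemma uniform_laws_convex_order:
  fixes K :: "'a::euclidean_space set"
  assumes K: "convex_body K" and M: "prob_space M"
    and I: "uniform_in M I K" and B: "uniform_on_boundary M B K"
    and cases: "(DIM('a) = 2 \<and> prob_space.expectation M I = prob_space.expectation M B) \<or>
         (circumscribed_polytope K \<and>
          (\<exists>c r. inscribed_sphere K c r \<and>
             c = prob_space.expectation M I \<and>
             prob_space.expectation M I = prob_space.expectation M B))"
    and f: "convex_on UNIV f"
  shows "(\<integral>x. f x \<partial>distr M borel I) \<le> (\<integral>x. f x \<partial>distr M borel B)"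
proof -
  interpret prob_space M by fact
  let ?H = "hausdorff_measure (DIM('a) - 1) :: 'a measure"
  have Im: "I \<in> borel_measurable M" and Id: "distr M borel I = uniform_measure lborel K"
    and Bm: "B \<in> borel_measurable M" and Bd: "distr M borel B = uniform_measure ?H (frontier K)"
    using I B by (auto simp: uniform_in_def uniform_on_boundary_def)
  have "prob_space (uniform_measure ?H (frontier K))"
    unfolding Bd[symmetric] by (rule prob_space_distr[OF Bm])
  note H = hausdorff_measure_normalizable[OF this borel_closed[OF frontier_closed]]
  have comp: "compact K"
    using K by (simp add: convex_body_def)
  obtain R where R: "\<And>x. x \<in> K \<Longrightarrow> norm x \<le> R"
    using compact_imp_bounded[OF comp] unfolding bounded_iff by blast
  have "AE x in distr M borel I. norm x \<le> R"
    unfolding Id using convex_body_emeasure[OF K] R by (intro AE_uniform_measureI) auto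
  from expectation_inner_distr[OF Im this]
  have mI: "(\<integral>x. u \<bullet> x \<partial>uniform_measure lborel K) = u \<bullet> expectation I" for u
    unfolding Id .
  have "frontier K \<subseteq> K"
    using comp by (simp add: compact_imp_closed frontier_subset_closed)
  then have "AE x in distr M borel B. norm x \<le> R"
    unfolding Bd using R by (intro AE_uniform_measureI) auto
  from expectation_inner_distr[OF Bm this]
  have mB: "(\<integral>x. u \<bullet> x \<partial>uniform_measure ?H (frontier K)) = u \<bullet> expectation B" for u
    unfolding Bd .
  show ?thesis
    unfolding Id Bd using cases
  proof (elim disjE conjE exE)
    assume d: "DIM('a) = 2" and e: "expectation I = expectation B"
    have d1: "DIM('a) - 1 = 1"
      using d by simp
    show "(\<integral>x. f x \<partial>uniform_measure lborel K) \<le> (\<integral>x. f x \<partial>uniform_measure ?H (frontier K))"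
      unfolding d1
    proof (rule planar_convex_order[OF d K _ H(3)[unfolded d1] _ f])
      show "(\<integral>x. u \<bullet> x \<partial>uniform_measure lborel K) = (\<integral>x. u \<bullet> x \<partial>uniform_measure (hausdorff_measure 1) (frontier K))" for u
        unfolding mI mB[unfolded d1] e ..
    qed (rule H(1)[unfolded d1])
  next
    fix c r assume "circumscribed_polytope K" and s: "inscribed_sphere K c r"
      and c: "c = expectation I" and e: "expectation I = expectation B"
    then have K': "polytope K" "interior K \<noteq> {}"
      by (auto simp: circumscribed_polytope_def)
    show "(\<integral>x. f x \<partial>uniform_measure lborel K) \<le> (\<integral>x. f x \<partial>uniform_measure ?H (frontier K))"
    proof (rule circumscribed_convex_order[OF K' s _ H(2,3) _ _ f])
      show "(\<integral>x. u \<bullet> x \<partial>uniform_measure lborel K) = u \<bullet> c" for u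
        unfolding mI c ..
      show "(\<integral>x. u \<bullet> x \<partial>uniform_measure ?H (frontier K)) = u \<bullet> c" for u
        unfolding mB c e ..
    qed (rule H(1))
  qed
qed

theorem corollary2:
  fixes K :: "'a::euclidean_space set"
    and M :: "'w measure"
    and I B :: "'w \<Rightarrow> 'a"
    and Is Bs :: "nat \<Rightarrow> 'w \<Rightarrow> 'a"
    and n :: nat and p :: real
  assumes "convex_body K"
    and "prob_space M"
    and "uniform_in M I K"
    and "uniform_on_boundary M B K"
    and "(DIM('a) = 2 \<and> prob_space.expectation M I = prob_space.expectation M B) \<or>
         (circumscribed_polytope K \<and>
          (\<exists>c r. inscribed_sphere K c r \<and>
             c = prob_space.expectation M I \<and>
             prob_space.expectation M I = prob_space.expectation M B))"
    and "n \<ge> 1"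
    and "prob_space.indep_vars M (\<lambda>_. borel) Is {1..n}"
    and "\<And>i. i \<in> {1..n} \<Longrightarrow> uniform_in M (Is i) K"
    and "prob_space.indep_vars M (\<lambda>_. borel) Bs {1..n}"
    and "\<And>i. i \<in> {1..n} \<Longrightarrow> uniform_on_boundary M (Bs i) K"
    and "p \<ge> 1"
  shows "prob_space.expectation M
           (\<lambda>\<omega>. measure lborel (convex hull ((\<lambda>i. Is i \<omega>) ` {1..n})) powr p)
       \<le> prob_space.expectation M
           (\<lambda>\<omega>. measure lborel (convex hull ((\<lambda>i. Bs i \<omega>) ` {1..n})) powr p)"
proof -
  interpret prob_space M by fact
  define J where "J = {1..n}"
  have J: "finite J" "J \<noteq> {}"
    using \<open>n \<ge> 1\<close> by (auto simp: J_def)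
  define G where "G x = measure lborel (convex hull (x ` J)) powr p" for x :: "nat \<Rightarrow> 'a"
  let ?P = "PiM J (\<lambda>_. borel :: 'a measure)" and ?\<mu> = "distr M borel I" and ?\<nu> = "distr M borel B"
  have Im: "I \<in> borel_measurable M" and Bm: "B \<in> borel_measurable M"
    and Id: "?\<mu> = uniform_measure lborel K"
    and Bd: "?\<nu> = uniform_measure (hausdorff_measure (DIM('a) - 1)) (frontier K)"
    using assms(3,4) by (auto simp: uniform_in_def uniform_on_boundary_def)
  have Is: "Is i \<in> borel_measurable M \<and> distr M borel (Is i) = ?\<mu>"
    and Bs: "Bs i \<in> borel_measurable M \<and> distr M borel (Bs i) = ?\<nu>" if "i \<in> J" for i
    using assms(8,10)[of i] that unfolding Id Bd by (auto simp: uniform_in_def uniform_on_boundary_def J_def)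
  have comp: "compact K"
    using assms(1) by (simp add: convex_body_def)
  obtain R where R: "\<And>x. x \<in> K \<Longrightarrow> norm x \<le> R"
    using compact_imp_bounded[OF comp] unfolding bounded_iff by blast
  have bI: "AE x in ?\<mu>. norm x \<le> R"
    unfolding Id using convex_body_emeasure[OF assms(1)] R by (intro AE_uniform_measureI) auto
  have "frontier K \<subseteq> K"
    using comp by (simp add: compact_imp_closed frontier_subset_closed)
  then have bB: "AE x in ?\<nu>. norm x \<le> R"
    unfolding Bd using R by (intro AE_uniform_measureI) auto
  have Gm: "G \<in> borel_measurable ?P"
    unfolding G_def using measurable_measure_hull[OF J] by measurable
  have Gnn: "0 \<le> G x" for x
    by (simp add: G_def)
  have Gbd: "G x \<le> measure lborel (cball 0 r :: 'a set) powr p" if "\<forall>i\<in>J. norm (x i) \<le> r" for x r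
    unfolding G_def using J that \<open>p \<ge> 1\<close> by (intro powr_mono2 measure_hull_le) auto
  have order: "(\<integral>\<^sup>+x. ennreal (G x) \<partial>PiM J (\<lambda>_. ?\<mu>)) \<le> (\<integral>\<^sup>+x. ennreal (G x) \<partial>PiM J (\<lambda>_. ?\<nu>))"
  proof (rule product_convex_order[OF _ _ bI _ _ bB _ J(1) Gm Gnn])
    show "(\<integral>x. f x \<partial>?\<mu>) \<le> (\<integral>x. f x \<partial>?\<nu>)" if "convex_on UNIV f" for f
      by (rule uniform_laws_convex_order[OF assms(1-5) that])
    show "convex_on UNIV (\<lambda>v. G (x(i := v)))" if "i \<in> J" for x i
      unfolding G_def by (rule convex_on_measure_hull_powr[OF J(1) that \<open>p \<ge> 1\<close>])
    show "\<exists>\<beta>. \<forall>x\<in>space ?P. (\<forall>i\<in>J. norm (x i) \<le> r) \<longrightarrow> G x \<le> \<beta>" for r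
      using Gbd by blast
  qed (auto intro: prob_space_distr Im Bm)
  have Gm': "(\<lambda>x. ennreal (G x)) \<in> borel_measurable ?P"
    using Gm by measurable
  \<comment> \<open>The hull depends only on the points with index in \<open>J\<close>, so
    restricting a family to \<open>J\<close> leaves \<open>G\<close> unchanged.\<close>
  have Gres: "G (\<lambda>i\<in>J. X i) = G X" for X
    by (simp add: G_def)
  have GX: "(\<lambda>\<omega>. G (\<lambda>i. X i \<omega>)) \<in> borel_measurable M" if "\<And>i. i \<in> J \<Longrightarrow> X i \<in> borel_measurable M" for X
  proof -
    have "(\<lambda>\<omega>. \<lambda>i\<in>J. X i \<omega>) \<in> measurable M ?P"
      using that by (intro measurable_restrict) auto
    from measurable_compose[OF this Gm] show ?thesis
      unfolding Gres .
  qed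
  have le: "(\<integral>\<^sup>+\<omega>. ennreal (G (\<lambda>i. Is i \<omega>)) \<partial>M) \<le> (\<integral>\<^sup>+\<omega>. ennreal (G (\<lambda>i. Bs i \<omega>)) \<partial>M)"
    using order nn_integral_iid[OF J(2) _ Is Gm'] nn_integral_iid[OF J(2) _ Bs Gm'] assms(7,9)
    unfolding Gres by (simp add: J_def)
  \<comment> \<open>\<open>enn2real\<close> sends infinity to 0 and is monotone only below a finite
    bound. The boundary points are almost surely bounded, so the larger nonnegative integral is
    finite and the inequality passes to expectations.\<close>
  have "AE \<omega> in M. \<forall>i\<in>J. norm (Bs i \<omega>) \<le> R"
  proof (rule AE_finite_allI[OF J(1)])
    fix i assume i: "i \<in> J"
    have "AE x in distr M borel (Bs i). norm x \<le> R"
      using bB unfolding conjunct2[OF Bs[OF i]] .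
    then show "AE \<omega> in M. norm (Bs i \<omega>) \<le> R"
      using Bs[OF i] by (intro AE_distrD[of "Bs i" M borel]) auto
  qed
  then have "AE \<omega> in M. norm (G (\<lambda>i. Bs i \<omega>)) \<le> measure lborel (cball 0 R :: 'a set) powr p"
    by eventually_elim (use Gbd Gnn in auto)
  then have "integrable M (\<lambda>\<omega>. G (\<lambda>i. Bs i \<omega>))"
    using GX Bs by (intro integrable_const_bound) auto
  then have fin: "(\<integral>\<^sup>+\<omega>. ennreal (G (\<lambda>i. Bs i \<omega>)) \<partial>M) < \<top>"
    using Gnn by (subst nn_integral_eq_integral) auto
  have "expectation (\<lambda>\<omega>. G (\<lambda>i. Is i \<omega>)) \<le> expectation (\<lambda>\<omega>. G (\<lambda>i. Bs i \<omega>))"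
    using GX Is Bs Gnn enn2real_mono[OF le fin] by (subst (1 2) integral_eq_nn_integral) auto
  then show ?thesis
    by (simp add: G_def J_def)
qed

end
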